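(* Fix a constant $\Delta$ and let $\mathcal{G}$ be the family of all trees of maximum degree at most $\Delta$. Let $\Pi$ be an LCL problem on $\mathcal{G}$. If $\Pi$ is $T$-mendable for some function $T$ with $T(n) = o(n)$, then $\Pi$ is $T'$-mendable for some function $T'$ with $T'(n) = O(\log n)$. In other words, there is no LCL problem on trees whose mending radius is between $\omega(\log n)$ and $o(n)$.
   Context: A locally verifiable problem $\Pi$ on a graph family $\mathcal{G}$ is given by a set $\Sigma$ of input labels, a set $\Gamma$ of output labels and a verifier $\psi$ with verification radius $r\in\mathbb{N}$: for a graph $G=(V,E)\in\mathcal{G}$ with input labeling $\sigma:V\to\Sigma$, an output labeling $\lambda:V\to\Gamma$ and a node $v$, $\psi(G,\lambda,v)\in\{\text{happy},\text{unhappy}\}$ depends only on the radius-$r$ neighborhood of $v$ (its structure together with input and output labels, up to isomorphism). $\lambda$ is a solution if $\psi$ is happy at every node. $\Pi$ is an LCL problem if $\Sigma,\Gamma$ are finite and all graphs in $\mathcal{G}$ have maximum degree bounded by a constant. Partial labelings are maps $\lambda:V\to\Gamma\cup\{\bot\}$; the relaxed verifier $\psi^*$ is happy at $v$ if some node within distance $r$ of $v$ has label $\bot$, and otherwise $\psi^*(G,\lambda,v)=\psi(G,\lambda',v)$ for any $\lambda':V\to\Gamma$ agreeing with $\lambda$ on the radius-$r$ neighborhood of $v$; $\psi^*$ accepts $\lambda$ if it is happy at all nodes. Given $\lambda$ accepted by $\psi^*$ and a node $v$, a $t$-mend of $\lambda$ at $v$ is a partial labeling $\mu$ such that $\psi^*$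 accepts $\mu$, $\mu(v)\neq\bot$, $\mu(u)=\bot$ implies $\lambda(u)=\bot$, and $\mu(u)\neq\lambda(u)$ implies $u$ is within distance $t$ of $v$. For $T:\mathbb{N}\to\mathbb{N}$, a verifier $\psi$ is $T$-mendable if for every $G\in\mathcal{G}$ with $n$ nodes, every partial labeling $\lambda$ accepted by $\psi^*$ and every node $v$, a $T(n)$-mend of $\lambda$ at $v$ exists. The problem $\Pi$ is $T$-mendable if for some $r$ there is a radius-$r$ verifier for $\Pi$ (i.e., one accepting exactly the solutions of $\Pi$) that is $T$-mendable. *)

theory Defs
  imports Main "HOL-Library.Landau_Symbols"
begin

definition walk :: "nat set \<Rightarrow> (nat \<Rightarrow> nat \<Rightarrow> bool) \<Rightarrow> nat list \<Rightarrow> bool" where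
  "walk V E xs \<longleftrightarrow> xs \<noteq> [] \<and> set xs \<subseteq> V \<and>
     (\<forall>i. Suc i < length xs \<longrightarrow> E (xs ! i) (xs ! Suc i))"

definition ball :: "nat set \<Rightarrow> (nat \<Rightarrow> nat \<Rightarrow> bool) \<Rightarrow> nat \<Rightarrow> nat \<Rightarrow> nat set" where
  "ball V E v r = {u \<in> V. \<exists>xs. walk V E xs \<and> hd xs = v \<and> last xs = u \<and> length xs \<le> Suc r}"

definition simple_graph :: "nat set \<Rightarrow> (nat \<Rightarrow> nat \<Rightarrow> bool) \<Rightarrow> bool" where
  "simple_graph V E \<longleftrightarrow> finite V \<and> (\<forall>u v. E u v \<longrightarrow> u \<in> V \<and> v \<in> V) \<and>
     (\<forall>u v. E u v \<longrightarrow> E v u) \<and> (\<forall>u. \<not> E u u)"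

definition connected_graph :: "nat set \<Rightarrow> (nat \<Rightarrow> nat \<Rightarrow> bool) \<Rightarrow> bool" where
  "connected_graph V E \<longleftrightarrow>
     (\<forall>u\<in>V. \<forall>v\<in>V. \<exists>xs. walk V E xs \<and> hd xs = u \<and> last xs = v)"

definition has_cycle :: "nat set \<Rightarrow> (nat \<Rightarrow> nat \<Rightarrow> bool) \<Rightarrow> bool" where
  "has_cycle V E \<longleftrightarrow>
     (\<exists>xs. walk V E xs \<and> distinct xs \<and> length xs \<ge> 3 \<and> E (last xs) (hd xs))"

definition is_tree :: "nat set \<Rightarrow> (nat \<Rightarrow> nat \<Rightarrow> bool) \<Rightarrow> bool" where
  "is_tree V E \<longleftrightarrow> simple_graph V E \<and> V \<noteq> {} \<and> connected_graph V E \<and> \<not> has_cycle V E"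

definition bdd_tree :: "nat \<Rightarrow> nat set \<Rightarrow> (nat \<Rightarrow> nat \<Rightarrow> bool) \<Rightarrow> bool" where
  "bdd_tree \<Delta> V E \<longleftrightarrow> is_tree V E \<and> (\<forall>v\<in>V. card {u \<in> V. E v u} \<le> \<Delta>)"

type_synonym ('i, 'o) verifier =
  "nat set \<Rightarrow> (nat \<Rightarrow> nat \<Rightarrow> bool) \<Rightarrow> (nat \<Rightarrow> 'i) \<Rightarrow> (nat \<Rightarrow> 'o) \<Rightarrow> nat \<Rightarrow> bool"

definition local_verifier ::
  "(nat set \<Rightarrow> (nat \<Rightarrow> nat \<Rightarrow> bool) \<Rightarrow> bool) \<Rightarrow> nat \<Rightarrow> ('i, 'o) verifier \<Rightarrow> bool" where
  "local_verifier F r \<psi> \<longleftrightarrow>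
    (\<forall>V1 E1 V2 E2 (\<sigma>1 :: nat \<Rightarrow> 'i) \<sigma>2 (l1 :: nat \<Rightarrow> 'o) l2 v1 v2 f.
       F V1 E1 \<longrightarrow> F V2 E2 \<longrightarrow> v1 \<in> V1 \<longrightarrow> v2 \<in> V2 \<longrightarrow>
       bij_betw f (ball V1 E1 v1 r) (ball V2 E2 v2 r) \<longrightarrow> f v1 = v2 \<longrightarrow>
       (\<forall>x\<in>ball V1 E1 v1 r. \<forall>y\<in>ball V1 E1 v1 r. E1 x y \<longleftrightarrow> E2 (f x) (f y)) \<longrightarrow>
       (\<forall>x\<in>ball V1 E1 v1 r. \<sigma>2 (f x) = \<sigma>1 x \<and> l2 (f x) = l1 x) \<longrightarrow>
       \<psi> V1 E1 \<sigma>1 l1 v1 = \<psi> V2 E2 \<sigma>2 l2 v2)"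

text \<open>Relaxed verifier on partial labelings (None plays the role of \<bottom>).\<close>
definition relaxed_happy ::
  "nat \<Rightarrow> ('i, 'o) verifier \<Rightarrow> nat set \<Rightarrow> (nat \<Rightarrow> nat \<Rightarrow> bool) \<Rightarrow> (nat \<Rightarrow> 'i)
     \<Rightarrow> (nat \<Rightarrow> 'o option) \<Rightarrow> nat \<Rightarrow> bool" where
  "relaxed_happy r \<psi> V E \<sigma> \<mu> v \<longleftrightarrow>
     (\<exists>u\<in>ball V E v r. \<mu> u = None) \<or>
     (\<forall>l'. (\<forall>u\<in>ball V E v r. \<mu> u = Some (l' u)) \<longrightarrow> \<psi> V E \<sigma> l' v)"

definition relaxed_accepts ::
  "nat \<Rightarrow> ('i, 'o) verifier \<Rightarrow> nat set \<Rightarrow> (nat \<Rightarrow> nat \<Rightarrow> bool) \<Rightarrow> (nat \<Rightarrow> 'i)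
     \<Rightarrow> (nat \<Rightarrow> 'o option) \<Rightarrow> bool" where
  "relaxed_accepts r \<psi> V E \<sigma> \<mu> \<longleftrightarrow> (\<forall>v\<in>V. relaxed_happy r \<psi> V E \<sigma> \<mu> v)"

definition is_mend ::
  "nat \<Rightarrow> ('i, 'o) verifier \<Rightarrow> nat set \<Rightarrow> (nat \<Rightarrow> nat \<Rightarrow> bool) \<Rightarrow> (nat \<Rightarrow> 'i)
     \<Rightarrow> (nat \<Rightarrow> 'o option) \<Rightarrow> nat \<Rightarrow> nat \<Rightarrow> (nat \<Rightarrow> 'o option) \<Rightarrow> bool" where
  "is_mend r \<psi> V E \<sigma> \<mu> v t \<mu>' \<longleftrightarrow>
     relaxed_accepts r \<psi> V E \<sigma> \<mu>' \<and> \<mu>' v \<noteq> None \<and>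
     (\<forall>u. \<mu>' u = None \<longrightarrow> \<mu> u = None) \<and>
     (\<forall>u. \<mu>' u \<noteq> \<mu> u \<longrightarrow> u \<in> ball V E v t)"

definition verifier_mendable ::
  "(nat set \<Rightarrow> (nat \<Rightarrow> nat \<Rightarrow> bool) \<Rightarrow> bool) \<Rightarrow> nat \<Rightarrow> ('i, 'o) verifier \<Rightarrow> (nat \<Rightarrow> nat) \<Rightarrow> bool" where
  "verifier_mendable F r \<psi> T \<longleftrightarrow>
     (\<forall>V E \<sigma> \<mu> v. F V E \<longrightarrow> relaxed_accepts r \<psi> V E \<sigma> \<mu> \<longrightarrow> v \<in> V \<longrightarrow>
        (\<exists>\<mu>'. is_mend r \<psi> V E \<sigma> \<mu> v (T (card V)) \<mu>'))"

text \<open>psi is a radius-r verifier for the problem whose solutions are those accepted by psi0.\<close>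
definition verifier_for ::
  "(nat set \<Rightarrow> (nat \<Rightarrow> nat \<Rightarrow> bool) \<Rightarrow> bool) \<Rightarrow> ('i, 'o) verifier \<Rightarrow> nat \<Rightarrow> ('i, 'o) verifier \<Rightarrow> bool" where
  "verifier_for F \<psi>0 r \<psi> \<longleftrightarrow> local_verifier F r \<psi> \<and>
     (\<forall>V E \<sigma> l. F V E \<longrightarrow> ((\<forall>v\<in>V. \<psi> V E \<sigma> l v) \<longleftrightarrow> (\<forall>v\<in>V. \<psi>0 V E \<sigma> l v)))"

definition problem_mendable ::
  "(nat set \<Rightarrow> (nat \<Rightarrow> nat \<Rightarrow> bool) \<Rightarrow> bool) \<Rightarrow> ('i, 'o) verifier \<Rightarrow> (nat \<Rightarrow> nat) \<Rightarrow> bool" where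
  "problem_mendable F \<psi>0 T \<longleftrightarrow>
     (\<exists>r \<psi>. verifier_for F \<psi>0 r \<psi> \<and> verifier_mendable F r \<psi> T)"

end

theory Submission
  imports Defs "HOL-Library.Discrete_Functions"
begin

text \<open>Let \<open>\<psi>\<close> be \<open>o(n)\<close>-mendable. A hole is mended by erasing labels further away, mending in the small component
  that remains, and then mending the erased vertices. To make this end within logarithmic distance, root the tree
  at the hole and give each vertex the level \<open>\<lfloor>log\<^sub>2 (size of its subtree)\<rfloor>\<close>. At most one child has the level of its
  parent, so every level class is a union of vertical chains, and along a descending path the level only drops.
  Chains of length more than \<open>2 d\<close>, for a constant \<open>d\<close>, are cut in the middle by erasing both ends of an edge; the
  component of the root then has logarithmic depth and can be relabelled at will.

  It remains to mend a hole in the middle of a chain of constant length \<open>2 d\<close> without touching the ends of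
  the chain, after cutting the long chains in the side trees, all of lower level. This creates new holes of
  lower level only. The cut side trees are not of bounded size, but only finitely many types of side trees exist, where the
  type records how relabellings can look near the root. Replacing each side tree by a smallest one of its
  type gives a tree with \<open>O(d)\<close> vertices, where by the choice of \<open>d\<close> the \<open>o(n)\<close>-mend stays away from the ends;
  equality of types carries the mend back.\<close>

subsection \<open>Balls and rooted trees\<close>

text \<open>The order of the constants matters: \<open>K\<close>, the size bound for the
  representatives, depends only on \<open>\<Delta>\<close>, \<open>r\<close> and
  \<open>\<psi>\<close>, and \<open>d\<close> is chosen after it. A shrunken caterpillar has between
  \<open>2 * d + 1\<close> and \<open>(2 * d + 1) * K\<close> vertices. Since \<open>T\<close> need
  not be monotone, both bounds are used: the lower one passes the threshold hidden in o(n), the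
  upper one is linear in \<open>d\<close>. So the mend has radius at most \<open>t\<close> with
  \<open>t + 2 * r < d\<close>. Both ends of a cut edge are erased because each has a task: the
  inner one makes the restriction acceptable as a tree of its own, the outer one hides the new
  labels from the rest. Both are midpoints of chains, so both can be mended. The bound is
  logarithmic and not its square because the way to a new hole is paid for by the levels lost, and
  the total telescopes along the recursion.\<close>

lemma walk_iff_successively:
  "walk V E xs \<longleftrightarrow> xs \<noteq> [] \<and> set xs \<subseteq> V \<and> successively E xs"
proof -
  have "(\<forall>i. Suc i < length xs \<longrightarrow> E (xs ! i) (xs ! Suc i)) \<longleftrightarrow> successively E xs"
  proof (induction xs)
    case (Cons x xs)
    show ?case
    proof (cases xs)
      case (Cons y ys)
      have "(\<forall>i. Suc i < length (x # xs) \<longrightarrow> E ((x # xs) ! i) ((x # xs) ! Suc i)) \<longleftrightarrow>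
        E x y \<and> (\<forall>i. Suc i < length xs \<longrightarrow> E (xs ! i) (xs ! Suc i))" (is "?l \<longleftrightarrow> ?r")
      proof
        assume l: ?l
        show ?r
        proof
          show "E x y" using l[rule_format, of 0] Cons by simp
          show "\<forall>i. Suc i < length xs \<longrightarrow> E (xs ! i) (xs ! Suc i)"
            using l by (metis Suc_less_eq length_Cons nth_Cons_Suc)
        qed
      next
        assume ?r
        then show ?l using Cons by (auto simp: nth_Cons split: nat.splits)
      qed
      then show ?thesis using Cons.IH Cons by simp
    qed simp
  qed simp
  then show ?thesis unfolding walk_def by blast
qed

lemma ball_0: "v \<in> V \<Longrightarrow> ball V E v 0 = {v}"
proof -
  assume "v \<in> V"
  then have "walk V E [v]" by (simp add: walk_iff_successively)
  then show ?thesis using \<open>v \<in> V\<close> unfolding ball_def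
    by (auto simp: walk_def le_Suc_eq length_Suc_conv intro!: exI[of _ "[v]"])
qed

lemma ball_subset: "ball V E v n \<subseteq> V"
  by (auto simp: ball_def)

lemma center_in_ball: "v \<in> V \<Longrightarrow> v \<in> ball V E v n"
  unfolding ball_def by (auto simp: walk_iff_successively intro!: exI[of _ "[v]"])

lemma ball_Suc:
  assumes "simple_graph V E"
  shows "u \<in> ball V E v (Suc n) \<longleftrightarrow> u \<in> ball V E v n \<or> (\<exists>w\<in>ball V E v n. E w u)"
proof
  assume "u \<in> ball V E v (Suc n)"
  then obtain xs where xs: "walk V E xs" "hd xs = v" "last xs = u" "length xs \<le> Suc (Suc n)" "u \<in> V"
    by (auto simp: ball_def)
  show "u \<in> ball V E v n \<or> (\<exists>w\<in>ball V E v n. E w u)"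
  proof (cases "length xs \<le> Suc n")
    case True
    then show ?thesis using xs by (auto simp: ball_def)
  next
    case False
    obtain ys y where ys: "xs = ys @ [y]" using xs(1) by (metis walk_def rev_exhaust)
    then have "ys \<noteq> []" using False by auto
    then have "walk V E ys" "hd ys = v" "E (last ys) u" "length ys \<le> Suc n" "last ys \<in> V"
      using xs ys by (auto simp: walk_iff_successively successively_append_iff)
    then show ?thesis by (auto simp: ball_def)
  qed
next
  assume "u \<in> ball V E v n \<or> (\<exists>w\<in>ball V E v n. E w u)"
  then show "u \<in> ball V E v (Suc n)"
  proof
    assume "u \<in> ball V E v n"
    then show ?thesis by (auto simp: ball_def)
  next
    assume "\<exists>w\<in>ball V E v n. E w u"
    then obtain w xs where "E w u" "walk V E xs" "hd xs = v" "last xs = w" "length xs \<le> Suc n"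
      by (auto simp: ball_def)
    moreover have "u \<in> V" using assms \<open>E w u\<close> by (auto simp: simple_graph_def)
    ultimately show ?thesis
      by (auto simp: ball_def walk_iff_successively successively_append_iff intro!: exI[of _ "xs @ [u]"])
  qed
qed

lemma ball_mono: "m \<le> n \<Longrightarrow> ball V E v m \<subseteq> ball V E v n"
  unfolding ball_def by fastforce

lemma ball_trans:
  assumes "simple_graph V E"
  shows "u \<in> ball V E v m \<Longrightarrow> w \<in> ball V E u n \<Longrightarrow> w \<in> ball V E v (m + n)"
proof (induction n arbitrary: w)
  case 0
  then have "u \<in> V" using ball_subset by blast
  then show ?case using 0 by (simp add: ball_0)
next
  case (Suc n)
  then show ?case using ball_Suc[OF assms] by (metis add_Suc_right)
qed

lemma ball_edge:
  assumes "simple_graph V E" "E v u"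
  shows "u \<in> ball V E v (Suc n)"
  using assms ball_Suc center_in_ball by (metis simple_graph_def)

lemma ball_sym:
  assumes "simple_graph V E" "v \<in> V"
  shows "u \<in> ball V E v n \<Longrightarrow> v \<in> ball V E u n"
proof (induction n arbitrary: u)
  case 0
  then show ?case using assms by (simp add: ball_0)
next
  case (Suc n)
  from Suc.prems consider "u \<in> ball V E v n" | w where "w \<in> ball V E v n" "E w u"
    using ball_Suc[OF assms(1)] by blast
  then show ?case
  proof cases
    case 1
    then show ?thesis using Suc.IH[OF 1] ball_mono[of n "Suc n" V E u] by auto
  next
    case 2
    then have "w \<in> ball V E u 1"
      using ball_edge[OF assms(1), of u w 0] assms(1) by (auto simp: simple_graph_def)
    then show ?thesis using ball_trans[OF assms(1) _ Suc.IH[OF 2(1)]] by force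
  qed
qed

lemma ball_map_subset:
  assumes "simple_graph V1 E1" "simple_graph V2 E2" "u \<in> V1" "f u \<in> V2"
    and "ball V1 E1 u n \<subseteq> D" "\<And>a b. a \<in> D \<Longrightarrow> b \<in> D \<Longrightarrow> E1 a b \<Longrightarrow> E2 (f a) (f b)"
  shows "f ` ball V1 E1 u n \<subseteq> ball V2 E2 (f u) n"
  using assms(5)
proof (induction n)
  case 0
  then show ?case using assms by (simp add: ball_0)
next
  case (Suc n)
  have sub: "ball V1 E1 u n \<subseteq> D" using Suc.prems ball_mono[of n "Suc n"] by force
  show ?case
  proof
    fix y assume "y \<in> f ` ball V1 E1 u (Suc n)"
    then obtain x where x: "x \<in> ball V1 E1 u (Suc n)" "y = f x" by blast
    then consider "x \<in> ball V1 E1 u n" | w where "w \<in> ball V1 E1 u n" "E1 w x"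
      using ball_Suc[OF assms(1)] by blast
    then show "y \<in> ball V2 E2 (f u) (Suc n)"
    proof cases
      case 1
      then show ?thesis using Suc.IH[OF sub] x ball_Suc[OF assms(2)] by blast
    next
      case 2
      then have "f w \<in> ball V2 E2 (f u) n" "E2 (f w) y"
        using Suc.IH[OF sub] x assms(6)[of w x] sub Suc.prems by blast+
      then show ?thesis using ball_Suc[OF assms(2)] by blast
    qed
  qed
qed

lemma ball_iso:
  assumes "simple_graph V1 E1" "simple_graph V2 E2" "u \<in> V1" "f u \<in> V2"
    and "bij_betw f D1 D2" "ball V1 E1 u n \<subseteq> D1" "ball V2 E2 (f u) n \<subseteq> D2"
    and "\<And>a b. a \<in> D1 \<Longrightarrow> b \<in> D1 \<Longrightarrow> E1 a b \<longleftrightarrow> E2 (f a) (f b)"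
  shows "f ` ball V1 E1 u n = ball V2 E2 (f u) n"
proof
  show "f ` ball V1 E1 u n \<subseteq> ball V2 E2 (f u) n"
    using assms by (intro ball_map_subset[where D = D1]) auto
  let ?g = "inv_into D1 f"
  have uD: "u \<in> D1" using assms(3,6) center_in_ball by blast
  then have gu: "?g (f u) = u" using assms(5) by (simp add: bij_betw_def)
  have fg: "f (?g y) = y" "?g y \<in> D1" if "y \<in> D2" for y
    using that assms(5) by (auto simp: bij_betw_def f_inv_into_f inv_into_into)
  have "?g ` ball V2 E2 (f u) n \<subseteq> ball V1 E1 (?g (f u)) n"
  proof (rule ball_map_subset[where D = D2])
    fix a b assume "a \<in> D2" "b \<in> D2" "E2 a b"
    then show "E1 (?g a) (?g b)" using assms(8)[of "?g a" "?g b"] fg by auto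
  qed (use assms gu in auto)
  then have "y \<in> f ` ball V1 E1 u n" if "y \<in> ball V2 E2 (f u) n" for y
    using that fg(1)[of y] assms(7) gu by (metis imageI image_subset_iff subset_iff)
  then show "ball V2 E2 (f u) n \<subseteq> f ` ball V1 E1 u n" by blast
qed

text \<open>Follow a walk from \<open>u\<close> until it first leaves \<open>A\<close>. The part
  before stays in \<open>A\<close>, so the inner end \<open>a\<close> of the crossing edge is close
  to \<open>u\<close> even when distances are measured inside \<open>A\<close>. This makes an erased
  boundary visible in the induced tree.\<close>

lemma ball_exit:
  assumes "simple_graph V E" "u \<in> A" "u \<in> V" "\<not> ball V E u n \<subseteq> A"
  obtains a b where "a \<in> A" "b \<notin> A" "E a b" "a \<in> ball V E u n" "b \<in> ball V E u n"
    "a \<in> ball (V \<inter> A) (\<lambda>x y. E x y \<and> x \<in> A \<and> y \<in> A) u n"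
proof -
  let ?E = "\<lambda>x y. E x y \<and> x \<in> A \<and> y \<in> A"
  have sg: "simple_graph (V \<inter> A) ?E" using assms(1) by (auto simp: simple_graph_def)
  have "ball V E u n \<subseteq> ball (V \<inter> A) ?E u n \<or>
     (\<exists>a b. a \<in> A \<and> b \<notin> A \<and> E a b \<and> a \<in> ball V E u n \<and> b \<in> ball V E u n \<and> a \<in> ball (V \<inter> A) ?E u n)"
  proof (induction n)
    case 0
    then show ?case using assms by (simp add: ball_0)
  next
    case (Suc n)
    then show ?case
    proof
      assume sub: "ball V E u n \<subseteq> ball (V \<inter> A) ?E u n"
      show ?thesis
      proof (cases "ball V E u (Suc n) \<subseteq> A")
        case True
        have "x \<in> ball (V \<inter> A) ?E u (Suc n)" if x: "x \<in> ball V E u (Suc n)" for x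
        proof -
          from x consider "x \<in> ball V E u n" | w where "w \<in> ball V E u n" "E w x"
            using ball_Suc[OF assms(1)] by blast
          then show ?thesis
          proof cases
            case 1
            then show ?thesis using sub ball_Suc[OF sg] by blast
          next
            case 2
            then have "w \<in> A" using sub ball_subset by blast
            then show ?thesis using sub ball_Suc[OF sg] 2 True x by blast
          qed
        qed
        then show ?thesis by blast
      next
        case False
        then obtain b where b: "b \<in> ball V E u (Suc n)" "b \<notin> A" by blast
        then have "b \<notin> ball V E u n" using sub ball_subset by blast
        then obtain w where w: "w \<in> ball V E u n" "E w b" using ball_Suc[OF assms(1)] b by blast
        then have "w \<in> A" using sub ball_subset by blast
        then show ?thesis using w b sub ball_mono[of n "Suc n"] by (meson le_SucI order_refl subsetD)
      qed
    next
      assume "\<exists>a b. a \<in> A \<and> b \<notin> A \<and> E a b \<and> a \<in> ball V E u n \<and> b \<in> ball V E u n \<and> a \<in> ball (V \<inter> A) ?E u n"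
      then show ?thesis using ball_mono[of n "Suc n"] by (meson le_SucI order_refl subsetD)
    qed
  qed
  then show ?thesis using assms(4) ball_subset that by blast
qed

text \<open>The loop \<open>p v = v\<close> makes all iterates of \<open>p\<close> meaningful.
  \<open>h\<close> is any measure that decreases towards the root, not necessarily the depth, so it
  survives restriction to a subtree with another root.\<close>

definition rooted :: "nat set \<Rightarrow> (nat \<Rightarrow> nat \<Rightarrow> bool) \<Rightarrow> nat \<Rightarrow> (nat \<Rightarrow> nat) \<Rightarrow> (nat \<Rightarrow> nat) \<Rightarrow> bool" where
  "rooted V E v p h \<longleftrightarrow> finite V \<and> v \<in> V \<and> p v = v \<and> (\<forall>y\<in>V. p y \<in> V) \<and>
     (\<forall>y\<in>V. y \<noteq> v \<longrightarrow> h (p y) < h y) \<and>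
     (\<forall>a b. E a b \<longleftrightarrow> a \<in> V \<and> b \<in> V \<and> a \<noteq> b \<and> (p a = b \<or> p b = a))"

lemma rooted_simple_graph: "rooted V E v p h \<Longrightarrow> simple_graph V E"
  unfolding rooted_def simple_graph_def by blast

lemma rooted_funpow:
  assumes "rooted V E v p h" "y \<in> V"
  shows "(p ^^ m) y \<in> V"
  using assms by (induction m) (auto simp: rooted_def)

lemma rooted_reach:
  assumes "rooted V E v p h" "y \<in> V"
  shows "\<exists>m. (p ^^ m) y = v"
  using assms(2)
proof (induction "h y" arbitrary: y rule: less_induct)
  case less
  show ?case
  proof (cases "y = v")
    case True
    then show ?thesis by (intro exI[of _ 0]) simp
  next
    case False
    then obtain m where "(p ^^ m) (p y) = v" using less assms(1) by (meson rooted_def)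
    then show ?thesis by (intro exI[of _ "Suc m"]) (simp add: funpow_swap1)
  qed
qed

lemma rooted_funpow_ball:
  assumes "rooted V E v p h" "y \<in> V"
  shows "y \<in> ball V E ((p ^^ m) y) m"
  using assms(2)
proof (induction m arbitrary: y)
  case 0
  then show ?case by (simp add: center_in_ball)
next
  case (Suc m)
  note sg = rooted_simple_graph[OF assms(1)]
  have "p y \<in> V" using Suc.prems assms(1) by (auto simp: rooted_def)
  then have 1: "p y \<in> ball V E ((p ^^ Suc m) y) m" using Suc.IH[of "p y"] by (simp add: funpow_swap1)
  show ?case
  proof (cases "p y = y")
    case True
    then show ?thesis using 1 ball_mono[of m "Suc m"] by auto
  next
    case False
    then have "E (p y) y" using \<open>p y \<in> V\<close> Suc.prems assms(1) by (auto simp: rooted_def)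
    then show ?thesis using 1 ball_Suc[OF sg] by blast
  qed
qed

lemma ball_imp_connected:
  assumes "\<And>u v. u \<in> V \<Longrightarrow> v \<in> V \<Longrightarrow> \<exists>n. v \<in> ball V E u n"
  shows "connected_graph V E"
  using assms unfolding connected_graph_def ball_def by blast

lemma rooted_is_tree:
  assumes R: "rooted V E v p h"
  shows "is_tree V E"
proof -
  note sg = rooted_simple_graph[OF R]
  have conn: "connected_graph V E"
  proof (rule ball_imp_connected)
    fix a b assume ab: "a \<in> V" "b \<in> V"
    obtain m m' where "(p ^^ m) a = v" "(p ^^ m') b = v" using ab rooted_reach[OF R] by metis
    then have "a \<in> ball V E v m" "b \<in> ball V E v m'" using ab rooted_funpow_ball[OF R] by metis+
    then have "b \<in> ball V E a (m + m')"
      using ball_trans[OF sg] ball_sym[OF sg] R by (meson rooted_def)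
    then show "\<exists>n. b \<in> ball V E a n" by blast
  qed
  have "\<not> has_cycle V E"
  proof
    assume "has_cycle V E"
    then obtain xs where xs: "walk V E xs" "distinct xs" "length xs \<ge> 3" "E (last xs) (hd xs)"
      unfolding has_cycle_def by blast
    let ?n = "length xs"
    have ne: "xs \<noteq> []" using xs by auto
    have cyc: "E (xs ! i) (xs ! (Suc i mod ?n))" if "i < ?n" for i
    proof (cases "Suc i = ?n")
      case True
      then have "i = ?n - 1" by simp
      then show ?thesis using xs(4) ne True by (simp add: last_conv_nth hd_conv_nth)
    next
      case False
      then show ?thesis using that xs(1) by (simp add: walk_def)
    qed
    \<comment> \<open>A vertex of largest \<open>h\<close> on the cycle would have both of its cycle
      neighbours as parent.\<close>
    define H where "H = Max (h ` set xs)"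
    have "H \<in> h ` set xs" unfolding H_def using ne by (intro Max_in) auto
    then obtain i where i: "i < ?n" "h (xs ! i) = H" by (auto simp: in_set_conv_nth)
    have par: "p (xs ! i) = xs ! j" if "E (xs ! i) (xs ! j) \<or> E (xs ! j) (xs ! i)" "j < ?n" for j
    proof -
      have "h (xs ! j) \<le> H" unfolding H_def using that by simp
      moreover have "E (xs ! i) (xs ! j)" using that sg by (auto simp: simple_graph_def)
      ultimately show ?thesis using R i(2) unfolding rooted_def by (metis leD)
    qed
    define j where "j = (i + ?n - 1) mod ?n"
    have n3: "?n \<ge> 3" by fact
    have j: "j < ?n" unfolding j_def using n3 by (intro mod_less_divisor) linarith
    have ji: "(if i = 0 then j = ?n - 1 else j = i - 1)"
    proof (cases "i = 0")
      case True then show ?thesis unfolding j_def using n3 by simp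
    next
      case False
      then have "i + ?n - 1 = (i - 1) + ?n" by simp
      moreover have "((i - 1) + ?n) mod ?n = i - 1" using i by simp
      ultimately show ?thesis unfolding j_def using False by metis
    qed
    have "Suc j mod ?n = i" using ji i n3 by (auto split: if_splits)
    then have "E (xs ! j) (xs ! i)" using cyc[OF j] by simp
    then have 1: "p (xs ! i) = xs ! j" using par j by blast
    have k: "Suc i mod ?n < ?n" using n3 by (intro mod_less_divisor) linarith
    have "p (xs ! i) = xs ! (Suc i mod ?n)" using par cyc[OF i(1)] k by blast
    then have eq: "j = Suc i mod ?n" using 1 xs(2) j k by (metis nth_eq_iff_index_eq)
    show False
    proof (cases "Suc i = ?n")
      case True then show ?thesis using eq ji n3 by (auto split: if_splits)
    next
      case False
      then have "Suc i mod ?n = Suc i" using i by simp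
      then show ?thesis using eq ji n3 i False by (auto split: if_splits)
    qed
  qed
  then show ?thesis unfolding is_tree_def using sg conn R by (auto simp: rooted_def)
qed

lemma rtranclp_distinct_list:
  assumes "R\<^sup>*\<^sup>* a b"
  shows "\<exists>xs. xs \<noteq> [] \<and> distinct xs \<and> hd xs = a \<and> last xs = b \<and> successively R xs"
proof -
  have "\<exists>xs. xs \<noteq> [] \<and> hd xs = a \<and> last xs = b \<and> successively R xs"
    using assms
  proof (induction rule: rtranclp_induct)
    case base
    then show ?case by (intro exI[of _ "[a]"]) simp
  next
    case (step y z)
    then obtain xs where "xs \<noteq> []" "hd xs = a" "last xs = y" "successively R xs" by blast
    then show ?case using step by (intro exI[of _ "xs @ [z]"]) (simp add: successively_append_iff)
  qed
  then obtain xs where xs: "xs \<noteq> [] \<and> hd xs = a \<and> last xs = b \<and> successively R xs"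
    and min: "\<And>ys. ys \<noteq> [] \<and> hd ys = a \<and> last ys = b \<and> successively R ys \<Longrightarrow> length xs \<le> length ys"
    using ex_has_least_nat[of "\<lambda>xs. xs \<noteq> [] \<and> hd xs = a \<and> last xs = b \<and> successively R xs" _ length]
    by blast
  have "distinct xs"
  proof (rule ccontr)
    assume "\<not> distinct xs"
    then obtain us vs ws y where d: "xs = us @ [y] @ vs @ [y] @ ws"
      using not_distinct_decomp by blast
    have "us @ [y] @ ws \<noteq> [] \<and> hd (us @ [y] @ ws) = a \<and> last (us @ [y] @ ws) = b \<and> successively R (us @ [y] @ ws)"
      using xs unfolding d
      by (auto simp: successively_append_iff successively_Cons hd_append split: if_splits)
    from min[OF this] have "length xs \<le> length (us @ [y] @ ws)" .
    then show False using d by simp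
  qed
  then show ?thesis using xs by blast
qed

text \<open>Breadth-first parents: \<open>h\<close> is the distance from \<open>v\<close>, and
  \<open>p\<close> picks a neighbour that is closer. Acyclicity serves to show that \<open>p\<close>
  misses no edge.\<close>

lemma tree_rooted:
  assumes "is_tree V E" "v \<in> V"
  shows "\<exists>p h. rooted V E v p h"
proof -
  have sg: "simple_graph V E" and conn: "connected_graph V E" and acyc: "\<not> has_cycle V E"
    using assms(1) by (auto simp: is_tree_def)
  have ex: "\<exists>n. y \<in> ball V E v n" if y: "y \<in> V" for y
  proof -
    obtain xs where "walk V E xs" "hd xs = v" "last xs = y"
      using conn assms(2) y unfolding connected_graph_def by blast
    then have "y \<in> ball V E v (length xs)" using y by (auto simp: ball_def)
    then show ?thesis by blast
  qed
  define h where "h = (\<lambda>y. LEAST n. y \<in> ball V E v n)"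
  have h: "y \<in> ball V E v (h y)" if "y \<in> V" for y
    unfolding h_def using ex[OF that] by (rule LeastI_ex)
  have h_le: "h y \<le> n" if "y \<in> ball V E v n" for y n
    unfolding h_def using that by (rule Least_le)
  have "\<exists>w. w \<in> V \<and> E w y \<and> h w < h y" if y: "y \<in> V" "y \<noteq> v" for y
  proof -
    have "h y \<noteq> 0"
    proof
      assume "h y = 0"
      then have "y \<in> ball V E v 0" using h[OF y(1)] by simp
      then show False using y assms(2) by (simp add: ball_0)
    qed
    then obtain n where n: "h y = Suc n" using not0_implies_Suc by blast
    then have "y \<notin> ball V E v n" using h_le by fastforce
    then obtain w where "w \<in> ball V E v n" "E w y"
      using h[OF y(1)] n ball_Suc[OF sg] by metis
    moreover have "w \<in> V" using \<open>E w y\<close> sg by (auto simp: simple_graph_def)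
    ultimately show ?thesis using h_le n by fastforce
  qed
  then obtain q where q: "q y \<in> V" "E (q y) y" "h (q y) < h y" if "y \<in> V" "y \<noteq> v" for y
    by metis
  define p where "p = (\<lambda>y. if y = v then v else q y)"
  have pV: "p y \<in> V" if "y \<in> V" for y using that q assms(2) by (simp add: p_def)
  define F where "F = (\<lambda>a b. a \<in> V \<and> b \<in> V \<and> a \<noteq> b \<and> (p a = b \<or> p b = a))"
  have FE: "E a b" if "F a b" for a b
    using that q sg unfolding F_def p_def simple_graph_def by (metis (full_types))
  have symF: "symp F" unfolding F_def symp_def by blast
  have toroot: "F\<^sup>*\<^sup>* y v" if "y \<in> V" for y
    using that
  proof (induction "h y" arbitrary: y rule: less_induct)
    case less
    show ?case
    proof (cases "y = v")
      case False
      have "p y \<noteq> y" using q[of y] less(2) False by (auto simp: p_def)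
      then have "F y (p y)" using less(2) pV by (auto simp: F_def)
      moreover have "F\<^sup>*\<^sup>* (p y) v" using less q False pV by (simp add: p_def)
      ultimately show ?thesis by (meson converse_rtranclp_into_rtranclp)
    qed simp
  qed
  \<comment> \<open>The path from \<open>a\<close> to \<open>b\<close> along parent edges closes up
    with the edge \<open>E a b\<close>. A path with one vertex would give \<open>a = b\<close>, one
    with two would make the edge a parent edge, so this is a genuine cycle.\<close>
  have EF: "F a b" if E: "E a b" for a b
  proof (rule ccontr)
    assume nF: "\<not> F a b"
    have ab: "a \<in> V" "b \<in> V" "a \<noteq> b" "E b a" using E sg by (auto simp: simple_graph_def)
    have "F\<^sup>*\<^sup>* a b"
      using toroot[OF ab(1)] toroot[OF ab(2)] symF
      by (meson rtranclp_trans sympD symp_rtranclp)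
    then obtain xs where xs: "xs \<noteq> []" "distinct xs" "hd xs = a" "last xs = b" "successively F xs"
      using rtranclp_distinct_list by meson
    have "length xs \<ge> 3"
    proof (rule ccontr)
      assume "\<not> length xs \<ge> 3"
      moreover have "length xs \<noteq> 0" using xs(1) by simp
      ultimately consider "length xs = 1" | "length xs = 2" by linarith
      then show False
        using xs ab nF by cases (auto simp: length_Suc_conv numeral_2_eq_2)
    qed
    moreover have "successively E xs" using xs(5) FE by (rule successively_mono)
    moreover have "set xs \<subseteq> V"
    proof
      fix x assume "x \<in> set xs"
      then obtain i where i: "i < length xs" "x = xs ! i" by (auto simp: in_set_conv_nth)
      have w: "walk UNIV F xs" using xs by (simp add: walk_iff_successively)
      show "x \<in> V"
      proof (cases "i = 0")
        case True
        then show ?thesis using i xs ab by (simp add: hd_conv_nth)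
      next
        case False
        then have "F (xs ! (i - 1)) (xs ! i)" using w i unfolding walk_def by (metis Suc_pred' bot_nat_0.not_eq_extremum)
        then show ?thesis using i by (simp add: F_def)
      qed
    qed
    ultimately have "has_cycle V E"
      unfolding has_cycle_def using xs ab by (auto simp: walk_iff_successively)
    then show False using acyc by blast
  qed
  have "rooted V E v p h"
    unfolding rooted_def
  proof (intro conjI allI ballI impI)
    show "finite V" using sg by (simp add: simple_graph_def)
    show "v \<in> V" "p v = v" using assms by (simp_all add: p_def)
    show "p y \<in> V" if "y \<in> V" for y using pV that .
    show "h (p y) < h y" if "y \<in> V" "y \<noteq> v" for y using q that by (simp add: p_def)
    show "E a b \<longleftrightarrow> a \<in> V \<and> b \<in> V \<and> a \<noteq> b \<and> (p a = b \<or> p b = a)" for a b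
      using EF FE unfolding F_def by blast
  qed
  then show ?thesis by blast
qed

subsection \<open>Locality of the relaxed verifier\<close>

definition induced :: "(nat \<Rightarrow> nat \<Rightarrow> bool) \<Rightarrow> nat set \<Rightarrow> nat \<Rightarrow> nat \<Rightarrow> bool" where
  "induced E A = (\<lambda>x y. E x y \<and> x \<in> A \<and> y \<in> A)"

lemma bdd_tree_simple_graph: "bdd_tree \<Delta> V E \<Longrightarrow> simple_graph V E"
  by (simp add: bdd_tree_def is_tree_def)

text \<open>No edge inside \<open>A\<close> is lost: parents stay in \<open>A\<close> except at the
  new root, whose old parent lies outside \<open>A\<close> unless it is the old root.\<close>

lemma rooted_induced:
  assumes "rooted V E v p h" "A \<subseteq> V" "a \<in> A"
    and "\<And>y. y \<in> A \<Longrightarrow> y \<noteq> a \<Longrightarrow> y \<noteq> v \<and> p y \<in> A" "a = v \<or> p a \<notin> A"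
  shows "rooted A (induced E A) a (p(a := a)) h"
  unfolding rooted_def induced_def
proof (intro conjI allI ballI impI)
  show "finite A" using assms(1,2) by (auto simp: rooted_def finite_subset)
  fix x y
  have 1: "E x y \<longleftrightarrow> x \<in> V \<and> y \<in> V \<and> x \<noteq> y \<and> (p x = y \<or> p y = x)"
    using assms(1) by (auto simp: rooted_def)
  have 2: "p x = y \<longleftrightarrow> (p(a := a)) x = y" if "x \<in> A" "y \<in> A" "x \<noteq> y" for x y
    using that assms(1,5) by (cases "x = a") (auto simp: rooted_def)
  show "(E x y \<and> x \<in> A \<and> y \<in> A) = (x \<in> A \<and> y \<in> A \<and> x \<noteq> y \<and> ((p(a := a)) x = y \<or> (p(a := a)) y = x))"
    using 1 2[of x y] 2[of y x] subsetD[OF assms(2), of x] subsetD[OF assms(2), of y] by metis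
next
  fix y assume y: "y \<in> A"
  show "(p(a := a)) y \<in> A" using assms(3,4) y by simp
  assume "y \<noteq> a"
  then show "h ((p(a := a)) y) < h y" using assms(1,2) assms(4)[OF y] y by (auto simp: rooted_def)
qed (use assms(3) in auto)

lemma bdd_tree_induced:
  assumes "bdd_tree \<Delta> V E" "A \<subseteq> V" "is_tree A (induced E A)"
  shows "bdd_tree \<Delta> A (induced E A)"
proof -
  have "card {u \<in> A. induced E A x u} \<le> \<Delta>" if x: "x \<in> A" for x
  proof -
    have "finite {u \<in> V. E x u}" using assms(1) by (auto simp: bdd_tree_def is_tree_def simple_graph_def)
    then have "card {u \<in> A. induced E A x u} \<le> card {u \<in> V. E x u}"
      using assms(2) by (intro card_mono) (auto simp: induced_def)
    then show ?thesis using assms(1,2) x by (force simp: bdd_tree_def)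
  qed
  then show ?thesis using assms(3) by (simp add: bdd_tree_def)
qed

lemma ball_induced:
  assumes "simple_graph V E" "A \<subseteq> V" "u \<in> A" "ball V E u n \<subseteq> A"
  shows "ball A (induced E A) u n = ball V E u n"
proof -
  have sg: "simple_graph A (induced E A)"
    using assms(1,2) by (auto simp: simple_graph_def induced_def finite_subset)
  have "id ` ball V E u n = ball A (induced E A) (id u) n"
    by (rule ball_iso[where ?D1.0 = A and ?D2.0 = A, OF assms(1) sg])
      (use assms in \<open>auto simp: induced_def ball_def\<close>)
  then show ?thesis by simp
qed

lemma ball_induced_exit:
  assumes "simple_graph V E" "A \<subseteq> V" "u \<in> A" "\<not> ball V E u n \<subseteq> A"
  obtains a b where "a \<in> A" "b \<notin> A" "E a b" "a \<in> ball V E u n" "b \<in> ball V E u n"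
    "a \<in> ball A (induced E A) u n"
proof -
  have AV: "V \<inter> A = A" using assms(2) by blast
  show ?thesis
  proof (rule ball_exit[OF assms(1,3) subsetD[OF assms(2,3)] assms(4)])
    fix a b
    assume "a \<in> A" "b \<notin> A" "E a b" "a \<in> ball V E u n" "b \<in> ball V E u n"
      "a \<in> ball (V \<inter> A) (\<lambda>x y. E x y \<and> x \<in> A \<and> y \<in> A) u n"
    then show ?thesis using that[of a b] AV by (simp add: induced_def)
  qed
qed

locale local_problem =
  fixes \<Delta> r :: nat and \<psi> :: "('i::finite, 'o::finite) verifier"
  assumes local_\<psi>: "local_verifier (bdd_tree \<Delta>) r \<psi>"
begin

text \<open>Locality of \<open>\<psi>\<close> for total labellings, lifted to partial ones: an
  erased vertex is seen on both sides or on neither, and otherwise \<open>the\<close> completes the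
  labellings. \<open>D1\<close> and \<open>D2\<close> may exceed the balls, so that one map can
  serve many centres.\<close>

lemma relaxed_happy_transfer:
  assumes T1: "bdd_tree \<Delta> V1 E1" and T2: "bdd_tree \<Delta> V2 E2" and u: "u \<in> V1" "f u \<in> V2"
    and f: "bij_betw f D1 D2" and b1: "ball V1 E1 u r \<subseteq> D1" and b2: "ball V2 E2 (f u) r \<subseteq> D2"
    and E: "\<And>a b. a \<in> D1 \<Longrightarrow> b \<in> D1 \<Longrightarrow> E1 a b \<longleftrightarrow> E2 (f a) (f b)"
    and L: "\<And>a. a \<in> D1 \<Longrightarrow> \<sigma>2 (f a) = \<sigma>1 a \<and> \<mu>2 (f a) = \<mu>1 a"
  shows "relaxed_happy r \<psi> V1 E1 \<sigma>1 \<mu>1 u \<longleftrightarrow> relaxed_happy r \<psi> V2 E2 \<sigma>2 \<mu>2 (f u)"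
proof -
  let ?B1 = "ball V1 E1 u r" and ?B2 = "ball V2 E2 (f u) r"
  have img: "f ` ?B1 = ?B2"
    by (rule ball_iso[OF bdd_tree_simple_graph[OF T1] bdd_tree_simple_graph[OF T2] u f b1 b2 E])
  have none: "(\<exists>a\<in>?B1. \<mu>1 a = None) \<longleftrightarrow> (\<exists>a\<in>?B2. \<mu>2 a = None)"
    unfolding img[symmetric] using L b1 by (auto simp: subset_iff)
  have bij: "bij_betw f ?B1 ?B2"
    using img f b1 by (auto simp: bij_betw_def intro: inj_on_subset)
  have eq: "\<psi> V1 E1 \<sigma>1 l1 u = \<psi> V2 E2 \<sigma>2 l2 (f u)"
    if l: "\<forall>a\<in>?B1. \<mu>1 a = Some (l1 a)" "\<forall>a\<in>?B2. \<mu>2 a = Some (l2 a)" for l1 l2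
  proof -
    have "\<sigma>2 (f a) = \<sigma>1 a \<and> l2 (f a) = l1 a" if a: "a \<in> ?B1" for a
    proof -
      have "\<mu>2 (f a) = Some (l2 (f a))" "\<mu>1 a = Some (l1 a)" using a l img by auto
      then show ?thesis using L[of a] a b1 by auto
    qed
    moreover have "E1 a b \<longleftrightarrow> E2 (f a) (f b)" if "a \<in> ?B1" "b \<in> ?B1" for a b
      using that E b1 by blast
    ultimately show ?thesis
      using local_\<psi>[unfolded local_verifier_def, rule_format, OF T1 T2 u bij refl, of \<sigma>2 \<sigma>1 l2 l1] by blast
  qed
  show ?thesis
  proof (cases "\<exists>a\<in>?B1. \<mu>1 a = None")
    case True
    then show ?thesis using none unfolding relaxed_happy_def by blast
  next
    case False
    then have m: "\<forall>a\<in>?B1. \<mu>1 a = Some ((the \<circ> \<mu>1) a)" "\<forall>a\<in>?B2. \<mu>2 a = Some ((the \<circ> \<mu>2) a)"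
      using none by auto
    have "relaxed_happy r \<psi> V1 E1 \<sigma>1 \<mu>1 u \<longleftrightarrow> \<psi> V1 E1 \<sigma>1 (the \<circ> \<mu>1) u"
      using eq[OF _ m(2)] m(1) False unfolding relaxed_happy_def by blast
    moreover have "relaxed_happy r \<psi> V2 E2 \<sigma>2 \<mu>2 (f u) \<longleftrightarrow> \<psi> V2 E2 \<sigma>2 (the \<circ> \<mu>2) (f u)"
      using eq[OF m(1)] m(2) False none unfolding relaxed_happy_def by blast
    ultimately show ?thesis using eq[OF m] by argo
  qed
qed

lemma relaxed_happy_cong:
  assumes "bdd_tree \<Delta> V E" "u \<in> V" "\<And>a. a \<in> ball V E u r \<Longrightarrow> \<mu>2 a = \<mu>1 a"
  shows "relaxed_happy r \<psi> V E \<sigma> \<mu>1 u \<longleftrightarrow> relaxed_happy r \<psi> V E \<sigma> \<mu>2 u"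
  using relaxed_happy_transfer[OF assms(1,1), of u id "ball V E u r" "ball V E u r" \<sigma> \<sigma> \<mu>2 \<mu>1] assms(2,3) by simp

lemma relaxed_happy_induced:
  assumes "bdd_tree \<Delta> V E" "A \<subseteq> V" "bdd_tree \<Delta> A (induced E A)" "u \<in> A" "ball V E u r \<subseteq> A"
    and "\<And>a. a \<in> ball V E u r \<Longrightarrow> \<mu>2 a = \<mu>1 a"
  shows "relaxed_happy r \<psi> V E \<sigma> \<mu>1 u \<longleftrightarrow> relaxed_happy r \<psi> A (induced E A) \<sigma> \<mu>2 u"
proof -
  let ?D = "ball V E u r"
  have "ball A (induced E A) u r = ?D"
    using ball_induced[OF bdd_tree_simple_graph[OF assms(1)]] assms by blast
  then have "relaxed_happy r \<psi> V E \<sigma> \<mu>1 u \<longleftrightarrow> relaxed_happy r \<psi> A (induced E A) \<sigma> \<mu>2 (id u)"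
    using assms by (intro relaxed_happy_transfer[where ?D1.0 = ?D and ?D2.0 = ?D]) (auto simp: induced_def bij_betw_def)
  then show ?thesis by simp
qed

section \<open>Erasing, restricting and pasting partial labellings\<close>

lemma relaxed_accepts_erase:
  assumes "bdd_tree \<Delta> V E" "relaxed_accepts r \<psi> V E \<sigma> \<mu>" "\<And>u. u \<in> V \<Longrightarrow> \<mu>' u = \<mu> u \<or> \<mu>' u = None"
  shows "relaxed_accepts r \<psi> V E \<sigma> \<mu>'"
  unfolding relaxed_accepts_def
proof
  fix u assume u: "u \<in> V"
  show "relaxed_happy r \<psi> V E \<sigma> \<mu>' u"
  proof (cases "\<exists>a\<in>ball V E u r. \<mu>' a = None")
    case True
    then show ?thesis by (auto simp: relaxed_happy_def)
  next
    case False
    then have "\<And>a. a \<in> ball V E u r \<Longrightarrow> \<mu>' a = \<mu> a" using assms(3) ball_subset by blast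
    then show ?thesis using relaxed_happy_cong[OF assms(1) u, of \<mu>' \<mu> \<sigma>] assms(2) u
      by (simp add: relaxed_accepts_def)
  qed
qed

text \<open>A vertex whose ball leaves \<open>A\<close> meets an erased boundary vertex along a path
  inside \<open>A\<close>, hence is happy; every other vertex has the same ball in \<open>A\<close>
  as in \<open>V\<close>.\<close>

lemma relaxed_accepts_induced:
  assumes "bdd_tree \<Delta> V E" "A \<subseteq> V" "bdd_tree \<Delta> A (induced E A)" "relaxed_accepts r \<psi> V E \<sigma> \<mu>"
    and "\<And>a b. a \<in> A \<Longrightarrow> b \<notin> A \<Longrightarrow> E a b \<Longrightarrow> \<mu> a = None"
  shows "relaxed_accepts r \<psi> A (induced E A) \<sigma> \<mu>"
  unfolding relaxed_accepts_def
proof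
  fix u assume u: "u \<in> A"
  show "relaxed_happy r \<psi> A (induced E A) \<sigma> \<mu> u"
  proof (cases "ball V E u r \<subseteq> A")
    case True
    then show ?thesis using relaxed_happy_induced[OF assms(1-3) u True, of \<mu> \<mu> \<sigma>] assms(2,4) u
      by (auto simp: relaxed_accepts_def)
  next
    case False
    then obtain a b where "a \<in> A" "b \<notin> A" "E a b" "a \<in> ball A (induced E A) u r"
      using ball_induced_exit[OF bdd_tree_simple_graph[OF assms(1)] assms(2) u False] by metis
    then show ?thesis using assms(5) by (auto simp: relaxed_happy_def)
  qed
qed

text \<open>Here \<open>P\<close> collects the boundary vertices of \<open>A\<close> that are not protected by an erased neighbour outside;
  they must be far from every change.\<close>

lemma relaxed_accepts_paste:
  assumes T: "bdd_tree \<Delta> V E" and A: "A \<subseteq> V" and TA: "bdd_tree \<Delta> A (induced E A)"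
    and acc: "relaxed_accepts r \<psi> V E \<sigma> \<mu>" and accA: "relaxed_accepts r \<psi> A (induced E A) \<sigma> \<mu>A"
    and wall: "\<And>a b. a \<in> A \<Longrightarrow> b \<notin> A \<Longrightarrow> E a b \<Longrightarrow> a \<in> P \<or> \<mu> b = None"
    and far: "\<And>z q. z \<in> A - P \<Longrightarrow> \<mu>A z \<noteq> \<mu> z \<Longrightarrow> q \<in> P \<Longrightarrow> q \<notin> ball V E z (2 * r)"
  shows "relaxed_accepts r \<psi> V E \<sigma> (\<lambda>u. if u \<in> A - P then \<mu>A u else \<mu> u)" (is "relaxed_accepts _ _ _ _ _ ?\<mu>")
  unfolding relaxed_accepts_def
proof
  note sg = bdd_tree_simple_graph[OF T]
  fix u assume u: "u \<in> V"
  show "relaxed_happy r \<psi> V E \<sigma> ?\<mu> u"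
  proof (cases "\<exists>z\<in>ball V E u r. z \<in> A - P \<and> \<mu>A z \<noteq> \<mu> z")
    case False
    then have "\<And>a. a \<in> ball V E u r \<Longrightarrow> ?\<mu> a = \<mu> a" by auto
    then show ?thesis using relaxed_happy_cong[OF T u, of ?\<mu> \<mu> \<sigma>] acc u by (simp add: relaxed_accepts_def)
  next
    case True
    then obtain z where z: "z \<in> ball V E u r" "z \<in> A - P" "\<mu>A z \<noteq> \<mu> z" by blast
    \<comment> \<open>Two steps of radius \<open>r\<close>, from the changed vertex \<open>z\<close>
      to \<open>u\<close> and from \<open>u\<close> to \<open>q\<close>, explain the distance
      \<open>2 * r\<close> in \<open>far\<close>.\<close>
    have "u \<in> ball V E z r" using ball_sym[OF sg u z(1)] .
    then have noP: "q \<notin> P" if "q \<in> ball V E u r" for q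
      using that ball_trans[OF sg] far[OF z(2,3)] by (metis mult_2)
    show ?thesis
    proof (cases "ball V E u r \<subseteq> A")
      case True
      then have uA: "u \<in> A" using center_in_ball[OF u] by blast
      have "\<And>a. a \<in> ball V E u r \<Longrightarrow> \<mu>A a = ?\<mu> a" using noP True by auto
      then show ?thesis using relaxed_happy_induced[OF T A TA uA True, of \<mu>A ?\<mu> \<sigma>] accA uA
        by (simp add: relaxed_accepts_def)
    next
      case False
      \<comment> \<open>The ball contains \<open>z\<close> but leaves \<open>A\<close>, so it
        contains both ends of an edge across the boundary. If \<open>u\<close> is outside
        \<open>A\<close>, that edge is found by leaving the complement.\<close>
      have "\<exists>a b. a \<in> A \<and> b \<notin> A \<and> E a b \<and> a \<in> ball V E u r \<and> b \<in> ball V E u r"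
      proof (cases "u \<in> A")
        case True
        then show ?thesis using ball_exit[OF sg True u False] by metis
      next
        case uA: False
        have "\<not> ball V E u r \<subseteq> - A" using z by blast
        then obtain a b where "a \<in> - A" "b \<notin> - A" "E a b" "a \<in> ball V E u r" "b \<in> ball V E u r"
          using ball_exit[OF sg, of u "- A" r] u uA by blast
        moreover have "E b a" using \<open>E a b\<close> sg by (auto simp: simple_graph_def)
        ultimately show ?thesis by blast
      qed
      then obtain a b where "a \<in> A" "b \<notin> A" "E a b" "a \<in> ball V E u r" "b \<in> ball V E u r" by blast
      then have "?\<mu> b = None" using wall noP by auto
      then show ?thesis using \<open>b \<in> ball V E u r\<close> unfolding relaxed_happy_def by blast
    qed
  qed
qed

text \<open>The holes are mended one at a time. A mend may overwrite earlier labels but never erases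
  one, so the order is irrelevant. As the labelling changes on the way, mendability is assumed for
  every accepted labelling.\<close>

lemma fill_holes:
  assumes "finite H" "relaxed_accepts r \<psi> V E \<sigma> \<mu>"
    and mend: "\<And>x \<mu>. x \<in> H \<Longrightarrow> relaxed_accepts r \<psi> V E \<sigma> \<mu> \<Longrightarrow> \<exists>\<mu>'. is_mend r \<psi> V E \<sigma> \<mu> x (b x) \<mu>'"
    and "\<And>x. x \<in> H \<Longrightarrow> ball V E x (b x) \<subseteq> R"
  shows "\<exists>\<mu>'. relaxed_accepts r \<psi> V E \<sigma> \<mu>' \<and> (\<forall>x\<in>H. \<mu>' x \<noteq> None) \<and> (\<forall>u. \<mu>' u = None \<longrightarrow> \<mu> u = None) \<and>
    (\<forall>u. \<mu>' u \<noteq> \<mu> u \<longrightarrow> u \<in> R)"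
  using assms(1,3,4)
proof (induction H rule: finite_induct)
  case empty
  then show ?case using assms(2) by blast
next
  case (insert x H)
  then obtain \<mu>' where \<mu>': "relaxed_accepts r \<psi> V E \<sigma> \<mu>'" "\<forall>x\<in>H. \<mu>' x \<noteq> None"
    "\<forall>u. \<mu>' u = None \<longrightarrow> \<mu> u = None" "\<forall>u. \<mu>' u \<noteq> \<mu> u \<longrightarrow> u \<in> R" by auto
  obtain \<mu>'' where \<mu>'': "is_mend r \<psi> V E \<sigma> \<mu>' x (b x) \<mu>''" using insert.prems(1) \<mu>'(1) by blast
  show ?case
  proof (intro exI[of _ \<mu>''] conjI allI impI ballI)
    show "u \<in> R" if "\<mu>'' u \<noteq> \<mu> u" for u
    proof (cases "\<mu>'' u = \<mu>' u")
      case False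
      then have "u \<in> ball V E x (b x)" using \<mu>'' by (auto simp: is_mend_def)
      then show ?thesis using insert.prems(2)[of x] by auto
    qed (use that \<mu>' in auto)
    show "\<mu>'' u \<noteq> None" if "u \<in> insert x H" for u
      using that \<mu>' \<mu>'' unfolding is_mend_def by (metis insertE)
  qed (use \<mu>' \<mu>'' in \<open>auto simp: is_mend_def\<close>)
qed

end

subsection \<open>Replacing a branch\<close>

lemma rooted_edge: "rooted V E v p h \<Longrightarrow> E a b \<longleftrightarrow> a \<in> V \<and> b \<in> V \<and> a \<noteq> b \<and> (p a = b \<or> p b = a)"
  by (simp add: rooted_def)

lemma rooted_parent_edge:
  assumes "rooted V E v p h" "y \<in> V" "y \<noteq> v"
  shows "E y (p y)" "E (p y) y" "p y \<in> V" "p y \<noteq> y"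
proof -
  have "h (p y) < h y" "p y \<in> V" using assms by (auto simp: rooted_def)
  then show "E y (p y)" "E (p y) y" "p y \<in> V" "p y \<noteq> y"
    using assms unfolding rooted_edge[OF assms(1)] by auto
qed

lemma bdd_tree_degree: "bdd_tree \<Delta> V E \<Longrightarrow> v \<in> V \<Longrightarrow> card {u \<in> V. E v u} \<le> \<Delta>"
  by (simp add: bdd_tree_def)

lemma bdd_tree_branch:
  assumes T: "bdd_tree \<Delta> V E" and X: "X \<subseteq> V" "x \<in> X"
    and cross: "\<And>a b. a \<in> V - X \<Longrightarrow> b \<in> X \<Longrightarrow> E a b \<Longrightarrow> b = x"
  shows "bdd_tree \<Delta> X (induced E X)"
proof -
  obtain p h where R: "rooted V E x p h" using tree_rooted[of V E x] T X by (auto simp: bdd_tree_def)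
  have "rooted X (induced E X) x (p(x := x)) h"
  proof (rule rooted_induced[OF R X])
    fix y assume "y \<in> X" "y \<noteq> x"
    then show "y \<noteq> x \<and> p y \<in> X" using cross[of "p y" y] rooted_parent_edge[OF R, of y] X by auto
  qed simp
  then show ?thesis using bdd_tree_induced[OF T X(1)] rooted_is_tree by blast
qed

text \<open>Both parts are rooted at \<open>x\<close> and their parent functions are glued there.
  Only the degree of \<open>x\<close> mixes the two parts, and \<open>deg\<close> keeps it from
  growing.\<close>

lemma bdd_tree_replace_branch:
  assumes T: "bdd_tree \<Delta> V E" and X: "X \<subseteq> V" "x \<in> X"
    and cross: "\<And>a b. a \<in> V - X \<Longrightarrow> b \<in> X \<Longrightarrow> E a b \<Longrightarrow> b = x"
    and T': "bdd_tree \<Delta> X' E'" and X': "x \<in> X'" "X' \<inter> (V - X) = {}"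
    and deg: "card {u \<in> X'. E' x u} \<le> card {u \<in> X. E x u}"
    and E2: "E2 = (\<lambda>a b. (a \<in> insert x (V - X) \<and> b \<in> insert x (V - X) \<and> E a b) \<or> E' a b)"
  shows "bdd_tree \<Delta> (V - X \<union> X') E2"
proof -
  let ?Y = "V - X"
  note sg = bdd_tree_simple_graph[OF T] and sg' = bdd_tree_simple_graph[OF T']
  obtain p h where R: "rooted V E x p h" using tree_rooted[of V E x] T X by (auto simp: bdd_tree_def)
  obtain p' h' where R': "rooted X' E' x p' h'" using tree_rooted[of X' E' x] T' X' by (auto simp: bdd_tree_def)
  have px: "p x = x" "p' x = x" using R R' by (auto simp: rooted_def)
  have pY: "p y \<in> insert x ?Y" if "y \<in> ?Y" for y
    using that rooted_parent_edge[OF R, of y] sg cross[of y "p y"] X by auto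
  have hY: "h x < h y" if "y \<in> V" "y \<noteq> x" for y
    using that
  proof (induction "h y" arbitrary: y rule: less_induct)
    case less
    have "h (p y) < h y" "p y \<in> V" using R less.prems by (auto simp: rooted_def)
    then show ?case using less.hyps[of "p y"] by (cases "p y = x") auto
  qed
  define p2 where "p2 = (\<lambda>y. if y \<in> X' then p' y else p y)"
  \<comment> \<open>\<open>x\<close> now has the value \<open>h' x\<close>, so the outer vertices
    are lifted by it; \<open>hY\<close> makes their own height positive.\<close>
  define h2 where "h2 = (\<lambda>y. if y \<in> X' then h' y else h y + h' x)"
  have disj: "y \<notin> X'" if "y \<in> ?Y" for y using X'(2) that by blast
  have "rooted (?Y \<union> X') E2 x p2 h2"
    unfolding rooted_def
  proof (intro conjI allI ballI impI)
    show "finite (?Y \<union> X')" using sg sg' by (simp add: simple_graph_def)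
    show "x \<in> ?Y \<union> X'" using X' by simp
    show "p2 x = x" using X' px by (simp add: p2_def)
    fix y assume y: "y \<in> ?Y \<union> X'"
    show "p2 y \<in> ?Y \<union> X'"
      using y pY[of y] R' X' by (auto simp: p2_def rooted_def)
    assume "y \<noteq> x"
    show "h2 (p2 y) < h2 y"
    proof (cases "y \<in> X'")
      case True
      then show ?thesis using R' \<open>y \<noteq> x\<close> by (auto simp: p2_def h2_def rooted_def)
    next
      case False
      then have yY: "y \<in> ?Y" using y by blast
      show ?thesis
      proof (cases "p y = x")
        case True
        then show ?thesis using False hY[of y] yY \<open>y \<noteq> x\<close> X' by (simp add: p2_def h2_def)
      next
        case neq: False
        then have "p y \<notin> X'" using pY[OF yY] disj by blast
        moreover have "h (p y) < h y" using R yY \<open>y \<noteq> x\<close> by (auto simp: rooted_def)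
        ultimately show ?thesis using False by (simp add: p2_def h2_def)
      qed
    qed
  next
    fix a b
    have E: "E a b \<longleftrightarrow> a \<in> V \<and> b \<in> V \<and> a \<noteq> b \<and> (p a = b \<or> p b = a)" using rooted_edge[OF R] .
    have E': "E' a b \<longleftrightarrow> a \<in> X' \<and> b \<in> X' \<and> a \<noteq> b \<and> (p' a = b \<or> p' b = a)" using rooted_edge[OF R'] .
    have p'X: "p' y \<in> X'" if "y \<in> X'" for y using R' that by (simp add: rooted_def)
    consider "a \<in> X'" "b \<in> X'" | "a \<in> ?Y" "b \<in> ?Y" | "a \<in> ?Y" "b \<in> X'" | "a \<in> X'" "b \<in> ?Y"
      | "a \<notin> ?Y \<union> X' \<or> b \<notin> ?Y \<union> X'" by blast
    then show "E2 a b \<longleftrightarrow> a \<in> ?Y \<union> X' \<and> b \<in> ?Y \<union> X' \<and> a \<noteq> b \<and> (p2 a = b \<or> p2 b = a)"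
    proof cases
      case 1
      have "\<not> E x x" using sg by (simp add: simple_graph_def)
      then have "E2 a b \<longleftrightarrow> E' a b" unfolding E2 using 1 disj by blast
      then show ?thesis unfolding E' p2_def using 1 by simp
    next
      case 2
      then have "E2 a b \<longleftrightarrow> E a b" unfolding E2 E' using disj by blast
      then show ?thesis unfolding E p2_def using 2 disj by simp
    next
      case 3
      then have "E2 a b \<longleftrightarrow> b = x \<and> p a = x" unfolding E2 E E' using disj px X by auto
      moreover have "p2 a = p a" "p2 b = p' b" "p' b \<noteq> a" "a \<noteq> b" using 3 disj p'X by (auto simp: p2_def)
      ultimately show ?thesis using 3 pY[of a] disj by auto
    next
      case 4
      then have "E2 a b \<longleftrightarrow> a = x \<and> p b = x" unfolding E2 E E' using disj px X by auto
      moreover have "p2 b = p b" "p2 a = p' a" "p' a \<noteq> b" "a \<noteq> b" using 4 disj p'X by (auto simp: p2_def)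
      ultimately show ?thesis using 4 pY[of b] disj by auto
    next
      case 5
      then show ?thesis unfolding E2 E' using X' by auto
    qed
  qed
  then have "is_tree (?Y \<union> X') E2" by (rule rooted_is_tree)
  moreover have "card {u \<in> ?Y \<union> X'. E2 y u} \<le> \<Delta>" if y: "y \<in> ?Y \<union> X'" for y
  proof -
    have fin: "finite V" "finite X'" using sg sg' by (auto simp: simple_graph_def)
    consider "y \<in> ?Y" | "y \<in> X'" "y \<noteq> x" | "y = x" using y by blast
    then show ?thesis
    proof cases
      case 1
      have "card {u \<in> ?Y \<union> X'. E2 y u} \<le> card {u \<in> V. E y u}"
      proof (rule card_mono)
        show "{u \<in> ?Y \<union> X'. E2 y u} \<subseteq> {u \<in> V. E y u}"
          using 1 disj X sg' unfolding E2 simple_graph_def by blast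
      qed (use fin in simp)
      then show ?thesis using bdd_tree_degree[OF T, of y] 1 by simp
    next
      case 2
      have "card {u \<in> ?Y \<union> X'. E2 y u} \<le> card {u \<in> X'. E' y u}"
      proof (rule card_mono)
        show "{u \<in> ?Y \<union> X'. E2 y u} \<subseteq> {u \<in> X'. E' y u}"
          using 2 disj X sg' unfolding E2 simple_graph_def by blast
      qed (use fin in simp)
      then show ?thesis using bdd_tree_degree[OF T', of y] 2 by simp
    next
      case 3
      have "card {u \<in> ?Y \<union> X'. E2 x u} \<le> card ({u \<in> ?Y. E x u} \<union> {u \<in> X'. E' x u})"
      proof (rule card_mono)
        show "{u \<in> ?Y \<union> X'. E2 x u} \<subseteq> {u \<in> ?Y. E x u} \<union> {u \<in> X'. E' x u}"
          using sg sg' unfolding E2 simple_graph_def by blast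
      qed (use fin in simp)
      also have "\<dots> \<le> card {u \<in> ?Y. E x u} + card {u \<in> X'. E' x u}" by (rule card_Un_le)
      also have "\<dots> \<le> card {u \<in> ?Y. E x u} + card {u \<in> X. E x u}" using deg by simp
      also have "\<dots> = card ({u \<in> ?Y. E x u} \<union> {u \<in> X. E x u})"
        using fin finite_subset[OF X(1) fin(1)] by (intro card_Un_disjoint[symmetric]) auto
      also have "{u \<in> ?Y. E x u} \<union> {u \<in> X. E x u} = {u \<in> V. E x u}" using X by blast
      finally show ?thesis using bdd_tree_degree[OF T, of x] X 3 by auto
    qed
  qed
  ultimately show ?thesis by (simp add: bdd_tree_def)
qed

lemma bdd_tree_iso:
  assumes T: "bdd_tree \<Delta> V1 E1" and f: "bij_betw f V1 V2" 
    and E2: "E2 = (\<lambda>a b. \<exists>x y. a = f x \<and> b = f y \<and> E1 x y)"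
  shows "bdd_tree \<Delta> V2 E2" "\<And>a b. a \<in> V1 \<Longrightarrow> b \<in> V1 \<Longrightarrow> E2 (f a) (f b) \<longleftrightarrow> E1 a b"
proof -
  note sg = bdd_tree_simple_graph[OF T]
  have EV: "x \<in> V1 \<and> y \<in> V1" if "E1 x y" for x y using sg that by (auto simp: simple_graph_def)
  have inj: "f x = f y \<longleftrightarrow> x = y" if "x \<in> V1" "y \<in> V1" for x y
    using f that by (auto simp: bij_betw_def inj_on_def)
  show iff: "E2 (f a) (f b) \<longleftrightarrow> E1 a b" if "a \<in> V1" "b \<in> V1" for a b
    unfolding E2 using that inj EV by metis
  have img: "f ` V1 = V2" using f by (simp add: bij_betw_def)
  obtain v where v: "v \<in> V1" using T by (auto simp: bdd_tree_def is_tree_def)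
  obtain p h where R: "rooted V1 E1 v p h" using tree_rooted[of V1 E1 v] T v by (auto simp: bdd_tree_def)
  let ?g = "inv_into V1 f"
  have g: "?g (f x) = x" if "x \<in> V1" for x using that f by (simp add: bij_betw_def)
  have pV: "p y \<in> V1" if "y \<in> V1" for y using R that by (simp add: rooted_def)
  have "rooted V2 E2 (f v) (\<lambda>y. f (p (?g y))) (\<lambda>y. h (?g y))"
    unfolding rooted_def
  proof (intro conjI allI ballI impI)
    show "finite V2" using img sg by (auto simp: simple_graph_def)
    show "f v \<in> V2" using img v by blast
    show "f (p (?g (f v))) = f v" using g v R by (simp add: rooted_def)
    fix y assume "y \<in> V2"
    then obtain x where x: "x \<in> V1" "y = f x" using img by blast
    then show "f (p (?g y)) \<in> V2" using g pV img by auto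
    assume "y \<noteq> f v"
    then show "h (?g (f (p (?g y)))) < h (?g y)" using x g pV R by (auto simp: rooted_def)
  next
    fix a b
    show "E2 a b \<longleftrightarrow> a \<in> V2 \<and> b \<in> V2 \<and> a \<noteq> b \<and> (f (p (?g a)) = b \<or> f (p (?g b)) = a)"
    proof (cases "a \<in> V2 \<and> b \<in> V2")
      case True
      then obtain x y where xy: "x \<in> V1" "y \<in> V1" "a = f x" "b = f y" using img by blast
      then show ?thesis using iff[of x y] rooted_edge[OF R, of x y] g inj pV True by simp
    next
      case False
      then show ?thesis unfolding E2 using EV img by blast
    qed
  qed
  moreover have "card {u \<in> V2. E2 y u} \<le> \<Delta>" if "y \<in> V2" for y
  proof -
    obtain x where x: "x \<in> V1" "y = f x" using img \<open>y \<in> V2\<close> by blast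
    have "{u \<in> V2. E2 y u} = f ` {u \<in> V1. E1 x u}" using x iff img by auto
    moreover have "finite {u \<in> V1. E1 x u}" using sg by (simp add: simple_graph_def)
    ultimately have "card {u \<in> V2. E2 y u} \<le> card {u \<in> V1. E1 x u}" by (simp add: card_image_le)
    then show ?thesis using bdd_tree_degree[OF T, of x] x by simp
  qed
  ultimately show "bdd_tree \<Delta> V2 E2" using rooted_is_tree by (simp add: bdd_tree_def)
qed

lemma card_ball_le:
  assumes "bdd_tree \<Delta> V E" "v \<in> V"
  shows "card (ball V E v n) \<le> Suc \<Delta> ^ n"
proof (induction n)
  case 0
  then show ?case using assms by (simp add: ball_0)
next
  case (Suc n)
  note sg = bdd_tree_simple_graph[OF assms(1)]
  have fin: "finite V" using sg by (simp add: simple_graph_def)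
  then have finb: "finite (ball V E v n)" using ball_subset finite_subset by metis
  have "ball V E v (Suc n) \<subseteq> (\<Union>w\<in>ball V E v n. insert w {u \<in> V. E w u})"
  proof
    fix u assume "u \<in> ball V E v (Suc n)"
    then have "u \<in> ball V E v n \<or> (\<exists>w\<in>ball V E v n. E w u)" "u \<in> V"
      using ball_Suc[OF sg, of u v n] ball_subset[of V E v "Suc n"] by auto
    then show "u \<in> (\<Union>w\<in>ball V E v n. insert w {u \<in> V. E w u})" by blast
  qed
  then have "card (ball V E v (Suc n)) \<le> card (\<Union>w\<in>ball V E v n. insert w {u \<in> V. E w u})"
    using fin finb by (intro card_mono) auto
  also have "\<dots> \<le> (\<Sum>w\<in>ball V E v n. card (insert w {u \<in> V. E w u}))" by (rule card_UN_le[OF finb])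
  also have "\<dots> \<le> (\<Sum>w\<in>ball V E v n. Suc \<Delta>)"
  proof (rule sum_mono)
    fix w assume "w \<in> ball V E v n"
    then have "card {u \<in> V. E w u} \<le> \<Delta>" using bdd_tree_degree[OF assms(1), of w] ball_subset[of V E v n] by blast
    then show "card (insert w {u \<in> V. E w u}) \<le> Suc \<Delta>" using fin by (simp add: card_insert_if)
  qed
  also have "\<dots> = card (ball V E v n) * Suc \<Delta>" by simp
  also have "\<dots> \<le> Suc \<Delta> ^ n * Suc \<Delta>" using Suc.IH by (rule mult_le_mono1)
  finally show ?case by (simp add: mult.commute)
qed

text \<open>Walks enter \<open>X\<close> through \<open>x\<close> only, so a walk of length
  \<open>n\<close> gets at most \<open>n\<close> deeper into \<open>X\<close> than the depth
  \<open>i\<close> at which it may start.\<close>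

lemma ball_attached:
  assumes sg: "simple_graph V E" and "x \<in> X" "X \<subseteq> V"
    and cross: "\<And>a b. a \<in> V - X \<Longrightarrow> b \<in> X \<Longrightarrow> E a b \<Longrightarrow> b = x"
    and u: "u \<in> V - X \<union> ball X (induced E X) x i"
  shows "ball V E u n \<subseteq> V - X \<union> ball X (induced E X) x (i + n)"
proof (induction n)
  case 0
  have "u \<in> V" using u ball_subset[of X] assms(3) by blast
  then show ?case using u by (simp add: ball_0)
next
  case (Suc n)
  have sgX: "simple_graph X (induced E X)"
    using sg assms(3) by (auto simp: simple_graph_def induced_def finite_subset)
  show ?case
  proof
    fix y assume y: "y \<in> ball V E u (Suc n)"
    show "y \<in> V - X \<union> ball X (induced E X) x (i + Suc n)"
    proof (cases "y \<in> X")
      case False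
      then show ?thesis using y ball_subset by blast
    next
      case True
      from y consider "y \<in> ball V E u n" | w where "w \<in> ball V E u n" "E w y"
        using ball_Suc[OF sg] by blast
      then show ?thesis
      proof cases
        case 1
        then have "y \<in> ball X (induced E X) x (i + n)" using Suc.IH True by blast
        then show ?thesis using ball_mono[of "i + n" "i + Suc n"] by auto
      next
        case 2
        show ?thesis
        proof (cases "w \<in> X")
          case wX: True
          then have "w \<in> ball X (induced E X) x (i + n)" using Suc.IH 2 by blast
          moreover have "induced E X w y" using 2 wX True by (simp add: induced_def)
          ultimately show ?thesis using ball_Suc[OF sgX] by auto
        next
          case False
          then have "y = x" using cross[of w y] 2 True ball_subset by blast
          then show ?thesis using assms(2) by (simp add: center_in_ball)
        qed
      qed
    qed
  qed
qed

subsection \<open>Types of branches\<close>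

text \<open>A copy of the labelled graph on the numbers \<open>g a\<close>. Bounded numbers and
  finitely many labels leave finitely many codes, and for injective numberings equal codes mean
  isomorphic graphs.\<close>

definition code :: "(nat \<Rightarrow> nat) \<Rightarrow> nat set \<Rightarrow> (nat \<Rightarrow> nat \<Rightarrow> bool) \<Rightarrow> (nat \<Rightarrow> 'a) \<Rightarrow> (nat \<times> nat) set \<times> (nat \<times> 'a) set" where
  "code g W E lab = ((\<lambda>(a, b). (g a, g b)) ` {(a, b). a \<in> W \<and> b \<in> W \<and> E a b}, (\<lambda>a. (g a, lab a)) ` W)"

lemma code_eq_imp_iso:
  assumes eq: "code g1 W1 E1 lab1 = code g2 W2 E2 lab2" and inj: "inj_on g1 W1" "inj_on g2 W2"
  obtains f where "bij_betw f W1 W2" "\<And>a b. a \<in> W1 \<Longrightarrow> b \<in> W1 \<Longrightarrow> E1 a b \<longleftrightarrow> E2 (f a) (f b)"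
    "\<And>a. a \<in> W1 \<Longrightarrow> lab2 (f a) = lab1 a"
proof -
  have edges: "(\<lambda>(a, b). (g1 a, g1 b)) ` {(a, b). a \<in> W1 \<and> b \<in> W1 \<and> E1 a b} =
      (\<lambda>(a, b). (g2 a, g2 b)) ` {(a, b). a \<in> W2 \<and> b \<in> W2 \<and> E2 a b}"
    and labs: "(\<lambda>a. (g1 a, lab1 a)) ` W1 = (\<lambda>a. (g2 a, lab2 a)) ` W2"
    using eq by (simp_all add: code_def)
  have "\<exists>b. b \<in> W2 \<and> g2 b = g1 a \<and> lab2 b = lab1 a" if a: "a \<in> W1" for a
  proof -
    have "(g1 a, lab1 a) \<in> (\<lambda>a. (g2 a, lab2 a)) ` W2" using a labs by blast
    then show ?thesis by auto
  qed
  then obtain f where f: "f a \<in> W2" "g2 (f a) = g1 a" "lab2 (f a) = lab1 a" if "a \<in> W1" for a by metis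
  have "bij_betw f W1 W2"
  proof (rule bij_betw_imageI)
    show "inj_on f W1" using f inj(1) unfolding inj_on_def by metis
    show "f ` W1 = W2"
    proof
      show "f ` W1 \<subseteq> W2" using f by blast
      show "W2 \<subseteq> f ` W1"
      proof
        fix b assume b: "b \<in> W2"
        then have "(g2 b, lab2 b) \<in> (\<lambda>a. (g1 a, lab1 a)) ` W1" using labs by blast
        then obtain a where a: "a \<in> W1" "g2 b = g1 a" by auto
        then have "f a = b" using f[of a] inj(2) b by (auto simp: inj_on_def)
        then show "b \<in> f ` W1" using a by blast
      qed
    qed
  qed
  moreover have "E1 a b \<longleftrightarrow> E2 (f a) (f b)" if ab: "a \<in> W1" "b \<in> W1" for a b
  proof
    assume "E1 a b"
    then have "(g1 a, g1 b) \<in> (\<lambda>(a, b). (g1 a, g1 b)) ` {(a, b). a \<in> W1 \<and> b \<in> W1 \<and> E1 a b}" using ab by auto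
    then obtain c d where "c \<in> W2" "d \<in> W2" "E2 c d" "g1 a = g2 c" "g1 b = g2 d" unfolding edges by auto
    moreover from this have "c = f a" "d = f b" using f ab inj(2) by (metis inj_onD)+
    ultimately show "E2 (f a) (f b)" by simp
  next
    assume "E2 (f a) (f b)"
    then have "(g2 (f a), g2 (f b)) \<in> (\<lambda>(a, b). (g2 a, g2 b)) ` {(a, b). a \<in> W2 \<and> b \<in> W2 \<and> E2 a b}"
      by (intro image_eqI[where x = "(f a, f b)"]) (use ab f(1) in auto)
    then have "(g1 a, g1 b) \<in> (\<lambda>(a, b). (g1 a, g1 b)) ` {(a, b). a \<in> W1 \<and> b \<in> W1 \<and> E1 a b}"
      unfolding edges using f ab by simp
    then obtain c d where "c \<in> W1" "d \<in> W1" "E1 c d" "g1 a = g1 c" "g1 b = g1 d" by auto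
    moreover from this have "c = a" "d = b" using ab inj(1) by (metis inj_onD)+
    ultimately show "E1 a b" by simp
  qed
  ultimately show ?thesis using that f(3) by blast
qed

lemma code_image:
  assumes "bij_betw f W1 W2" "\<And>a b. a \<in> W1 \<Longrightarrow> b \<in> W1 \<Longrightarrow> E1 a b \<longleftrightarrow> E2 (f a) (f b)"
    and "\<And>a. a \<in> W1 \<Longrightarrow> lab2 (f a) = lab1 a"
  shows "code g W2 E2 lab2 = code (g \<circ> f) W1 E1 lab1"
proof -
  have W2: "W2 = f ` W1" using assms(1) by (simp add: bij_betw_def)
  have "{(a, b). a \<in> W2 \<and> b \<in> W2 \<and> E2 a b} = (\<lambda>(a, b). (f a, f b)) ` {(a, b). a \<in> W1 \<and> b \<in> W1 \<and> E1 a b}"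
    (is "?L = ?R")
  proof (intro set_eqI iffI)
    fix z assume "z \<in> ?L"
    then obtain a b where ab: "a \<in> W1" "b \<in> W1" "z = (f a, f b)" "E2 (f a) (f b)" unfolding W2 by blast
    then show "z \<in> ?R" using assms(2)[of a b] by (intro image_eqI[of _ _ "(a, b)"]) simp_all
  next
    fix z assume "z \<in> ?R"
    then obtain a b where "a \<in> W1" "b \<in> W1" "z = (f a, f b)" "E1 a b" by auto
    then show "z \<in> ?L" unfolding W2 using assms(2)[of a b] by simp
  qed
  moreover have "(\<lambda>a. (g a, lab2 a)) ` W2 = (\<lambda>a. (g (f a), lab1 a)) ` W1"
    unfolding W2 image_image using assms(3) by (intro image_cong) auto
  ultimately show ?thesis by (simp add: code_def image_image case_prod_beta)
qed

lemma finite_range_bounded_witness: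
  assumes "finite (F ` S)"
  shows "\<exists>K::nat. \<forall>s\<in>S. \<exists>s'\<in>S. F s' = F s \<and> m s' \<le> K"
proof -
  let ?c = "inv_into S F"
  show ?thesis
  proof (intro exI ballI bexI conjI)
    fix s assume s: "s \<in> S"
    then show "?c (F s) \<in> S" "F (?c (F s)) = F s" by (auto intro: inv_into_into f_inv_into_f)
    show "m (?c (F s)) \<le> Max ((\<lambda>t. m (?c t)) ` F ` S)"
      using assms s by (intro Max_ge) auto
  qed
qed

text \<open>A pointed labelled tree is summarised by the windows that its valid relabellings can show around the
  root: attaching the root to another tree only reveals the window.\<close>

context local_problem
begin

text \<open>Radius \<open>2 * r\<close> covers all that vertices within \<open>r\<close> of the root
  can see in the branch. The extra step shows the neighbours of the root even for
  \<open>r = 0\<close>, so that the type controls its degree.\<close>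

definition window :: "nat set \<Rightarrow> (nat \<Rightarrow> nat \<Rightarrow> bool) \<Rightarrow> nat \<Rightarrow> nat set" where
  "window X E x = ball X E x (2 * r + 1)"

text \<open>Vertices within \<open>r\<close> of the root are exempt because in a host tree their
  view may leave the branch; they are checked there. The second clause forbids new holes.\<close>

definition valid_below :: "nat set \<Rightarrow> (nat \<Rightarrow> nat \<Rightarrow> bool) \<Rightarrow> (nat \<Rightarrow> 'i) \<Rightarrow> (nat \<Rightarrow> 'o option) \<Rightarrow> nat \<Rightarrow> (nat \<Rightarrow> 'o option) \<Rightarrow> bool" where
  "valid_below X E \<sigma> \<mu> x \<nu> \<longleftrightarrow> (\<forall>u\<in>X - ball X E x r. relaxed_happy r \<psi> X E \<sigma> \<nu> u) \<and>
     (\<forall>u\<in>X. \<nu> u = None \<longrightarrow> \<mu> u = None)"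

text \<open>A set of codes, one for each numbering and each valid relabelling, so that equality of
  types matches relabellings in both directions. The flag \<open>u = x\<close> forces isomorphisms
  of windows to preserve the root.\<close>

definition root_type where
  "root_type X E \<sigma> \<mu> x = {code g (window X E x) E (\<lambda>u. (\<sigma> u, \<mu> u, \<nu> u, u = x)) | g \<nu>.
     inj_on g (window X E x) \<and> g ` window X E x \<subseteq> {..<Suc \<Delta> ^ (2 * r + 1)} \<and> valid_below X E \<sigma> \<mu> x \<nu>}"

lemma root_typeI:
  assumes "inj_on g (window X E x)" "g ` window X E x \<subseteq> {..<Suc \<Delta> ^ (2 * r + 1)}" "valid_below X E \<sigma> \<mu> x \<nu>"
  shows "code g (window X E x) E (\<lambda>u. (\<sigma> u, \<mu> u, \<nu> u, u = x)) \<in> root_type X E \<sigma> \<mu> x"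
  unfolding root_type_def mem_Collect_eq
  by (rule exI[of _ g], rule exI[of _ \<nu>]) (intro conjI refl assms)

lemma root_typeE:
  assumes "c \<in> root_type X E \<sigma> \<mu> x"
  obtains g \<nu> where "c = code g (window X E x) E (\<lambda>u. (\<sigma> u, \<mu> u, \<nu> u, u = x))" "inj_on g (window X E x)"
    "g ` window X E x \<subseteq> {..<Suc \<Delta> ^ (2 * r + 1)}" "valid_below X E \<sigma> \<mu> x \<nu>"
  using assms that unfolding root_type_def mem_Collect_eq by (elim exE conjE)

text \<open>A numbering of the first window turns \<open>\<nu>1\<close> into a code that the second
  type must contain too. Both \<open>f\<close> and \<open>\<nu>2\<close> depend on
  \<open>\<nu>1\<close>: different relabellings may need different maps between the windows.\<close>

lemma root_type_window:
  assumes T: "bdd_tree \<Delta> X1 E1" and eq: "root_type X1 E1 \<sigma>1 \<mu>1 x1 = root_type X2 E2 \<sigma>2 \<mu>2 x2"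
    and x: "x1 \<in> X1" and val: "valid_below X1 E1 \<sigma>1 \<mu>1 x1 \<nu>1"
  obtains f \<nu>2 where "valid_below X2 E2 \<sigma>2 \<mu>2 x2 \<nu>2" "bij_betw f (window X1 E1 x1) (window X2 E2 x2)" "f x1 = x2"
    "\<And>a b. a \<in> window X1 E1 x1 \<Longrightarrow> b \<in> window X1 E1 x1 \<Longrightarrow> E1 a b \<longleftrightarrow> E2 (f a) (f b)"
    "\<And>a. a \<in> window X1 E1 x1 \<Longrightarrow> \<sigma>2 (f a) = \<sigma>1 a \<and> \<mu>2 (f a) = \<mu>1 a \<and> \<nu>2 (f a) = \<nu>1 a"
proof -
  let ?W1 = "window X1 E1 x1" and ?W2 = "window X2 E2 x2"
  have "finite ?W1"
    using T finite_subset[OF ball_subset] by (auto simp: bdd_tree_def is_tree_def simple_graph_def window_def)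
  then obtain g where g: "bij_betw g ?W1 {0..<card ?W1}" using ex_bij_betw_finite_nat by blast
  moreover have "card ?W1 \<le> Suc \<Delta> ^ (2 * r + 1)" unfolding window_def using card_ball_le[OF T x] by blast
  ultimately have "inj_on g ?W1" "g ` ?W1 \<subseteq> {..<Suc \<Delta> ^ (2 * r + 1)}" by (auto simp: bij_betw_def)
  then have "code g ?W1 E1 (\<lambda>u. (\<sigma>1 u, \<mu>1 u, \<nu>1 u, u = x1)) \<in> root_type X1 E1 \<sigma>1 \<mu>1 x1"
    using val by (rule root_typeI)
  then obtain g2 \<nu>2 where
    c: "code g ?W1 E1 (\<lambda>u. (\<sigma>1 u, \<mu>1 u, \<nu>1 u, u = x1)) = code g2 ?W2 E2 (\<lambda>u. (\<sigma>2 u, \<mu>2 u, \<nu>2 u, u = x2))"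
    and g2: "inj_on g2 ?W2" "valid_below X2 E2 \<sigma>2 \<mu>2 x2 \<nu>2"
    unfolding eq by (rule root_typeE)
  obtain f where f: "bij_betw f ?W1 ?W2" "\<And>a b. a \<in> ?W1 \<Longrightarrow> b \<in> ?W1 \<Longrightarrow> E1 a b \<longleftrightarrow> E2 (f a) (f b)"
    "\<And>a. a \<in> ?W1 \<Longrightarrow> (\<sigma>2 (f a), \<mu>2 (f a), \<nu>2 (f a), f a = x2) = (\<sigma>1 a, \<mu>1 a, \<nu>1 a, a = x1)"
    using code_eq_imp_iso[OF c \<open>inj_on g ?W1\<close> g2(1)] by metis
  have "x1 \<in> ?W1" unfolding window_def using x by (rule center_in_ball)
  then show ?thesis using that[OF g2(2) f(1) _ f(2)] f(3) by auto
qed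

lemma root_type_iso_subset:
  assumes T1: "bdd_tree \<Delta> X1 E1" and T2: "bdd_tree \<Delta> X2 E2" and f: "bij_betw f X1 X2" and x: "x1 \<in> X1" "f x1 = x2"
    and E: "\<And>a b. a \<in> X1 \<Longrightarrow> b \<in> X1 \<Longrightarrow> E1 a b \<longleftrightarrow> E2 (f a) (f b)"
    and L: "\<And>a. a \<in> X1 \<Longrightarrow> \<sigma>2 (f a) = \<sigma>1 a \<and> \<mu>2 (f a) = \<mu>1 a"
  shows "root_type X2 E2 \<sigma>2 \<mu>2 x2 \<subseteq> root_type X1 E1 \<sigma>1 \<mu>1 x1"
proof
  let ?W1 = "window X1 E1 x1" and ?W2 = "window X2 E2 x2"
  have balls: "f ` ball X1 E1 x1 n = ball X2 E2 x2 n" for n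
    using ball_iso[OF bdd_tree_simple_graph[OF T1] bdd_tree_simple_graph[OF T2] x(1) _ f ball_subset ball_subset E] x f
    by (auto simp: bij_betw_def)
  have inj: "inj_on f X1" using f by (simp add: bij_betw_def)
  have WX: "?W1 \<subseteq> X1" unfolding window_def by (rule ball_subset)
  have fW: "bij_betw f ?W1 ?W2"
    unfolding bij_betw_def using inj_on_subset[OF inj WX] balls by (simp add: window_def)
  fix c assume "c \<in> root_type X2 E2 \<sigma>2 \<mu>2 x2"
  then obtain g \<nu> where c: "c = code g ?W2 E2 (\<lambda>u. (\<sigma>2 u, \<mu>2 u, \<nu> u, u = x2))" and g: "inj_on g ?W2"
    "g ` ?W2 \<subseteq> {..<Suc \<Delta> ^ (2 * r + 1)}" and val: "valid_below X2 E2 \<sigma>2 \<mu>2 x2 \<nu>"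
    by (rule root_typeE)
  have "c = code (g \<circ> f) ?W1 E1 (\<lambda>u. (\<sigma>1 u, \<mu>1 u, (\<nu> \<circ> f) u, u = x1))"
    unfolding c
  proof (rule code_image[OF fW])
    fix a assume "a \<in> ?W1"
    then have "a \<in> X1" using WX by blast
    moreover from this have "f a = x2 \<longleftrightarrow> a = x1" using x inj by (auto simp: inj_on_def)
    ultimately show "(\<sigma>2 (f a), \<mu>2 (f a), \<nu> (f a), f a = x2) = (\<sigma>1 a, \<mu>1 a, (\<nu> \<circ> f) a, a = x1)"
      using L by simp
  qed (use E WX in blast)
  moreover have "inj_on (g \<circ> f) ?W1" "(g \<circ> f) ` ?W1 \<subseteq> {..<Suc \<Delta> ^ (2 * r + 1)}"
    using fW g unfolding bij_betw_def by (auto intro: comp_inj_on)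
  moreover have "valid_below X1 E1 \<sigma>1 \<mu>1 x1 (\<nu> \<circ> f)"
    unfolding valid_below_def
  proof (intro conjI ballI)
    fix u assume u: "u \<in> X1 - ball X1 E1 x1 r"
    have "f u \<in> X2" using u f by (auto simp: bij_betw_def)
    moreover have "f u \<notin> ball X2 E2 x2 r"
    proof
      assume "f u \<in> ball X2 E2 x2 r"
      then obtain w where "w \<in> ball X1 E1 x1 r" "f u = f w" using balls by blast
      moreover from this have "w \<in> X1" using ball_subset by blast
      ultimately show False using u inj by (auto simp: inj_on_def)
    qed
    ultimately have "relaxed_happy r \<psi> X2 E2 \<sigma>2 \<nu> (f u)" using val by (simp add: valid_below_def)
    then show "relaxed_happy r \<psi> X1 E1 \<sigma>1 (\<nu> \<circ> f) u"
      using relaxed_happy_transfer[OF T1 T2 _ _ f ball_subset ball_subset E, of u \<sigma>2 \<sigma>1 \<nu> "\<nu> \<circ> f"] u \<open>f u \<in> X2\<close> L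
      by auto
  next
    fix u assume "u \<in> X1"
    then have "f u \<in> X2" "\<mu>2 (f u) = \<mu>1 u" using f L by (auto simp: bij_betw_def)
    then show "(\<nu> \<circ> f) u = None \<longrightarrow> \<mu>1 u = None"
      using val unfolding valid_below_def by (metis comp_apply)
  qed
  ultimately show "c \<in> root_type X1 E1 \<sigma>1 \<mu>1 x1" by (simp only: root_typeI)
qed

lemma root_type_iso:
  assumes T1: "bdd_tree \<Delta> X1 E1" and T2: "bdd_tree \<Delta> X2 E2" and f: "bij_betw f X1 X2" and x: "x1 \<in> X1" "f x1 = x2"
    and E: "\<And>a b. a \<in> X1 \<Longrightarrow> b \<in> X1 \<Longrightarrow> E1 a b \<longleftrightarrow> E2 (f a) (f b)"
    and L: "\<And>a. a \<in> X1 \<Longrightarrow> \<sigma>2 (f a) = \<sigma>1 a \<and> \<mu>2 (f a) = \<mu>1 a"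
  shows "root_type X2 E2 \<sigma>2 \<mu>2 x2 = root_type X1 E1 \<sigma>1 \<mu>1 x1"
proof
  show "root_type X2 E2 \<sigma>2 \<mu>2 x2 \<subseteq> root_type X1 E1 \<sigma>1 \<mu>1 x1"
  proof (rule root_type_iso_subset[OF T1 T2 f x])
    show "E1 a b \<longleftrightarrow> E2 (f a) (f b)" if "a \<in> X1" "b \<in> X1" for a b using E that .
    show "\<sigma>2 (f a) = \<sigma>1 a \<and> \<mu>2 (f a) = \<mu>1 a" if "a \<in> X1" for a using L that .
  qed
  let ?g = "inv_into X1 f"
  have g: "?g b \<in> X1" "f (?g b) = b" if "b \<in> X2" for b
    using that f by (auto simp: bij_betw_def f_inv_into_f inv_into_into)
  show "root_type X1 E1 \<sigma>1 \<mu>1 x1 \<subseteq> root_type X2 E2 \<sigma>2 \<mu>2 x2"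
  proof (rule root_type_iso_subset[OF T2 T1 bij_betw_inv_into[OF f]])
    show "x2 \<in> X2" using x f by (auto simp: bij_betw_def)
    show "?g x2 = x1" using x f by (auto simp: bij_betw_def)
    show "E2 a b \<longleftrightarrow> E1 (?g a) (?g b)" if "a \<in> X2" "b \<in> X2" for a b
      using E[of "?g a" "?g b"] g that by simp
    show "\<sigma>1 (?g a) = \<sigma>2 a \<and> \<mu>1 (?g a) = \<mu>2 a" if "a \<in> X2" for a
      using L[of "?g a"] g that by simp
  qed
qed

text \<open>All codes live over the numbers below \<open>Suc \<Delta> ^ (2 * r + 1)\<close>, a bound
  for the size of a window, and over finite label types.\<close>

lemma finite_range_root_type:
  "finite ((\<lambda>(X, E, \<sigma>, \<mu>, x). root_type X E \<sigma> \<mu> x) ` S)"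
proof (rule finite_subset)
  let ?N = "{..<Suc \<Delta> ^ (2 * r + 1)}"
  show "(\<lambda>(X, E, \<sigma>, \<mu>, x). root_type X E \<sigma> \<mu> x) ` S \<subseteq> Pow (Pow (?N \<times> ?N) \<times> Pow (?N \<times> UNIV))"
  proof clarify
    fix X E \<sigma> \<mu> x e l
    assume "(e, l) \<in> root_type X E \<sigma> \<mu> x"
    then obtain g lab where "(e, l) = code g (window X E x) E lab" "g ` window X E x \<subseteq> ?N"
      by (rule root_typeE)
    then show "e \<in> Pow (?N \<times> ?N) \<and> l \<in> Pow (?N \<times> UNIV)" unfolding code_def by auto
  qed
  show "finite (Pow (Pow (?N \<times> ?N) \<times> Pow (?N \<times> (UNIV :: ('i \<times> 'o option \<times> 'o option \<times> bool) set))))"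
    by simp
qed

text \<open>\<open>K\<close> bounds the size of one chosen representative for each type. It is
  renamed into \<open>X\<close> with the root kept, so that it stays disjoint from the rest of any
  tree having \<open>X\<close> as a branch; \<open>K < card X\<close> gives the room.\<close>

lemma small_representatives:
  "\<exists>K. \<forall>X E \<sigma> \<mu> x. bdd_tree \<Delta> X E \<longrightarrow> x \<in> X \<longrightarrow> K < card X \<longrightarrow>
     (\<exists>X' E' \<sigma>' \<mu>'. X' \<subseteq> X \<and> x \<in> X' \<and> card X' \<le> K \<and> bdd_tree \<Delta> X' E' \<and>
        root_type X' E' \<sigma>' \<mu>' x = root_type X E \<sigma> \<mu> x)"
proof -
  let ?S = "{(X, E, \<sigma> :: nat \<Rightarrow> 'i, \<mu> :: nat \<Rightarrow> 'o option, x). bdd_tree \<Delta> X E \<and> x \<in> X}"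
  let ?F = "\<lambda>(X, E, \<sigma>, \<mu>, x). root_type X E \<sigma> \<mu> x"
  have "\<exists>K. \<forall>s\<in>?S. \<exists>s'\<in>?S. ?F s' = ?F s \<and> card (fst s') \<le> K"
    by (rule finite_range_bounded_witness[OF finite_range_root_type])
  then obtain K where K: "\<forall>s\<in>?S. \<exists>s'\<in>?S. ?F s' = ?F s \<and> card (fst s') \<le> K" by (rule exE)
  show ?thesis
  proof (intro exI[of _ K] allI impI)
    fix X E and \<sigma> :: "nat \<Rightarrow> 'i" and \<mu> :: "nat \<Rightarrow> 'o option" and x
    assume T: "bdd_tree \<Delta> X E" and x: "x \<in> X" and big: "K < card X"
    then have "(X, E, \<sigma>, \<mu>, x) \<in> ?S" by simp
    from bspec[OF K this] obtain s' where s': "s' \<in> ?S" "?F s' = ?F (X, E, \<sigma>, \<mu>, x)" "card (fst s') \<le> K"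
      by (elim bexE conjE)
    obtain X' E' \<sigma>' \<mu>' x' where "s' = (X', E', \<sigma>', \<mu>', x')" by (cases s')
    with s' have X': "bdd_tree \<Delta> X' E'" "x' \<in> X'" "card X' \<le> K"
      "root_type X' E' \<sigma>' \<mu>' x' = root_type X E \<sigma> \<mu> x" by simp_all
    have fin: "finite X" "finite X'"
      using T X'(1) by (auto simp: bdd_tree_def is_tree_def simple_graph_def)
    have "card (X' - {x'}) \<le> card (X - {x})" using X' big x fin by simp
    then obtain f0 where f0: "f0 ` (X' - {x'}) \<subseteq> X - {x}" "inj_on f0 (X' - {x'})"
      using card_le_inj[of "X' - {x'}" "X - {x}"] fin by blast
    define f where "f = f0(x' := x)"
    have f: "f ` X' \<subseteq> X" "inj_on f X'" "f x' = x"
      using f0 x unfolding f_def inj_on_def by (auto simp: image_subset_iff)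
    let ?E = "\<lambda>a b. \<exists>u v. a = f u \<and> b = f v \<and> E' u v"
    let ?g = "inv_into X' f"
    have bij: "bij_betw f X' (f ` X')" using f(2) by (simp add: bij_betw_def)
    note iso = bdd_tree_iso[OF X'(1) bij refl]
    have "root_type (f ` X') ?E (\<sigma>' \<circ> ?g) (\<mu>' \<circ> ?g) x = root_type X' E' \<sigma>' \<mu>' x'"
      by (rule root_type_iso[OF X'(1) iso(1) bij X'(2) f(3)]) (use iso(2) f(2) in auto)
    moreover have "card (f ` X') \<le> K" using card_image[OF f(2)] X'(3) by simp
    moreover have "x \<in> f ` X'" using f(3) X'(2) by blast
    ultimately show "\<exists>X' E' \<sigma>' \<mu>'. X' \<subseteq> X \<and> x \<in> X' \<and> card X' \<le> K \<and> bdd_tree \<Delta> X' E' \<and>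
        root_type X' E' \<sigma>' \<mu>' x = root_type X E \<sigma> \<mu> x"
      using f(1) iso(1) unfolding X'(4)[symmetric]
      by - (rule exI[of _ "f ` X'"], rule exI[of _ ?E], rule exI[of _ "\<sigma>' \<circ> ?g"], rule exI[of _ "\<mu>' \<circ> ?g"],
        intro conjI, assumption+)
  qed
qed

section \<open>Branches seen inside a host tree\<close>

lemma relaxed_happy_branch:
  assumes T: "bdd_tree \<Delta> V E" and X: "X \<subseteq> V" "x \<in> X"
    and cross: "\<And>a b. a \<in> V - X \<Longrightarrow> b \<in> X \<Longrightarrow> E a b \<Longrightarrow> b = x"
    and u: "u \<in> X - ball X (induced E X) x r"
  shows "relaxed_happy r \<psi> V E \<sigma> \<mu> u \<longleftrightarrow> relaxed_happy r \<psi> X (induced E X) \<sigma> \<mu> u"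
proof -
  note sg = bdd_tree_simple_graph[OF T]
  have TX: "bdd_tree \<Delta> X (induced E X)" by (rule bdd_tree_branch[OF T X cross])
  have "ball V E u r \<subseteq> X"
  proof (rule ccontr)
    assume "\<not> ball V E u r \<subseteq> X"
    then obtain a b where ab: "a \<in> X" "b \<notin> X" "E a b" "a \<in> ball X (induced E X) u r"
      using ball_induced_exit[OF sg X(1), of u r] u by blast
    then have "E b a" "b \<in> V" using sg by (auto simp: simple_graph_def)
    then have "a = x" using cross ab by blast
    then show False using ab ball_sym[OF bdd_tree_simple_graph[OF TX]] u by blast
  qed
  then show ?thesis using relaxed_happy_induced[OF T X(1) TX, of u \<mu> \<mu> \<sigma>] u by blast
qed

text \<open>Compares two trees with the same outside whose branches look alike near
  \<open>x\<close>. Vertices deep in the branch are settled by \<open>val\<close>; all others see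
  only the outside and the window, where the identity and \<open>f\<close> glue to an
  isomorphism.\<close>

lemma transplant:
  assumes T1: "bdd_tree \<Delta> V1 E1" and T2: "bdd_tree \<Delta> V2 E2"
    and X1: "X1 \<subseteq> V1" "x \<in> X1" and X2: "X2 \<subseteq> V2" "x \<in> X2" and Y: "V1 - X1 = V2 - X2"
    and cross1: "\<And>a b. a \<in> V1 - X1 \<Longrightarrow> b \<in> X1 \<Longrightarrow> E1 a b \<Longrightarrow> b = x"
    and cross2: "\<And>a b. a \<in> V2 - X2 \<Longrightarrow> b \<in> X2 \<Longrightarrow> E2 a b \<Longrightarrow> b = x"
    and EY: "\<And>a b. a \<in> insert x (V1 - X1) \<Longrightarrow> b \<in> insert x (V1 - X1) \<Longrightarrow> E1 a b \<longleftrightarrow> E2 a b"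
    and LY: "\<And>a. a \<in> V1 - X1 \<Longrightarrow> \<sigma>2 a = \<sigma>1 a \<and> \<mu>2 a = \<mu>1 a"
    and f: "bij_betw f (window X1 (induced E1 X1) x) (window X2 (induced E2 X2) x)" "f x = x"
    and EX: "\<And>a b. a \<in> window X1 (induced E1 X1) x \<Longrightarrow> b \<in> window X1 (induced E1 X1) x \<Longrightarrow>
       induced E1 X1 a b \<longleftrightarrow> induced E2 X2 (f a) (f b)"
    and LX: "\<And>a. a \<in> window X1 (induced E1 X1) x \<Longrightarrow> \<sigma>2 (f a) = \<sigma>1 a \<and> \<mu>2 (f a) = \<mu>1 a"
    and acc: "relaxed_accepts r \<psi> V2 E2 \<sigma>2 \<mu>2"
    and val: "\<And>u. u \<in> X1 - ball X1 (induced E1 X1) x r \<Longrightarrow> relaxed_happy r \<psi> X1 (induced E1 X1) \<sigma>1 \<mu>1 u"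
  shows "relaxed_accepts r \<psi> V1 E1 \<sigma>1 \<mu>1"
  unfolding relaxed_accepts_def
proof
  let ?Y = "V1 - X1" and ?I1 = "induced E1 X1" and ?I2 = "induced E2 X2"
  let ?W1 = "window X1 ?I1 x" and ?W2 = "window X2 ?I2 x"
  note sg1 = bdd_tree_simple_graph[OF T1] and sg2 = bdd_tree_simple_graph[OF T2]
  have TX1: "bdd_tree \<Delta> X1 ?I1" by (rule bdd_tree_branch[OF T1 X1 cross1])
  have TX2: "bdd_tree \<Delta> X2 ?I2" by (rule bdd_tree_branch[OF T2 X2 cross2])
  have W: "?W1 \<subseteq> X1" "?W2 \<subseteq> X2" "x \<in> ?W1" "x \<in> ?W2"
    unfolding window_def using ball_subset center_in_ball X1(2) X2(2) by auto
  have fW: "f ` ?W1 = ?W2" "inj_on f ?W1" using f by (auto simp: bij_betw_def)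
  fix u assume u: "u \<in> V1"
  show "relaxed_happy r \<psi> V1 E1 \<sigma>1 \<mu>1 u"
  proof (cases "u \<in> X1 - ball X1 ?I1 x r")
    case True
    have "relaxed_happy r \<psi> V1 E1 \<sigma>1 \<mu>1 u \<longleftrightarrow> relaxed_happy r \<psi> X1 ?I1 \<sigma>1 \<mu>1 u"
      by (rule relaxed_happy_branch[OF T1 X1 _ True]) (rule cross1)
    then show ?thesis using val[OF True] by simp
  next
    case False
    then have uY: "u \<in> ?Y \<union> ball X1 ?I1 x r" using u by blast
    let ?F = "\<lambda>a. if a \<in> ?Y then a else f a"
    let ?D1 = "?Y \<union> ?W1" and ?D2 = "(V2 - X2) \<union> ?W2"
    have F: "?F ` ?W1 = ?W2" "?F ` ?Y = V2 - X2"
    proof -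
      have "?F ` ?W1 = f ` ?W1" using W(1) by (intro image_cong) auto
      then show "?F ` ?W1 = ?W2" using fW by simp
      have "?F ` ?Y = ?Y" by auto
      then show "?F ` ?Y = V2 - X2" using Y by simp
    qed
    have bij: "bij_betw ?F ?D1 ?D2"
    proof -
      have "bij_betw ?F ?Y (V2 - X2)" unfolding bij_betw_def using F(2) by (auto simp: inj_on_def)
      moreover have "bij_betw ?F ?W1 ?W2" 
        unfolding bij_betw_def using F(1) fW(2) W(1) by (auto simp: inj_on_def)
      moreover have "(V2 - X2) \<inter> ?W2 = {}" using W by blast
      ultimately show ?thesis by (rule bij_betw_combine)
    qed
    have img: "f ` ball X1 ?I1 x r = ball X2 ?I2 x r"
    proof -
      have "f ` ball X1 ?I1 x r = ball X2 ?I2 (f x) r"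
      proof (rule ball_iso[OF bdd_tree_simple_graph[OF TX1] bdd_tree_simple_graph[OF TX2] X1(2) _ f(1)])
        show "ball X1 ?I1 x r \<subseteq> ?W1" unfolding window_def by (rule ball_mono) simp
        show "ball X2 ?I2 (f x) r \<subseteq> ?W2" unfolding window_def f(2) by (rule ball_mono) simp
      qed (use EX X2 f(2) in auto)
      then show ?thesis using f(2) by simp
    qed
    have Fu: "?F u \<in> (V2 - X2) \<union> ball X2 ?I2 x r" using uY img Y by auto
    then have FuV: "?F u \<in> V2" using ball_subset[of X2] X2 by blast
    \<comment> \<open>Depth at most \<open>r\<close> in the branch plus the radius \<open>r\<close>
      of the verifier stays within the window.\<close>
    have b1: "ball V1 E1 u r \<subseteq> ?D1"
    proof -
      have "ball V1 E1 u r \<subseteq> ?Y \<union> ball X1 ?I1 x (r + r)" by (rule ball_attached[OF sg1 X1(2,1) cross1 uY])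
      moreover have "ball X1 ?I1 x (r + r) \<subseteq> ?W1" unfolding window_def by (rule ball_mono) simp
      ultimately show ?thesis by blast
    qed
    have b2: "ball V2 E2 (?F u) r \<subseteq> ?D2"
    proof -
      have "ball V2 E2 (?F u) r \<subseteq> (V2 - X2) \<union> ball X2 ?I2 x (r + r)" by (rule ball_attached[OF sg2 X2(2,1) cross2 Fu])
      moreover have "ball X2 ?I2 x (r + r) \<subseteq> ?W2" unfolding window_def by (rule ball_mono) simp
      ultimately show ?thesis by blast
    qed
    have fX: "f a \<in> X2" if "a \<in> ?W1" for a using that fW W by blast
    have fx: "f a = x \<longleftrightarrow> a = x" if "a \<in> ?W1" for a using fW(2) W(3) f(2) that by (auto dest: inj_onD)
    have mixed: "E1 a b \<longleftrightarrow> E2 a (f b)" if a: "a \<in> ?Y" and b: "b \<in> ?W1" for a b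
    proof
      assume "E1 a b"
      then have "b = x" using cross1 a b W by blast
      then show "E2 a (f b)" using EY[of a x] a f(2) \<open>E1 a b\<close> by simp
    next
      assume e: "E2 a (f b)"
      then have "f b = x" using cross2[of a "f b"] a Y fX[OF b] by blast
      then show "E1 a b" using fx[OF b] EY[of a x] a e by simp
    qed
    have iso: "E1 a b \<longleftrightarrow> E2 (?F a) (?F b)" if ab: "a \<in> ?D1" "b \<in> ?D1" for a b
    proof -
      have sym: "E1 a b \<longleftrightarrow> E1 b a" "E2 a b \<longleftrightarrow> E2 b a" for a b using sg1 sg2 by (auto simp: simple_graph_def)
      consider "a \<in> ?Y" "b \<in> ?Y" | "a \<in> ?Y" "b \<in> ?W1" | "a \<in> ?W1" "b \<in> ?Y" | "a \<in> ?W1" "b \<in> ?W1"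
        using ab by blast
      then show ?thesis
      proof cases
        case 1
        then show ?thesis using EY by simp
      next
        case 2
        then have "?F a = a" "?F b = f b" using W by auto
        then show ?thesis using mixed[OF 2] by simp
      next
        case 3
        then have "?F a = f a" "?F b = b" using W by auto
        then show ?thesis using mixed[OF 3(2,1)] sym by simp
      next
        case 4
        then have "?F a = f a" "?F b = f b" using W by auto
        moreover have "E1 a b \<longleftrightarrow> E2 (f a) (f b)" using EX[OF 4] 4 fX W by (auto simp: induced_def)
        ultimately show ?thesis by simp
      qed
    qed
    have "relaxed_happy r \<psi> V1 E1 \<sigma>1 \<mu>1 u \<longleftrightarrow> relaxed_happy r \<psi> V2 E2 \<sigma>2 \<mu>2 (?F u)"
    proof (rule relaxed_happy_transfer[OF T1 T2 u FuV bij b1 b2 iso])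
      fix a assume "a \<in> ?D1"
      then show "\<sigma>2 (?F a) = \<sigma>1 a \<and> \<mu>2 (?F a) = \<mu>1 a" using LY LX by auto
    qed
    then show ?thesis using acc FuV by (simp add: relaxed_accepts_def)
  qed
qed

end

subsection \<open>Mending a caterpillar\<close>

lemma bij_betw_inverse:
  assumes "bij_betw f A B"
  obtains g where "bij_betw g B A" "\<And>b. b \<in> B \<Longrightarrow> g b \<in> A \<and> f (g b) = b" "\<And>a. a \<in> A \<Longrightarrow> g (f a) = a"
  using assms that[of "inv_into A f"]
  by (metis bij_betw_def bij_betw_inv_into f_inv_into_f inv_into_f_f inv_into_into)

text \<open>Used with \<open>k\<close> the index in a caterpillar: changes confined to a ball touch
  few bundles, and bundles with distant indices are far apart in the tree.\<close>

lemma ball_lipschitz: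
  assumes "simple_graph V E" "\<And>a b. E a b \<Longrightarrow> k b \<le> Suc (k a)"
  shows "u \<in> ball V E v n \<Longrightarrow> k u \<le> k v + n \<and> k v \<le> k u + n"
proof (induction n arbitrary: u)
  case 0
  then show ?case using ball_0[of v V E] by (auto simp: ball_def walk_def length_Suc_conv le_Suc_eq)
next
  case (Suc n)
  from Suc.prems consider "u \<in> ball V E v n" | w where "w \<in> ball V E v n" "E w u"
    using ball_Suc[OF assms(1)] by blast
  then show ?case
  proof cases
    case 1
    then show ?thesis using Suc.IH by fastforce
  next
    case 2
    have "E u w" using 2(2) assms(1) by (auto simp: simple_graph_def)
    then show ?thesis using Suc.IH[OF 2(1)] assms(2)[OF 2(2)] assms(2)[of u w] by simp
  qed
qed

text \<open>A path \<open>s 0, \<dots>, s (2 * d)\<close> with a bundle of side trees at each of its vertices; \<open>k\<close> names the bundle.\<close>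

definition caterpillar :: "nat set \<Rightarrow> (nat \<Rightarrow> nat \<Rightarrow> bool) \<Rightarrow> nat \<Rightarrow> (nat \<Rightarrow> nat) \<Rightarrow> (nat \<Rightarrow> nat) \<Rightarrow> bool" where
  "caterpillar V E d s k \<longleftrightarrow> (\<forall>v\<in>V. k v \<le> 2 * d) \<and> (\<forall>i\<le>2 * d. s i \<in> V \<and> k (s i) = i) \<and>
     (\<forall>a b. E a b \<longrightarrow> k a \<noteq> k b \<longrightarrow> (\<exists>i<2 * d. {a, b} = {s i, s (Suc i)}))"

lemma caterpillar_edge:
  assumes "caterpillar V E d s k" "E a b"
  shows "k b \<le> Suc (k a)" "k a \<noteq> k b \<Longrightarrow> b = s (k b)"
proof -
  have "k b \<le> Suc (k a) \<and> b = s (k b)" if ne: "k a \<noteq> k b"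
  proof -
    obtain i where i: "i < 2 * d" "{a, b} = {s i, s (Suc i)}" using assms ne unfolding caterpillar_def by metis
    moreover have "k (s i) = i" "k (s (Suc i)) = Suc i" using assms(1) i by (auto simp: caterpillar_def)
    ultimately show ?thesis by (auto simp: doubleton_eq_iff)
  qed
  then show "k b \<le> Suc (k a)" "k a \<noteq> k b \<Longrightarrow> b = s (k b)" by fastforce+
qed

context local_problem
begin

text \<open>While some bundle has more than \<open>K\<close> vertices, it is replaced by a
  representative and the induction continues on the smaller tree. The mend is located by the index
  \<open>k\<close>, which survives the replacement; distances inside a bundle need not.\<close>

lemma caterpillar_mend:
  assumes K: "\<forall>X E \<sigma> \<mu> x. bdd_tree \<Delta> X E \<longrightarrow> x \<in> X \<longrightarrow> K < card X \<longrightarrow>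
     (\<exists>X' E' \<sigma>' \<mu>'. X' \<subseteq> X \<and> x \<in> X' \<and> card X' \<le> K \<and> bdd_tree \<Delta> X' E' \<and>
        root_type X' E' \<sigma>' \<mu>' x = root_type X E \<sigma> \<mu> x)"
    and mend: "verifier_mendable (bdd_tree \<Delta>) r \<psi> T"
    and t: "\<And>N. 2 * d + 1 \<le> N \<Longrightarrow> N \<le> (2 * d + 1) * K \<Longrightarrow> T N \<le> t"
    and "bdd_tree \<Delta> V E" "caterpillar V E d s k" "relaxed_accepts r \<psi> V E \<sigma> \<mu>"
  shows "\<exists>\<mu>'. relaxed_accepts r \<psi> V E \<sigma> \<mu>' \<and> \<mu>' (s d) \<noteq> None \<and> (\<forall>u\<in>V. \<mu>' u = None \<longrightarrow> \<mu> u = None) \<and>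
     (\<forall>u\<in>V. \<mu>' u \<noteq> \<mu> u \<longrightarrow> d \<le> k u + t \<and> k u \<le> d + t)"
  using assms(4-6)
proof (induction "card V" arbitrary: V E \<sigma> \<mu> rule: less_induct)
  case less
  note T = less.prems(1) and cat = less.prems(2) and acc = less.prems(3)
  note sg = bdd_tree_simple_graph[OF T]
  have finV: "finite V" using sg by (simp add: simple_graph_def)
  have s: "s i \<in> V" "k (s i) = i" if "i \<le> 2 * d" for i using cat that by (auto simp: caterpillar_def)
  have kV: "k v \<le> 2 * d" if "v \<in> V" for v using cat that by (auto simp: caterpillar_def)
  show ?case
  proof (cases "\<exists>i\<le>2 * d. K < card {v \<in> V. k v = i}")
    case False
    have "V = (\<Union>i\<in>{..2 * d}. {v \<in> V. k v = i})" using kV by auto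
    then have "card V \<le> (\<Sum>i\<in>{..2 * d}. card {v \<in> V. k v = i})"
      using card_UN_le[of "{..2 * d}" "\<lambda>i. {v \<in> V. k v = i}"] by simp
    also have "\<dots> \<le> (\<Sum>i\<in>{..2 * d}. K)" using False by (intro sum_mono) (auto simp: not_less)
    finally have "card V \<le> (2 * d + 1) * K" by simp
    moreover have "card {..2 * d} \<le> card V"
    proof (rule card_inj_on_le[of s])
      show "inj_on s {..2 * d}" using s(2) by (metis atMost_iff inj_onI)
    qed (use s finV in auto)
    ultimately have Tt: "T (card V) \<le> t" using t by simp
    obtain \<mu>' where "is_mend r \<psi> V E \<sigma> \<mu> (s d) (T (card V)) \<mu>'"
      using mend T acc s(1)[of d] unfolding verifier_mendable_def by (metis le_add2 mult_2)
    then have m: "relaxed_accepts r \<psi> V E \<sigma> \<mu>'" "\<mu>' (s d) \<noteq> None" "\<And>u. \<mu>' u = None \<Longrightarrow> \<mu> u = None"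
      "\<And>u. \<mu>' u \<noteq> \<mu> u \<Longrightarrow> u \<in> ball V E (s d) (T (card V))" by (auto simp: is_mend_def)
    have "d \<le> k u + t \<and> k u \<le> d + t" if "\<mu>' u \<noteq> \<mu> u" for u
      using ball_lipschitz[of V E k, OF sg _ m(4)[OF that]] caterpillar_edge(1)[OF cat] s(2)[of d] Tt by force
    then show ?thesis using m by blast
  next
    case True
    then obtain i where i: "i \<le> 2 * d" "K < card {v \<in> V. k v = i}" by blast
    define X where "X = {v \<in> V. k v = i}"
    define x where "x = s i"
    have X: "X \<subseteq> V" "x \<in> X" and big: "K < card X" using i s by (auto simp: X_def x_def)
    have cross: "b = x" if "a \<in> V - X" "b \<in> X" "E a b" for a b
      using caterpillar_edge(2)[OF cat that(3)] that by (auto simp: X_def x_def)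
    have TX: "bdd_tree \<Delta> X (induced E X)" by (rule bdd_tree_branch[OF T X cross])
    obtain X' E' \<sigma>' \<mu>' where X': "X' \<subseteq> X" "x \<in> X'" "card X' \<le> K" "bdd_tree \<Delta> X' E'" and
      type': "root_type X' E' \<sigma>' \<mu>' x = root_type X (induced E X) \<sigma> \<mu> x"
      using K[rule_format, OF TX X(2) big, of \<sigma> \<mu>] by (elim exE conjE)
    define \<sigma>2 where "\<sigma>2 = (\<lambda>u. if u \<in> X' then \<sigma>' u else \<sigma> u)"
    have type: "root_type X' E' \<sigma>2 \<mu>' x = root_type X (induced E X) \<sigma> \<mu> x"
      unfolding type'[symmetric]
      by (rule root_type_iso[OF X'(4) X'(4) bij_betw_id X'(2)]) (auto simp: \<sigma>2_def)
    \<comment> \<open>The present labelling is a valid relabelling of itself, so the representative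
      has one with the same window, \<open>\<nu>\<close> below. It is \<open>\<nu>\<close>, not
      \<open>\<mu>'\<close>, that labels the new branch.\<close>
    have val: "valid_below X (induced E X) \<sigma> \<mu> x \<mu>"
      unfolding valid_below_def
    proof (intro conjI ballI impI)
      fix u assume u: "u \<in> X - ball X (induced E X) x r"
      have "relaxed_happy r \<psi> V E \<sigma> \<mu> u \<longleftrightarrow> relaxed_happy r \<psi> X (induced E X) \<sigma> \<mu> u"
        by (rule relaxed_happy_branch[OF T X _ u]) (rule cross)
      then show "relaxed_happy r \<psi> X (induced E X) \<sigma> \<mu> u"
        using acc u X(1) by (auto simp: relaxed_accepts_def)
    qed
    let ?W = "window X (induced E X) x" and ?W' = "window X' E' x"
    obtain f \<nu> where f_val: "valid_below X' E' \<sigma>2 \<mu>' x \<nu>" and f: "bij_betw f ?W ?W'" "f x = x"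
      and fE: "\<And>a b. a \<in> ?W \<Longrightarrow> b \<in> ?W \<Longrightarrow> induced E X a b \<longleftrightarrow> E' (f a) (f b)"
      and fL: "\<And>a. a \<in> ?W \<Longrightarrow> \<sigma>2 (f a) = \<sigma> a \<and> \<mu>' (f a) = \<mu> a \<and> \<nu> (f a) = \<mu> a"
      by (rule root_type_window[OF TX type[symmetric] X(2) val], rule that) assumption+
    obtain g where g: "bij_betw g ?W' ?W" and fg: "\<And>b. b \<in> ?W' \<Longrightarrow> g b \<in> ?W \<and> f (g b) = b"
      and gf: "\<And>a. a \<in> ?W \<Longrightarrow> g (f a) = a"
      by (rule bij_betw_inverse[OF f(1)], rule that) assumption+
    have xW: "x \<in> ?W" "x \<in> ?W'" unfolding window_def using X(2) X'(2) by (auto intro: center_in_ball)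
    have gx: "g x = x" using gf[OF xW(1)] f(2) by simp
    note sg' = bdd_tree_simple_graph[OF X'(4)]
    \<comment> \<open>Neighbours of the root lie in the window, hence come from neighbours in
      \<open>X\<close>.\<close>
    have deg: "card {u \<in> X'. E' x u} \<le> card {u \<in> X. E x u}"
    proof -
      have "{u \<in> X'. E' x u} \<subseteq> f ` {u \<in> X. E x u}"
      proof
        fix u assume u: "u \<in> {u \<in> X'. E' x u}"
        then have "u \<in> ?W'" unfolding window_def using ball_edge[OF sg', of x u "2 * r"] by simp
        then have "g u \<in> ?W" "f (g u) = u" using fg by auto
        moreover from this have "induced E X x (g u)" using fE[OF xW(1), of "g u"] f(2) u by simp
        ultimately show "u \<in> f ` {u \<in> X. E x u}" by (auto simp: induced_def intro!: image_eqI[of _ _ "g u"])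
      qed
      moreover have "finite {u \<in> X. E x u}" using X(1) finV by (auto intro: finite_subset)
      ultimately show ?thesis by (rule surj_card_le[rotated])
    qed
    define E2 where "E2 = (\<lambda>a b. (a \<in> insert x (V - X) \<and> b \<in> insert x (V - X) \<and> E a b) \<or> E' a b)"
    let ?V2 = "V - X \<union> X'"
    have disj: "X' \<inter> (V - X) = {}" using X'(1) by blast
    have T2: "bdd_tree \<Delta> ?V2 E2"
      by (rule bdd_tree_replace_branch[OF T X cross X'(4,2) disj deg E2_def])
    have E'X: "a \<in> X' \<and> b \<in> X'" if "E' a b" for a b using that sg' by (auto simp: simple_graph_def)
    have noloop: "\<not> E a a" for a using sg by (simp add: simple_graph_def)
    have ind2: "induced E2 X' = E'"
      unfolding induced_def E2_def using E'X disj noloop by (intro ext) blast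
    have V2X: "?V2 - X' = V - X" using disj by blast
    have cross2: "b = x" if "a \<in> ?V2 - X'" "b \<in> X'" "E2 a b" for a b
      using that disj E'X unfolding E2_def by blast
    have EY: "E a b \<longleftrightarrow> E2 a b" if "a \<in> insert x (V - X)" "b \<in> insert x (V - X)" for a b
    proof -
      have "\<not> E' x x" using sg' by (simp add: simple_graph_def)
      then show ?thesis using that E'X disj unfolding E2_def by blast
    qed
    have X2: "X' \<subseteq> ?V2" by blast
    have \<sigma>Y: "\<sigma>2 a = \<sigma> a" if "a \<in> V - X" for a using that X'(1) by (auto simp: \<sigma>2_def)
    define \<mu>2 where "\<mu>2 = (\<lambda>u. if u \<in> X' then \<nu> u else \<mu> u)"
    have \<mu>2: "\<mu>2 a = \<mu> a" if "a \<in> V - X" for a using that X'(1) by (auto simp: \<mu>2_def)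
    have W'X: "?W' \<subseteq> X'" unfolding window_def by (rule ball_subset)
    have acc2: "relaxed_accepts r \<psi> ?V2 E2 \<sigma>2 \<mu>2"
    proof (rule transplant[OF T2 T X2 X'(2) X V2X cross2 cross, where f = g])
      show "bij_betw g (window X' (induced E2 X') x) (window X (induced E X) x)" unfolding ind2 by (rule g)
      show "g x = x" by (rule gx)
      show "relaxed_accepts r \<psi> V E \<sigma> \<mu>" by (rule acc)
      show "E2 a b \<longleftrightarrow> E a b" if "a \<in> insert x (?V2 - X')" "b \<in> insert x (?V2 - X')" for a b
        using EY that unfolding V2X by simp
      show "\<sigma> a = \<sigma>2 a \<and> \<mu> a = \<mu>2 a" if "a \<in> ?V2 - X'" for a
        using that \<sigma>Y \<mu>2 unfolding V2X by simp
    next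
      fix a b assume "a \<in> window X' (induced E2 X') x" "b \<in> window X' (induced E2 X') x"
      then show "induced E2 X' a b \<longleftrightarrow> induced E X (g a) (g b)"
        unfolding ind2 using fE[of "g a" "g b"] fg by simp
    next
      fix a assume "a \<in> window X' (induced E2 X') x"
      then have a: "a \<in> ?W'" by (simp add: ind2)
      then have "a \<in> X'" "g a \<in> ?W" "f (g a) = a" using W'X fg by auto
      then show "\<sigma> (g a) = \<sigma>2 a \<and> \<mu> (g a) = \<mu>2 a" using fL[of "g a"] by (simp add: \<mu>2_def)
    next
      fix u assume u: "u \<in> X' - ball X' (induced E2 X') x r"
      then have "relaxed_happy r \<psi> X' E' \<sigma>2 \<nu> u" using f_val unfolding ind2 valid_below_def by blast
      moreover have "u \<in> X'" using u by blast
      moreover have "\<mu>2 a = \<nu> a" if "a \<in> ball X' E' u r" for a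
        using that ball_subset[of X' E' u r] by (auto simp: \<mu>2_def)
      ultimately show "relaxed_happy r \<psi> X' (induced E2 X') \<sigma>2 \<mu>2 u"
        unfolding ind2 using relaxed_happy_cong[OF X'(4), of u \<mu>2 \<nu> \<sigma>2] by blast
    qed
    have cat2: "caterpillar ?V2 E2 d s k"
      unfolding caterpillar_def
    proof (intro conjI ballI allI impI)
      show "k v \<le> 2 * d" if "v \<in> ?V2" for v using kV that X'(1) X(1) by blast
      show "s j \<in> ?V2" "k (s j) = j" if "j \<le> 2 * d" for j
        using s[OF that] X'(2) by (auto simp: X_def x_def)
      fix a b assume ab: "E2 a b" "k a \<noteq> k b"
      have "\<not> E' a b" using ab(2) E'X X'(1) by (auto simp: X_def)
      then have "E a b" using ab(1) by (simp add: E2_def)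
      then show "\<exists>i<2 * d. {a, b} = {s i, s (Suc i)}" using cat ab(2) by (simp add: caterpillar_def)
    qed
    have "card X' < card X" using X'(3) big by simp
    moreover have "card ?V2 = card (V - X) + card X'"
      using finV finite_subset[OF X'(1) finite_subset[OF X(1) finV]] disj by (intro card_Un_disjoint) auto
    moreover have "card V = card (V - X) + card X"
      using finV X(1) by (metis card_Diff_subset card_mono finite_subset le_add_diff_inverse2)
    ultimately have "card ?V2 < card V" by simp
    from less.hyps[OF this T2 cat2 acc2] obtain \<mu>3 where acc3: "relaxed_accepts r \<psi> ?V2 E2 \<sigma>2 \<mu>3"
      and m3: "\<mu>3 (s d) \<noteq> None" "\<And>u. u \<in> ?V2 \<Longrightarrow> \<mu>3 u = None \<Longrightarrow> \<mu>2 u = None"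
      "\<And>u. u \<in> ?V2 \<Longrightarrow> \<mu>3 u \<noteq> \<mu>2 u \<Longrightarrow> d \<le> k u + t \<and> k u \<le> d + t" by blast
    \<comment> \<open>Outside the range of the mend the bundle keeps its old labels: types match
      windows only, so carrying labels back could alter those deep inside. Within the range the new
      labels are carried back, by a map \<open>f'\<close> that need not be \<open>f\<close>.\<close>
    obtain f' \<nu>' where val': "valid_below X (induced E X) \<sigma> \<mu> x \<nu>'" and f': "bij_betw f' ?W ?W'" "f' x = x"
      and fE': "\<And>a b. a \<in> ?W \<Longrightarrow> b \<in> ?W \<Longrightarrow> induced E X a b \<longleftrightarrow> E' (f' a) (f' b)"
      and fL': "\<And>a. a \<in> ?W \<Longrightarrow> \<sigma>2 (f' a) = \<sigma> a \<and> \<mu>3 (f' a) = \<nu>' a"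
      and far: "\<not> (d \<le> i + t \<and> i \<le> d + t) \<Longrightarrow> \<nu>' = \<mu>"
    proof (cases "d \<le> i + t \<and> i \<le> d + t")
      case False
      have "\<mu>3 (f a) = \<mu> a" if "a \<in> ?W" for a
      proof -
        have "f a \<in> X'" using that f(1) W'X by (auto simp: bij_betw_def)
        moreover from this have "k (f a) = i" using X'(1) by (auto simp: X_def)
        ultimately show ?thesis using m3(3)[of "f a"] False fL[OF that] by (auto simp: \<mu>2_def)
      qed
      then show ?thesis using that[OF val f fE] fL by blast
    next
      case True
      \<comment> \<open>Holes of \<open>\<mu>3\<close> in the representative are holes of
        \<open>\<nu>\<close>, hence of \<open>\<mu>'\<close>. So \<open>\<mu>3\<close> is again one
        of the relabellings recorded in the type, and \<open>X\<close> has a counterpart of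
        it.\<close>
      have val3: "valid_below X' E' \<sigma>2 \<mu>' x \<mu>3"
        unfolding valid_below_def
      proof (intro conjI ballI impI)
        fix u assume "u \<in> X' - ball X' E' x r"
        then have u: "u \<in> X' - ball X' (induced E2 X') x r" by (simp add: ind2)
        have "relaxed_happy r \<psi> ?V2 E2 \<sigma>2 \<mu>3 u \<longleftrightarrow> relaxed_happy r \<psi> X' (induced E2 X') \<sigma>2 \<mu>3 u"
          by (rule relaxed_happy_branch[OF T2 X2 X'(2) _ u]) (rule cross2)
        then show "relaxed_happy r \<psi> X' E' \<sigma>2 \<mu>3 u"
          using acc3 \<open>u \<in> X' - ball X' E' x r\<close> unfolding ind2 relaxed_accepts_def by blast
      next
        fix u assume "u \<in> X'" "\<mu>3 u = None"
        then have "\<nu> u = None" using m3(2)[of u] by (simp add: \<mu>2_def)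
        then show "\<mu>' u = None" using f_val \<open>u \<in> X'\<close> by (simp add: valid_below_def)
      qed
      obtain h \<nu>' where h: "valid_below X (induced E X) \<sigma> \<mu> x \<nu>'" "bij_betw h ?W' ?W" "h x = x"
        "\<And>a b. a \<in> ?W' \<Longrightarrow> b \<in> ?W' \<Longrightarrow> E' a b \<longleftrightarrow> induced E X (h a) (h b)"
        "\<And>a. a \<in> ?W' \<Longrightarrow> \<sigma> (h a) = \<sigma>2 a \<and> \<mu> (h a) = \<mu>' a \<and> \<nu>' (h a) = \<mu>3 a"
        by (rule root_type_window[OF X'(4) type X'(2) val3], rule that) assumption+
      obtain h' where h': "bij_betw h' ?W ?W'" "\<And>b. b \<in> ?W \<Longrightarrow> h' b \<in> ?W' \<and> h (h' b) = b"
        "\<And>a. a \<in> ?W' \<Longrightarrow> h' (h a) = a"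
        by (rule bij_betw_inverse[OF h(2)], rule that) assumption+
      show ?thesis
      proof (rule that[OF h(1) h'(1)])
        show "h' x = x" using h'(3)[OF xW(2)] h(3) by simp
        show "induced E X a b \<longleftrightarrow> E' (h' a) (h' b)" if "a \<in> ?W" "b \<in> ?W" for a b
          using h(4)[of "h' a" "h' b"] h'(2) that by simp
        show "\<sigma>2 (h' a) = \<sigma> a \<and> \<mu>3 (h' a) = \<nu>' a" if "a \<in> ?W" for a
          using h(5)[of "h' a"] h'(2) that by simp
      qed (use True in blast)
    qed
    define \<mu>4 where "\<mu>4 = (\<lambda>u. if u \<in> X then \<nu>' u else \<mu>3 u)"
    have WX: "?W \<subseteq> X" unfolding window_def by (rule ball_subset)
    have acc4: "relaxed_accepts r \<psi> V E \<sigma> \<mu>4"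
    proof (rule transplant[OF T T2 X X2 X'(2) V2X[symmetric] cross cross2 EY, where f = f'])
      show "bij_betw f' (window X (induced E X) x) (window X' (induced E2 X') x)" unfolding ind2 by (rule f')
      show "relaxed_accepts r \<psi> ?V2 E2 \<sigma>2 \<mu>3" by (rule acc3)
      show "\<sigma>2 a = \<sigma> a \<and> \<mu>3 a = \<mu>4 a" if "a \<in> V - X" for a
        using that \<sigma>Y by (simp add: \<mu>4_def)
      show "induced E X a b \<longleftrightarrow> induced E2 X' (f' a) (f' b)" if "a \<in> ?W" "b \<in> ?W" for a b
        unfolding ind2 by (rule fE'[OF that])
      show "\<sigma>2 (f' a) = \<sigma> a \<and> \<mu>3 (f' a) = \<mu>4 a" if "a \<in> ?W" for a
        using fL'[OF that] that WX by (auto simp: \<mu>4_def)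
    next
      fix u assume u: "u \<in> X - ball X (induced E X) x r"
      then have "relaxed_happy r \<psi> X (induced E X) \<sigma> \<nu>' u" using val' unfolding valid_below_def by blast
      moreover have "u \<in> X" using u by blast
      moreover have "\<mu>4 a = \<nu>' a" if "a \<in> ball X (induced E X) u r" for a
        using that ball_subset[of X "induced E X" u r] by (auto simp: \<mu>4_def)
      ultimately show "relaxed_happy r \<psi> X (induced E X) \<sigma> \<mu>4 u"
        using relaxed_happy_cong[OF TX, of u \<mu>4 \<nu>' \<sigma>] by blast
    qed (use f' in auto)
    show ?thesis
    proof (intro exI[of _ \<mu>4] conjI ballI impI)
      show "relaxed_accepts r \<psi> V E \<sigma> \<mu>4" by (rule acc4)
      show "\<mu>4 (s d) \<noteq> None"
      proof (cases "d = i")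
        case True
        then have "\<mu>4 (s d) = \<mu>3 (s d)" using fL'[OF xW(1)] f'(2) X(2) by (simp add: \<mu>4_def x_def)
        then show ?thesis using m3(1) by simp
      next
        case False
        then have "s d \<notin> X" using s(2)[of d] by (simp add: X_def)
        then show ?thesis using m3(1) by (simp add: \<mu>4_def)
      qed
      fix u assume u: "u \<in> V"
      show "\<mu> u = None" if "\<mu>4 u = None"
      proof (cases "u \<in> X")
        case True
        then show ?thesis using that val' by (simp add: \<mu>4_def valid_below_def)
      next
        case False
        then show ?thesis using that u m3(2)[of u] \<mu>2[of u] by (simp add: \<mu>4_def)
      qed
      have "d \<le> k u + t \<and> k u \<le> d + t" if "\<mu>4 u \<noteq> \<mu> u"
      proof (cases "u \<in> X")
        case True
        then have "k u = i" by (simp add: X_def)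
        then show ?thesis using far that True by (auto simp: \<mu>4_def)
      next
        case False
        then show ?thesis using that u m3(3)[of u] \<mu>2[of u] by (simp add: \<mu>4_def)
      qed
      then show "\<mu>4 u \<noteq> \<mu> u \<Longrightarrow> d \<le> k u + t" "\<mu>4 u \<noteq> \<mu> u \<Longrightarrow> k u \<le> d + t" by auto
    qed
  qed
qed

end

subsection \<open>Mending along levels\<close>

lemma rooted_funpow_root: "rooted V E v p h \<Longrightarrow> (p ^^ m) v = v"
  by (induction m) (auto simp: rooted_def)

lemma rooted_height_le:
  assumes "rooted V E v p h" "y \<in> V"
  shows "h ((p ^^ m) y) \<le> h y"
proof (induction m)
  case (Suc m)
  have "(p ^^ m) y \<in> V" using rooted_funpow[OF assms] .
  then have "h (p ((p ^^ m) y)) \<le> h ((p ^^ m) y)" using assms(1) unfolding rooted_def by (metis order.refl less_imp_le)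
  then show ?case using Suc by simp
qed simp

definition descendants :: "nat set \<Rightarrow> (nat \<Rightarrow> nat) \<Rightarrow> nat \<Rightarrow> nat set" where
  "descendants V p x = {y \<in> V. \<exists>m. (p ^^ m) y = x}"

lemma descendants_parent: "y \<in> V \<Longrightarrow> p y \<in> descendants V p x \<Longrightarrow> y \<in> descendants V p x"
  unfolding descendants_def by (auto simp flip: funpow_swap1 intro: exI[of _ "Suc _"])

lemma descendants_cases:
  assumes "rooted V E v p h" "y \<in> descendants V p x"
  shows "y = x \<or> p y \<in> descendants V p x"
proof -
  obtain m where m: "y \<in> V" "(p ^^ m) y = x" using assms(2) by (auto simp: descendants_def)
  have "p y \<in> V" using assms(1) m by (simp add: rooted_def)
  then show ?thesis using m by (cases m) (auto simp: descendants_def funpow_swap1)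
qed

context local_problem
begin

text \<open>The cuts cost labels on \<open>H\<close> only; once these holes are filled, the
  labelling is a mend of the original one.\<close>

lemma mend_after_filling:
  assumes "finite H" "relaxed_accepts r \<psi> V E \<sigma> \<mu>1" "\<mu>1 w \<noteq> None"
    and none: "\<And>u. \<mu>1 u = None \<Longrightarrow> \<mu> u = None \<or> u \<in> H"
    and change: "\<And>u. \<mu>1 u \<noteq> \<mu> u \<Longrightarrow> u \<in> ball V E w R"
    and mend: "\<And>x \<mu>. x \<in> H \<Longrightarrow> relaxed_accepts r \<psi> V E \<sigma> \<mu> \<Longrightarrow> \<exists>\<mu>'. is_mend r \<psi> V E \<sigma> \<mu> x (b x) \<mu>'"
    and balls: "\<And>x. x \<in> H \<Longrightarrow> ball V E x (b x) \<subseteq> ball V E w R"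
  shows "\<exists>\<mu>'. is_mend r \<psi> V E \<sigma> \<mu> w R \<mu>'"
proof -
  obtain \<mu>' where m: "relaxed_accepts r \<psi> V E \<sigma> \<mu>'" "\<And>x. x \<in> H \<Longrightarrow> \<mu>' x \<noteq> None"
    "\<And>u. \<mu>' u = None \<Longrightarrow> \<mu>1 u = None" "\<And>u. \<mu>' u \<noteq> \<mu>1 u \<Longrightarrow> u \<in> ball V E w R"
    using fill_holes[OF assms(1,2) mend balls] by metis
  have "u \<in> ball V E w R" if "\<mu>' u \<noteq> \<mu> u" for u
    using that m(4)[of u] change[of u] by (cases "\<mu>' u = \<mu>1 u") auto
  moreover have "\<mu>' w \<noteq> None" using m(3)[of w] assms(3) by blast
  moreover have "\<mu> u = None" if "\<mu>' u = None" for u using none[OF m(3)[OF that]] m(2)[of u] that by blast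
  ultimately show ?thesis unfolding is_mend_def using m(1) by blast
qed

end

text \<open>The levels split the rooted tree into vertical chains, and a descending path meets each level in a
  segment of one chain. A long chain is cut in the middle.\<close>

locale leveled_tree = local_problem \<Delta> r \<psi>
  for \<Delta> r :: nat and \<psi> :: "('i::finite, 'o::finite) verifier" +
  fixes V :: "nat set" and E :: "nat \<Rightarrow> nat \<Rightarrow> bool" and v :: nat and p h lv :: "nat \<Rightarrow> nat" and d t :: nat
  assumes T: "bdd_tree \<Delta> V E" and R: "rooted V E v p h"
    and lv_mono: "\<And>y. y \<in> V \<Longrightarrow> lv y \<le> lv (p y)"
    and lv_unique: "\<And>x y. x \<in> V \<Longrightarrow> y \<in> V \<Longrightarrow> x \<noteq> v \<Longrightarrow> y \<noteq> v \<Longrightarrow> p x = p y \<Longrightarrow>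
      lv x = lv (p x) \<Longrightarrow> lv y = lv (p y) \<Longrightarrow> x = y"
    and far: "t + 2 * r < d"
    and caterpillar_mendable: "\<And>V E s k \<sigma> \<mu>. bdd_tree \<Delta> V E \<Longrightarrow> caterpillar V E d s k \<Longrightarrow>
      relaxed_accepts r \<psi> V E \<sigma> \<mu> \<Longrightarrow>
      \<exists>\<mu>'. relaxed_accepts r \<psi> V E \<sigma> \<mu>' \<and> \<mu>' (s d) \<noteq> None \<and> (\<forall>u\<in>V. \<mu>' u = None \<longrightarrow> \<mu> u = None) \<and>
     (\<forall>u\<in>V. \<mu>' u \<noteq> \<mu> u \<longrightarrow> d \<le> k u + t \<and> k u \<le> d + t)"
begin

section \<open>Chains of constant level and the edges cut in their middle\<close>

lemmas sg = bdd_tree_simple_graph[OF T]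

lemma finite_V: "finite V" using sg by (simp add: simple_graph_def)

lemma v_in: "v \<in> V" and p_root: "p v = v" and p_in: "y \<in> V \<Longrightarrow> p y \<in> V"
  using R by (auto simp: rooted_def)

lemma up_in: "y \<in> V \<Longrightarrow> (p ^^ m) y \<in> V"
  using rooted_funpow[OF R] .

lemma lv_up_mono: "y \<in> V \<Longrightarrow> i \<le> j \<Longrightarrow> lv ((p ^^ i) y) \<le> lv ((p ^^ j) y)"
proof (induction j)
  case (Suc j)
  show ?case
  proof (cases "i = Suc j")
    case False
    then have "lv ((p ^^ i) y) \<le> lv ((p ^^ j) y)" using Suc by simp
    also have "\<dots> \<le> lv (p ((p ^^ j) y))" using lv_mono up_in Suc.prems by blast
    finally show ?thesis by simp
  qed simp
qed simp

text \<open>Indexed downwards from the top \<open>s 0\<close>, with \<open>n + 1\<close> vertices.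
  The condition on \<open>v\<close> rules out repeating the root along its loop.\<close>

definition chain :: "nat \<Rightarrow> (nat \<Rightarrow> nat) \<Rightarrow> bool" where
  "chain n s \<longleftrightarrow> (\<forall>i\<le>n. s i \<in> V \<and> lv (s i) = lv (s 0)) \<and> (\<forall>i<n. s (Suc i) \<noteq> v \<and> p (s (Suc i)) = s i)"

lemma chainD:
  assumes "chain n s"
  shows "i \<le> n \<Longrightarrow> s i \<in> V" "i \<le> n \<Longrightarrow> lv (s i) = lv (s 0)" "i < n \<Longrightarrow> s (Suc i) \<noteq> v" "i < n \<Longrightarrow> p (s (Suc i)) = s i"
  using assms unfolding chain_def by blast+

text \<open>The lower end of the middle edge of \<open>2 * d + 2\<close> consecutive vertices: with
  this length both \<open>b\<close> and \<open>p b\<close> are midpoints of chains on the indices 0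
  to \<open>2 * d\<close>. Every such edge counts; no selection is made.\<close>

definition cut_vertex :: "nat \<Rightarrow> bool" where
  "cut_vertex b \<longleftrightarrow> (\<exists>s. chain (2 * d + 1) s \<and> s (Suc d) = b)"

text \<open>The vertices at or below a cut of level less than \<open>k\<close>. The set is closed
  under children, so its boundary consists of topmost cuts, and erasing happens only there.\<close>

definition cut_off :: "nat \<Rightarrow> nat set" where
  "cut_off k = {y \<in> V. \<exists>m. cut_vertex ((p ^^ m) y) \<and> lv ((p ^^ m) y) < k}"

lemma cut_vertex_chains:
  assumes "cut_vertex b"
  obtains s s' where "chain (2 * d) s" "s d = b" "chain (2 * d) s'" "s' d = p b" "lv (p b) = lv b"
proof -
  obtain s where s: "chain (2 * d + 1) s" "s (Suc d) = b" using assms by (auto simp: cut_vertex_def)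
  note D = chainD[OF s(1)]
  have "chain (2 * d) (s \<circ> Suc)"
    unfolding chain_def
  proof (intro conjI allI impI)
    fix i assume i: "i \<le> 2 * d"
    show "(s \<circ> Suc) i \<in> V" using D(1)[of "Suc i"] i by simp
    show "lv ((s \<circ> Suc) i) = lv ((s \<circ> Suc) 0)" using D(2)[of "Suc i"] D(2)[of "Suc 0"] i by simp
  next
    fix i assume i: "i < 2 * d"
    show "(s \<circ> Suc) (Suc i) \<noteq> v" "p ((s \<circ> Suc) (Suc i)) = (s \<circ> Suc) i"
      using D(3)[of "Suc i"] D(4)[of "Suc i"] i by simp_all
  qed
  moreover have "chain (2 * d) s"
    unfolding chain_def
  proof (intro conjI allI impI)
    show "s i \<in> V" "lv (s i) = lv (s 0)" if "i \<le> 2 * d" for i using D(1)[of i] D(2)[of i] that by simp_all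
    show "s (Suc i) \<noteq> v" "p (s (Suc i)) = s i" if "i < 2 * d" for i using D(3)[of i] D(4)[of i] that by simp_all
  qed
  moreover have "s d = p b" using D(4)[of d] s(2) by simp
  moreover have "lv (p b) = lv b" using D(2)[of d] D(2)[of "Suc d"] s(2) \<open>s d = p b\<close> by simp
  ultimately show ?thesis using that[of "s \<circ> Suc" s] s(2) by simp
qed

lemma cut_off_child: "y \<in> V \<Longrightarrow> p y \<in> cut_off k \<Longrightarrow> y \<in> cut_off k"
  unfolding cut_off_def by (auto simp flip: funpow_swap1 intro: exI[of _ "Suc _"])

lemma cut_off_boundary:
  assumes "b \<in> cut_off k" "p b \<notin> cut_off k"
  shows "cut_vertex b" "lv b < k"
proof -
  obtain m where m: "b \<in> V" "cut_vertex ((p ^^ m) b)" "lv ((p ^^ m) b) < k" using assms(1) by (auto simp: cut_off_def)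
  have "m = 0"
  proof (rule ccontr)
    assume "m \<noteq> 0"
    then obtain n where "m = Suc n" using not0_implies_Suc by blast
    then have "p b \<in> cut_off k" using m p_in by (auto simp: cut_off_def funpow_swap1)
    then show False using assms(2) by blast
  qed
  then show "cut_vertex b" "lv b < k" using m by simp_all
qed

lemma root_not_cut_off: "v \<notin> cut_off k"
proof
  assume "v \<in> cut_off k"
  then have "cut_vertex v" using rooted_funpow_root[OF R] by (auto simp: cut_off_def)
  then obtain s where "chain (2 * d + 1) s" "s (Suc d) = v" by (auto simp: cut_vertex_def)
  then show False using chainD(3)[of "2 * d + 1" s d] by simp
qed

text \<open>If \<open>2 * d + 1\<close> steps upwards kept the level, the vertices passed would form
  a chain, and its middle edge would be a cut above \<open>y\<close>. So each block of that many
  steps gains a level, and \<open>2 * d\<close> is the largest remainder.\<close>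

lemma climb:
  assumes y: "y \<in> V" "y \<notin> cut_off k" and low: "lv ((p ^^ m) y) < k" and proper: "\<And>i. i < m \<Longrightarrow> (p ^^ i) y \<noteq> v"
  shows "m \<le> (2 * d + 1) * (lv ((p ^^ m) y) - lv y) + 2 * d"
proof -
  let ?L = "2 * d + 1"
  have step: "lv ((p ^^ i) y) < lv ((p ^^ (i + ?L)) y)" if i: "i + ?L \<le> m" for i
  proof (rule ccontr)
    assume "\<not> ?thesis"
    then have eq: "lv ((p ^^ (i + ?L)) y) = lv ((p ^^ i) y)" using lv_up_mono[OF y(1), of i "i + ?L"] by simp
    have all: "lv ((p ^^ (i + ?L - j)) y) = lv ((p ^^ i) y)" if "j \<le> ?L" for j
      using lv_up_mono[OF y(1), of i "i + ?L - j"] lv_up_mono[OF y(1), of "i + ?L - j" "i + ?L"] eq that by simp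
    define s where "s = (\<lambda>j. (p ^^ (i + ?L - j)) y)"
    have "chain ?L s"
      unfolding chain_def
    proof (intro conjI allI impI)
      show "s j \<in> V" for j using up_in[OF y(1)] by (simp add: s_def)
      show "lv (s j) = lv (s 0)" if "j \<le> ?L" for j using all[OF that] all[of 0] by (simp add: s_def)
      fix j assume j: "j < ?L"
      show "s (Suc j) \<noteq> v" unfolding s_def using i j by (intro proper) simp
      have "i + ?L - j = Suc (i + ?L - Suc j)" using j by simp
      then show "p (s (Suc j)) = s j" unfolding s_def by simp
    qed
    then have "cut_vertex (s (Suc d))" unfolding cut_vertex_def by blast
    moreover have "lv (s (Suc d)) < k"
      using all[of "Suc d"] lv_up_mono[OF y(1), of i m] i low by (simp add: s_def)
    ultimately have "y \<in> cut_off k" unfolding cut_off_def s_def using y(1) by blast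
    then show False using y(2) by blast
  qed
  have levels: "q * ?L \<le> m \<Longrightarrow> lv y + q \<le> lv ((p ^^ (q * ?L)) y)" for q
  proof (induction q)
    case (Suc q)
    then have "lv y + q < lv ((p ^^ (q * ?L + ?L)) y)" using step[of "q * ?L"] by simp
    then show ?case by (simp add: algebra_simps)
  qed simp
  have "lv y + m div ?L \<le> lv ((p ^^ (m div ?L * ?L)) y)" by (rule levels[OF div_times_less_eq_dividend])
  also have "\<dots> \<le> lv ((p ^^ m) y)" by (rule lv_up_mono[OF y(1) div_times_less_eq_dividend])
  finally have "m div ?L \<le> lv ((p ^^ m) y) - lv y" by simp
  then have "?L * (m div ?L) \<le> ?L * (lv ((p ^^ m) y) - lv y)" by (rule mult_le_mono2)
  moreover have "m = ?L * (m div ?L) + m mod ?L" by (rule mult_div_mod_eq[symmetric])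
  moreover have "m mod ?L < ?L" by simp
  ultimately show ?thesis by linarith
qed

lemma climb_to:
  assumes y: "y \<in> V" "y \<notin> cut_off k" "y \<in> descendants V p x" and low: "lv x < k"
  obtains m where "(p ^^ m) y = x" "m \<le> (2 * d + 1) * (lv x - lv y) + 2 * d"
proof -
  \<comment> \<open>Minimality excludes steps spent on the loop at the root.\<close>
  let ?m = "LEAST m. (p ^^ m) y = x"
  have m: "(p ^^ ?m) y = x" using y(3) unfolding descendants_def by (auto intro: LeastI_ex)
  have "(p ^^ i) y \<noteq> v" if i: "i < ?m" for i
  proof
    assume iv: "(p ^^ i) y = v"
    have "(p ^^ ?m) y = (p ^^ (?m - i)) ((p ^^ i) y)"
      using i by (metis add.commute funpow_add comp_apply le_add_diff_inverse less_imp_le)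
    then have "(p ^^ i) y = x" using m iv rooted_funpow_root[OF R] by simp
    then show False using not_less_Least[OF i] by blast
  qed
  then show ?thesis using climb[OF y(1,2), of ?m] m low that by simp
qed

text \<open>\<open>3 * d + 2\<close> is \<open>(2 * d + 1) + (d + 1)\<close>: the way to a new hole
  costs \<open>2 * d + 1\<close> for each level lost, and once \<open>d\<close> along the chain and
  1 for the cut edge. At least one level is lost, which pays for the latter.\<close>

definition reach :: "nat \<Rightarrow> nat" where
  "reach k = (3 * d + 2) * (k + 1)"

lemma ball_reach_subset:
  assumes "b \<in> ball V E w n" "n + reach j \<le> N"
  shows "ball V E b (reach j) \<subseteq> ball V E w N"
  using ball_trans[OF sg assms(1)] ball_mono[OF assms(2)] by blast

text \<open>Induction on the level. The side trees at inner chain vertices have lower level, because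
  the one child of equal level is the next chain vertex. Hence cuts below level \<open>k\<close>
  keep them shallow and leave only holes that the induction hypothesis mends.\<close>

lemma chain_mend:
  assumes "chain (2 * d) s" "relaxed_accepts r \<psi> V E \<sigma> \<mu>"
  shows "\<exists>\<mu>'. is_mend r \<psi> V E \<sigma> \<mu> (s d) (reach (lv (s d))) \<mu>'"
  using assms
proof (induction "lv (s d)" arbitrary: s \<mu> rule: less_induct)
  case less
  note ch = less.prems(1) and acc = less.prems(2)
  define k where "k = lv (s d)"
  let ?D = "descendants V p"
  have d0: "d > 0" using far by simp
  have sV: "s i \<in> V" if "i \<le> 2 * d" for i using chainD(1)[OF ch that] .
  have slv: "lv (s i) = k" if "i \<le> 2 * d" for i
    using chainD(2)[OF ch that] chainD(2)[OF ch, of d] by (simp add: k_def)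
  have sp: "p (s (Suc i)) = s i" "s (Suc i) \<noteq> v" if "i < 2 * d" for i
    using chainD(4)[OF ch that] chainD(3)[OF ch that] .
  have up: "(p ^^ n) (s (j + n)) = s j" if "j + n \<le> 2 * d" for j n
    using that by (induction n) (auto simp: funpow_swap1 sp)
  have hs: "h (s i) < h (s j)" if "i < j" "j \<le> 2 * d" for i j
    using that
  proof (induction j)
    case (Suc j)
    have "h (s j) < h (s (Suc j))" using R sV[of "Suc j"] sp[of j] Suc.prems unfolding rooted_def by (metis Suc_le_lessD)
    then show ?case using Suc by (cases "i = j") auto
  qed simp
  have not_below: "s i \<notin> ?D (s j)" if "i < j" "j \<le> 2 * d" for i j
  proof
    assume "s i \<in> ?D (s j)"
    then obtain n where "(p ^^ n) (s i) = s j" by (auto simp: descendants_def)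
    then have "h (s j) \<le> h (s i)" using rooted_height_le[OF R sV[of i], of n] that by simp
    then show False using hs[OF that] by simp
  qed
  define S where "S = (\<lambda>y. {i. i \<le> 2 * d \<and> (i = 0 \<or> y \<in> ?D (s i))})"
  define idx where "idx = (\<lambda>y. Max (S y))"
  have finS: "finite (S y)" "0 \<in> S y" for y unfolding S_def by auto
  have idx_in: "idx y \<in> S y" for y unfolding idx_def using finS[of y] by (intro Max_in) auto
  have idx_ge: "i \<le> idx y" if "i \<in> S y" for i y unfolding idx_def using finS that by simp
  have idx_s: "idx (s i) = i" if i: "i \<le> 2 * d" for i
  proof -
    have "s i \<in> ?D (s i)" using sV[OF i] unfolding descendants_def by (auto intro: exI[of _ 0])
    then have "i \<in> S (s i)" using i by (simp add: S_def)
    moreover have "j \<le> i" if "j \<in> S (s i)" for j using that not_below[of i j] by (fastforce simp: S_def)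
    ultimately show ?thesis unfolding idx_def using finS by (intro Max_eqI) auto
  qed
  have idx_le: "idx y \<le> 2 * d" for y using idx_in[of y] by (simp add: S_def)
  have idx_p: "y = s (idx y) \<and> p y = s (idx y - 1) \<and> idx (p y) = idx y - 1 \<and> 0 < idx y"
    if y: "y \<in> V" "idx (p y) \<noteq> idx y" for y
  proof -
    have "S (p y) \<subseteq> S y" using descendants_parent[OF y(1)] by (auto simp: S_def)
    then have lt: "idx (p y) < idx y" using idx_ge[of "idx (p y)" y] idx_in[of "p y"] y(2) by force
    then have "idx y \<notin> S (p y)" using idx_ge[of "idx y" "p y"] by force
    moreover have "y \<in> ?D (s (idx y))" using idx_in[of y] lt by (auto simp: S_def)
    ultimately have "y = s (idx y)" using descendants_cases[OF R] idx_le[of y] by (auto simp: S_def)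
    moreover have "idx y = Suc (idx y - 1)" using lt by simp
    moreover have "idx y - 1 < 2 * d" using idx_le[of y] lt by simp
    ultimately have "p y = s (idx y - 1)" using sp(1)[of "idx y - 1"] by metis
    then show ?thesis using \<open>y = s (idx y)\<close> lt idx_s[of "idx y - 1"] idx_le[of y] by simp
  qed
  have catV: "caterpillar V E d s idx"
    unfolding caterpillar_def
  proof (intro conjI ballI allI impI)
    fix a b assume ab: "E a b" "idx a \<noteq> idx b"
    have "a \<in> V" "b \<in> V" "p a = b \<or> p b = a" using ab(1) rooted_edge[OF R] by auto
    then obtain y where y: "y \<in> V" "{a, b} = {p y, y}" "idx (p y) \<noteq> idx y" using ab(2) by (metis insert_commute)
    have "idx y - 1 < 2 * d" "{a, b} = {s (idx y - 1), s (Suc (idx y - 1))}"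
      using idx_p[OF y(1,3)] idx_le[of y] y(2) by auto
    then show "\<exists>i<2 * d. {a, b} = {s i, s (Suc i)}" by blast
  qed (use idx_le idx_s sV in auto)
  define P where "P = {s 0, s (2 * d)}"
  \<comment> \<open>Of the two outermost bundles only the ends of the chain are kept: what lies
    beyond them may have level \<open>k\<close> or more, where no cuts are made.\<close>
  define A where "A = {y \<in> V. y \<notin> cut_off k \<and> 0 < idx y \<and> idx y < 2 * d} \<union> P"
  have s_uncut: "s i \<notin> cut_off k" if i: "i \<le> 2 * d" for i
  proof
    assume "s i \<in> cut_off k"
    then obtain m where "lv ((p ^^ m) (s i)) < k" by (auto simp: cut_off_def)
    then show False using lv_up_mono[OF sV[OF i], of 0 m] slv[OF i] by simp
  qed
  have sA: "s i \<in> A" if i: "i \<le> 2 * d" for i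
    using s_uncut[OF i] idx_s[OF i] sV[OF i] i by (cases "i = 0 \<or> i = 2 * d") (auto simp: A_def P_def)
  have AV: "A \<subseteq> V" using sV by (auto simp: A_def P_def)
  have PA: "P \<subseteq> A" by (auto simp: A_def)
  have idxP: "idx q = 0 \<or> idx q = 2 * d" if "q \<in> P" for q using that idx_s by (auto simp: P_def)
  have AP: "y \<in> V \<and> y \<notin> cut_off k \<and> 0 < idx y \<and> idx y < 2 * d" if "y \<in> A - P" for y
    using that by (auto simp: A_def)
  have idx_v: "idx v = 0"
  proof (rule ccontr)
    assume n: "idx v \<noteq> 0"
    then have "v \<in> ?D (s (idx v))" using idx_in[of v] by (simp add: S_def)
    then have "v = s (idx v)" using rooted_funpow_root[OF R] by (auto simp: descendants_def)
    moreover have "idx v - 1 < 2 * d" using n idx_le[of v] by linarith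
    ultimately show False using sp(2)[of "idx v - 1"] n by simp
  qed
  have RA: "rooted A (induced E A) (s 0) (p(s 0 := s 0)) h"
  proof (rule rooted_induced[OF R AV])
    show "s 0 \<in> A" using sA by simp
    show "y \<noteq> v \<and> p y \<in> A" if y: "y \<in> A" "y \<noteq> s 0" for y
    proof (cases "y \<in> P")
      case True
      then have "y = s (2 * d)" using y by (simp add: P_def)
      then have "p y = s (2 * d - 1)" "y \<noteq> v" using sp[of "2 * d - 1"] d0 by auto
      then show ?thesis using sA by simp
    next
      case False
      then have y': "y \<in> V" "y \<notin> cut_off k" "0 < idx y" "idx y < 2 * d" using AP y by blast+
      have "p y \<in> A"
      proof (cases "idx (p y) = idx y")
        case True
        then show ?thesis using y' cut_off_child[OF y'(1)] p_in by (auto simp: A_def)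
      next
        case False
        then show ?thesis using idx_p[OF y'(1)] sA[of "idx y - 1"] y' by simp
      qed
      then show ?thesis using y' idx_v by auto
    qed
    show "s 0 = v \<or> p (s 0) \<notin> A"
    proof (rule ccontr)
      assume n: "\<not> ?thesis"
      have "idx (p (s 0)) = idx (s 0)" using idx_p[OF sV[of 0]] idx_s[of 0] by auto
      then have "idx (p (s 0)) = 0" using idx_s by simp
      then have "p (s 0) \<in> P" "p (s 0) \<noteq> s (2 * d)" using n idx_s[of "2 * d"] d0 by (auto simp: A_def)
      then have "p (s 0) = s 0" by (simp add: P_def)
      then show False using rooted_parent_edge[OF R sV[of 0]] n by simp
    qed
  qed
  have TA: "bdd_tree \<Delta> A (induced E A)" by (rule bdd_tree_induced[OF T AV rooted_is_tree[OF RA]])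
  have catA: "caterpillar A (induced E A) d s idx"
    using catV sA AV unfolding caterpillar_def induced_def by auto
  define B where "B = {b \<in> V. b \<in> cut_off k \<and> p b \<notin> cut_off k \<and> 0 < idx b \<and> idx b < 2 * d}"
  define H where "H = B \<union> p ` B"
  have cross: "b \<in> B \<and> a = p b" if ab: "a \<in> A" "b \<notin> A" "E a b" "a \<notin> P" for a b
  proof -
    have a: "a \<in> V" "a \<notin> cut_off k" "0 < idx a" "idx a < 2 * d" using AP ab by blast+
    have bV: "b \<in> V" and par: "p a = b \<or> p b = a" using ab(3) rooted_edge[OF R] by auto
    have same: "idx b = idx a"
    proof (rule ccontr)
      assume "idx b \<noteq> idx a"
      then have "b = s (idx b)" using caterpillar_edge(2)[OF catV ab(3)] by simp
      then show False using sA[OF idx_le[of b]] ab(2) by simp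
    qed
    then have "b \<in> cut_off k" using ab(2) bV a by (auto simp: A_def)
    then show ?thesis using par a cut_off_child[OF a(1)] bV same by (auto simp: B_def)
  qed
  define \<mu>c where "\<mu>c = (\<lambda>u. if u \<in> H then None else \<mu> u)"
  \<comment> \<open>The ends are erased only while the caterpillar is treated as a tree of its own,
    since the surroundings of the ends are missing there.\<close>
  define \<mu>A where "\<mu>A = (\<lambda>u. if u \<in> P then None else \<mu>c u)"
  have accc: "relaxed_accepts r \<psi> V E \<sigma> \<mu>c" by (rule relaxed_accepts_erase[OF T acc]) (simp add: \<mu>c_def)
  have "relaxed_accepts r \<psi> V E \<sigma> \<mu>A" by (rule relaxed_accepts_erase[OF T accc]) (simp add: \<mu>A_def)
  then have accA: "relaxed_accepts r \<psi> A (induced E A) \<sigma> \<mu>A"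
  proof (rule relaxed_accepts_induced[OF T AV TA])
    fix a b assume ab: "a \<in> A" "b \<notin> A" "E a b"
    show "\<mu>A a = None"
    proof (cases "a \<in> P")
      case False
      then have "a \<in> H" using cross[OF ab] by (auto simp: H_def)
      then show ?thesis by (simp add: \<mu>A_def \<mu>c_def)
    qed (simp add: \<mu>A_def)
  qed
  obtain \<mu>' where acc': "relaxed_accepts r \<psi> A (induced E A) \<sigma> \<mu>'" and m': "\<mu>' (s d) \<noteq> None"
    "\<And>u. u \<in> A \<Longrightarrow> \<mu>' u = None \<Longrightarrow> \<mu>A u = None"
    "\<And>u. u \<in> A \<Longrightarrow> \<mu>' u \<noteq> \<mu>A u \<Longrightarrow> d \<le> idx u + t \<and> idx u \<le> d + t"
    using caterpillar_mendable[OF TA catA accA] by blast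
  \<comment> \<open>The ends get their labels back from \<open>\<mu>c\<close>. The mend stays at
    indices within \<open>t\<close> of \<open>d\<close>, so by \<open>t + 2 * r < d\<close> no ball
    of radius \<open>r\<close> contains both a change and an end.\<close>
  define \<mu>1 where "\<mu>1 = (\<lambda>u. if u \<in> A - P then \<mu>' u else \<mu>c u)"
  have acc1: "relaxed_accepts r \<psi> V E \<sigma> \<mu>1"
    unfolding \<mu>1_def
  proof (rule relaxed_accepts_paste[OF T AV TA accc acc'])
    show "a \<in> P \<or> \<mu>c b = None" if "a \<in> A" "b \<notin> A" "E a b" for a b
      using cross[OF that] by (auto simp: \<mu>c_def H_def)
    fix z q assume z: "z \<in> A - P" "\<mu>' z \<noteq> \<mu>c z" and q: "q \<in> P"
    then have "d \<le> idx z + t \<and> idx z \<le> d + t" using m'(3)[of z] by (simp add: \<mu>A_def)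
    moreover have "idx q \<le> idx z + 2 * r \<and> idx z \<le> idx q + 2 * r" if "q \<in> ball V E z (2 * r)"
      using ball_lipschitz[of V E idx, OF sg _ that] caterpillar_edge(1)[OF catV] by blast
    ultimately show "q \<notin> ball V E z (2 * r)" using idxP[OF q] far by auto
  qed
  have s_ball: "s i \<in> ball V E (s d) d" if i: "i \<le> 2 * d" for i
  proof (cases "i \<le> d")
    case True
    then have "s d \<in> ball V E (s i) (d - i)" using rooted_funpow_ball[OF R sV[of d], of "d - i"] up[of i "d - i"] by simp
    then have "s i \<in> ball V E (s d) (d - i)" by (rule ball_sym[OF sg sV[OF i]])
    then show ?thesis using ball_mono[of "d - i" d V E "s d"] by auto
  next
    case False
    then have "s i \<in> ball V E (s d) (i - d)" using rooted_funpow_ball[OF R sV[OF i], of "i - d"] up[of d "i - d"] i by simp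
    moreover have "i - d \<le> d" using i by simp
    ultimately show ?thesis using ball_mono by blast
  qed
  have distA: "u \<in> ball V E (s d) (d + (2 * d + 1) * (k - lv u))" if "u \<in> A - P" for u
  proof -
    define i where "i = idx u"
    have u: "u \<in> V" "u \<notin> cut_off k" and i: "0 < i" "i < 2 * d" using AP[OF that] by (auto simp: i_def)
    show ?thesis
    proof (cases "u = s i")
      case True
      then show ?thesis using s_ball[of i] i slv[of i] by simp
    next
      case False
      have uD: "u \<in> ?D (s i)" using idx_in[of u] i by (simp add: S_def i_def)
      define m where "m = (LEAST m. (p ^^ m) u = s i)"
      have m: "(p ^^ m) u = s i" unfolding m_def using uD by (auto simp: descendants_def intro: LeastI_ex)
      then obtain n where n: "m = Suc n" using False by (cases m) auto
      define x where "x = (p ^^ n) u"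
      have xV: "x \<in> V" and px: "p x = s i" using up_in[OF u(1)] m n by (simp_all add: x_def)
      have "x \<noteq> s i" using not_less_Least[of n "\<lambda>m. (p ^^ m) u = s i"] n unfolding m_def x_def by simp
      then have xv: "x \<noteq> v" using px p_root by auto
      have "x \<noteq> s (Suc i)"
      proof
        assume "x = s (Suc i)"
        then have "u \<in> ?D (s (Suc i))" using u(1) by (auto simp: descendants_def x_def)
        then have "Suc i \<in> S u" using i by (simp add: S_def)
        then show False using idx_ge[of "Suc i" u] by (simp add: i_def)
      qed
      \<comment> \<open>The only child of \<open>s i\<close> at level \<open>k\<close> is
        \<open>s (Suc i)\<close>, by \<open>lv_unique\<close>.\<close>
      then have "lv x \<noteq> k"
        using lv_unique[OF xV sV[of "Suc i"] xv] sp[of i] px slv[of i] slv[of "Suc i"] i by auto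
      then have low: "lv x < k" using lv_mono[OF xV] px slv[of i] i by simp
      have "u \<in> ?D x" using u(1) by (auto simp: descendants_def x_def)
      from climb_to[OF u this low] obtain n' where n': "(p ^^ n') u = x" "n' \<le> (2 * d + 1) * (lv x - lv u) + 2 * d" .
      have "u \<in> ball V E (s i) (Suc n')" using rooted_funpow_ball[OF R u(1), of "Suc n'"] n'(1) px by simp
      from ball_trans[OF sg s_ball this] have b: "u \<in> ball V E (s d) (d + Suc n')" using i by simp
      \<comment> \<open>The level gained between \<open>x\<close> and \<open>s i\<close> pays for
        the remainder \<open>2 * d\<close> and for the step from \<open>x\<close> to
        \<open>s i\<close>.\<close>
      have "lv u \<le> lv x" using lv_up_mono[OF u(1), of 0 n] by (simp add: x_def)
      then have "Suc (lv x - lv u) \<le> k - lv u" using low by simp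
      then have "(2 * d + 1) * Suc (lv x - lv u) \<le> (2 * d + 1) * (k - lv u)" by (rule mult_le_mono2)
      then have "d + Suc n' \<le> d + (2 * d + 1) * (k - lv u)" using n'(2) by simp
      then show ?thesis using b ball_mono by blast
    qed
  qed
  have arith: "d + (2 * d + 1) * (k - j) + 1 + reach j \<le> reach k" if j: "j < k" for j
  proof -
    obtain q where q: "k = j + Suc q" using less_imp_Suc_add[OF j] by auto
    show ?thesis unfolding q reach_def by (simp add: algebra_simps)
  qed
  have B: "lv b < k \<and> p b \<in> ball V E (s d) (d + (2 * d + 1) * (k - lv b)) \<and>
      b \<in> ball V E (s d) (d + (2 * d + 1) * (k - lv b) + 1) \<and> lv (p b) = lv b" if b: "b \<in> B" for b
  proof -
    have bV: "b \<in> V" "b \<in> cut_off k" "p b \<notin> cut_off k" "0 < idx b" "idx b < 2 * d" using b by (auto simp: B_def)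
    note cut = cut_off_boundary[OF bV(2,3)]
    obtain s1 s2 where lvp: "lv (p b) = lv b" by (rule cut_vertex_chains[OF cut(1)])
    have "b \<noteq> s i" if "i \<le> 2 * d" for i using s_uncut[OF that] bV(2) by blast
    then have "idx (p b) = idx b" using idx_p[OF bV(1)] idx_le by blast
    \<comment> \<open>The upper end of the cut edge is still uncut and has the level of
      \<open>b\<close>, so \<open>distA\<close> applies to it and bounds the distance of both
      ends.\<close>
    then have "p b \<in> A" "p b \<notin> P" using bV p_in idxP by (fastforce simp: A_def)+
    then have 1: "p b \<in> ball V E (s d) (d + (2 * d + 1) * (k - lv b))" using distA[of "p b"] lvp by simp
    have "b \<noteq> v" using bV(2) root_not_cut_off by blast
    then have "E (p b) b" using rooted_parent_edge[OF R bV(1)] by simp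
    then have "b \<in> ball V E (s d) (d + (2 * d + 1) * (k - lv b) + 1)" using 1 ball_Suc[OF sg] by (metis Suc_eq_plus1)
    then show ?thesis using cut 1 lvp by blast
  qed
  have Hball: "x \<in> ball V E (s d) (d + (2 * d + 1) * (k - lv x) + 1) \<and> lv x < k" if x: "x \<in> H" for x
  proof -
    obtain b where b: "b \<in> B" "x = b \<or> x = p b" using x by (auto simp: H_def)
    note Bb = B[OF b(1)]
    let ?n = "d + (2 * d + 1) * (k - lv b)"
    have "lv x = lv b" using b(2) Bb by blast
    moreover have "x \<in> ball V E (s d) (?n + 1)" using b(2) Bb ball_mono[OF le_add1[of ?n 1]] by blast
    ultimately show ?thesis using Bb by simp
  qed
  have "\<exists>\<mu>'. is_mend r \<psi> V E \<sigma> \<mu> (s d) (reach k) \<mu>'"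
  proof (rule mend_after_filling[OF _ acc1, where H = H and b = "\<lambda>x. reach (lv x)"])
    show "finite H" unfolding H_def B_def using finite_V by simp
    have "s d \<in> A - P" using sA[of d] idxP[of "s d"] idx_s[of d] d0 by auto
    then show "\<mu>1 (s d) \<noteq> None" using m'(1) by (simp add: \<mu>1_def)
    show "\<mu> u = None \<or> u \<in> H" if "\<mu>1 u = None" for u
    proof -
      have "\<mu>c u = None" using that m'(2)[of u] by (auto simp: \<mu>1_def \<mu>A_def split: if_splits)
      then show ?thesis by (auto simp: \<mu>c_def split: if_splits)
    qed
    show "u \<in> ball V E (s d) (reach k)" if "\<mu>1 u \<noteq> \<mu> u" for u
    proof (cases "u \<in> H")
      case True
      have "d + (2 * d + 1) * (k - lv u) + 1 \<le> reach k" using arith[of "lv u"] Hball[OF True] by linarith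
      then show ?thesis using Hball[OF True] ball_mono by blast
    next
      case False
      then have "u \<in> A - P" using that by (auto simp: \<mu>1_def \<mu>c_def split: if_splits)
      moreover have "d + (2 * d + 1) * (k - lv u) \<le> reach k"
      proof -
        have "(2 * d + 1) * (k - lv u) \<le> (2 * d + 1) * k" by (rule mult_le_mono2) simp
        moreover have "d + (2 * d + 1) * k \<le> reach k" by (simp add: reach_def algebra_simps)
        ultimately show ?thesis by linarith
      qed
      ultimately show ?thesis using distA[of u] ball_mono by blast
    qed
    \<comment> \<open>Both ends of a cut edge are midpoints of chains of level less than
      \<open>k\<close>, so the induction hypothesis mends them, in the whole tree.\<close>
    show "\<exists>\<mu>'. is_mend r \<psi> V E \<sigma> \<nu> x (reach (lv x)) \<mu>'" if x: "x \<in> H" and \<nu>: "relaxed_accepts r \<psi> V E \<sigma> \<nu>" for x \<nu>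
    proof -
      obtain b where b: "b \<in> B" "x = b \<or> x = p b" using x by (auto simp: H_def)
      then have "cut_vertex b" using cut_off_boundary[of b k] by (auto simp: B_def)
      then obtain s1 s2 where s12: "chain (2 * d) s1" "s1 d = b" "chain (2 * d) s2" "s2 d = p b" 
        by (rule cut_vertex_chains)
      have "lv x < lv (s d)" using Hball[OF x] by (simp add: k_def)
      then show ?thesis using less.hyps[of s1 \<nu>] less.hyps[of s2 \<nu>] s12 b(2) \<nu> by auto
    qed
    show "ball V E x (reach (lv x)) \<subseteq> ball V E (s d) (reach k)" if "x \<in> H" for x
      using Hball[OF that] arith[of "lv x"] by (intro ball_reach_subset) auto
  qed
  then show ?case by (simp add: k_def)
qed

text \<open>After all cuts the component of the root has small depth, so any mend inside it is short
  enough, whatever \<open>T0\<close> is. No part of its boundary is left unprotected, and the cuts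
  are then mended by \<open>chain_mend\<close>.\<close>

lemma root_mend:
  assumes mend: "verifier_mendable (bdd_tree \<Delta>) r \<psi> T0" and acc: "relaxed_accepts r \<psi> V E \<sigma> \<mu>"
  shows "\<exists>\<mu>'. is_mend r \<psi> V E \<sigma> \<mu> v (reach (Suc (lv v))) \<mu>'"
proof -
  \<comment> \<open>No level exceeds \<open>lv v\<close>, so this \<open>k\<close> admits cuts of
    every level.\<close>
  define k where "k = Suc (lv v)"
  define A where "A = V - cut_off k"
  have AV: "A \<subseteq> V" and vA: "v \<in> A" using v_in root_not_cut_off by (auto simp: A_def)
  have up: "p y \<in> A" if "y \<in> A" for y using that p_in cut_off_child by (auto simp: A_def)
  have RA: "rooted A (induced E A) v (p(v := v)) h"
    by (rule rooted_induced[OF R AV vA]) (use up in auto)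
  have TA: "bdd_tree \<Delta> A (induced E A)" by (rule bdd_tree_induced[OF T AV rooted_is_tree[OF RA]])
  define B where "B = {b \<in> V. b \<in> cut_off k \<and> p b \<notin> cut_off k}"
  define H where "H = B \<union> p ` B"
  have cross: "b \<in> B \<and> a = p b" if ab: "a \<in> A" "b \<notin> A" "E a b" for a b
  proof -
    have "b \<in> V" "p a = b \<or> p b = a" using ab(3) rooted_edge[OF R] by auto
    then show ?thesis using ab up[OF ab(1)] by (auto simp: A_def B_def)
  qed
  define \<mu>c where "\<mu>c = (\<lambda>u. if u \<in> H then None else \<mu> u)"
  have accc: "relaxed_accepts r \<psi> V E \<sigma> \<mu>c" by (rule relaxed_accepts_erase[OF T acc]) (simp add: \<mu>c_def)
  then have accA: "relaxed_accepts r \<psi> A (induced E A) \<sigma> \<mu>c"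
    by (rule relaxed_accepts_induced[OF T AV TA]) (use cross in \<open>auto simp: \<mu>c_def H_def\<close>)
  obtain \<mu>' where "is_mend r \<psi> A (induced E A) \<sigma> \<mu>c v (T0 (card A)) \<mu>'"
    using mend TA accA vA unfolding verifier_mendable_def by blast
  then have m': "relaxed_accepts r \<psi> A (induced E A) \<sigma> \<mu>'" "\<mu>' v \<noteq> None" "\<And>u. \<mu>' u = None \<Longrightarrow> \<mu>c u = None"
    by (auto simp: is_mend_def)
  define \<mu>1 where "\<mu>1 = (\<lambda>u. if u \<in> A - {} then \<mu>' u else \<mu>c u)"
  have acc1: "relaxed_accepts r \<psi> V E \<sigma> \<mu>1"
    unfolding \<mu>1_def
  proof (rule relaxed_accepts_paste[OF T AV TA accc m'(1)])
    show "a \<in> {} \<or> \<mu>c b = None" if "a \<in> A" "b \<notin> A" "E a b" for a b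
      using cross[OF that] by (auto simp: \<mu>c_def H_def)
  qed simp
  have vD: "y \<in> descendants V p v" if "y \<in> V" for y
    using rooted_reach[OF R that] that by (auto simp: descendants_def)
  have distA: "u \<in> ball V E v ((2 * d + 1) * (lv v - lv u) + 2 * d) \<and> lv u \<le> lv v" if u: "u \<in> A" for u
  proof -
    have u': "u \<in> V" "u \<notin> cut_off k" using u by (auto simp: A_def)
    have "lv v < k" by (simp add: k_def)
    from climb_to[OF u' vD[OF u'(1)] this] obtain m where
      m: "(p ^^ m) u = v" "m \<le> (2 * d + 1) * (lv v - lv u) + 2 * d" .
    have "u \<in> ball V E v m" using rooted_funpow_ball[OF R u'(1), of m] m(1) by simp
    moreover have "lv u \<le> lv v" using lv_up_mono[OF u'(1), of 0 m] m(1) by simp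
    ultimately show ?thesis using ball_mono[OF m(2)] by blast
  qed
  have arith: "(2 * d + 1) * (lv v - j) + 2 * d + 1 + reach j \<le> reach k" if j: "j \<le> lv v" for j
  proof -
    obtain q where q: "lv v = j + q" using le_Suc_ex[OF j] by auto
    show ?thesis unfolding k_def q reach_def by (simp add: algebra_simps)
  qed
  have Hball: "x \<in> ball V E v ((2 * d + 1) * (lv v - lv x) + 2 * d + 1) \<and> lv x \<le> lv v" if x: "x \<in> H" for x
  proof -
    obtain b where b: "b \<in> B" "x = b \<or> x = p b" using x by (auto simp: H_def)
    have bV: "b \<in> V" "b \<in> cut_off k" "p b \<notin> cut_off k" using b by (auto simp: B_def)
    obtain s1 s2 where lvp: "lv (p b) = lv b" by (rule cut_vertex_chains[OF cut_off_boundary(1)[OF bV(2,3)]])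
    let ?n = "(2 * d + 1) * (lv v - lv b) + 2 * d"
    have "p b \<in> A" using bV p_in by (simp add: A_def)
    then have 1: "p b \<in> ball V E v ?n" "lv b \<le> lv v" using distA[of "p b"] lvp by auto
    have "b \<noteq> v" using bV(2) root_not_cut_off by blast
    then have "E (p b) b" using rooted_parent_edge[OF R bV(1)] by simp
    then have "b \<in> ball V E v (?n + 1)" using 1 ball_Suc[OF sg] by (metis Suc_eq_plus1)
    moreover have "p b \<in> ball V E v (?n + 1)" using 1 ball_mono[of ?n "?n + 1" V E v] by auto
    ultimately show ?thesis using b(2) lvp 1(2) by auto
  qed
  have "\<exists>\<mu>'. is_mend r \<psi> V E \<sigma> \<mu> v (reach k) \<mu>'"
  proof (rule mend_after_filling[OF _ acc1, where H = H and b = "\<lambda>x. reach (lv x)"])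
    show "finite H" unfolding H_def B_def using finite_V by simp
    show "\<mu>1 v \<noteq> None" using m'(2) vA by (simp add: \<mu>1_def)
    show "\<mu> u = None \<or> u \<in> H" if "\<mu>1 u = None" for u
    proof -
      have "\<mu>c u = None" using that m'(3)[of u] by (auto simp: \<mu>1_def split: if_splits)
      then show ?thesis by (auto simp: \<mu>c_def split: if_splits)
    qed
    show "u \<in> ball V E v (reach k)" if "\<mu>1 u \<noteq> \<mu> u" for u
    proof (cases "u \<in> H")
      case True
      have "(2 * d + 1) * (lv v - lv u) + 2 * d + 1 \<le> reach k" using arith[of "lv u"] Hball[OF True] by linarith
      then show ?thesis using Hball[OF True] ball_mono by blast
    next
      case False
      then have "u \<in> A" using that by (auto simp: \<mu>1_def \<mu>c_def split: if_splits)
      then have u: "u \<in> ball V E v ((2 * d + 1) * (lv v - lv u) + 2 * d)" "lv u \<le> lv v" using distA by blast+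
      have "(2 * d + 1) * (lv v - lv u) + 2 * d \<le> reach k" using arith[OF u(2)] by linarith
      then show ?thesis using u(1) ball_mono by blast
    qed
    show "\<exists>\<mu>'. is_mend r \<psi> V E \<sigma> \<nu> x (reach (lv x)) \<mu>'" if x: "x \<in> H" and \<nu>: "relaxed_accepts r \<psi> V E \<sigma> \<nu>" for x \<nu>
    proof -
      obtain b where b: "b \<in> B" "x = b \<or> x = p b" using x by (auto simp: H_def)
      then have "cut_vertex b" using cut_off_boundary[of b k] by (auto simp: B_def)
      then obtain s1 s2 where s12: "chain (2 * d) s1" "s1 d = b" "chain (2 * d) s2" "s2 d = p b" 
        by (rule cut_vertex_chains)
      then show ?thesis using chain_mend[OF s12(1) \<nu>] chain_mend[OF s12(3) \<nu>] b(2) by auto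
    qed
    show "ball V E x (reach (lv x)) \<subseteq> ball V E v (reach k)" if "x \<in> H" for x
      using Hball[OF that] arith[of "lv x"] by (intro ball_reach_subset) auto
  qed
  then show ?thesis by (simp add: k_def)
qed

end

subsection \<open>The gap\<close>

lemma descendants_child_subset:
  assumes "y \<in> V"
  shows "descendants V p y \<subseteq> descendants V p (p y)"
  unfolding descendants_def by (auto intro: exI[of _ "Suc _"])

text \<open>With a common descendant, one sibling would be a proper ancestor of the other, hence at
  or above their common parent, against \<open>h\<close>.\<close>

lemma descendants_disjoint_siblings:
  assumes R: "rooted V E v p h" and xy: "x \<in> V" "y \<in> V" "x \<noteq> v" "y \<noteq> v" "p x = p y" "x \<noteq> y"
  shows "descendants V p x \<inter> descendants V p y = {}"
proof -
  have False if u: "u \<in> V" "(p ^^ m) u = x" "(p ^^ n) u = y" "m \<le> n" and xy: "x \<in> V" "y \<in> V" "y \<noteq> v" "p x = p y" "x \<noteq> y"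
    for u m n x y
  proof -
    have "(p ^^ (n - m)) x = y" using u by (metis comp_apply funpow_add le_add_diff_inverse2)
    then obtain q where "(p ^^ q) (p x) = y" using xy(5) by (cases "n - m") (auto simp: funpow_swap1)
    then have "h y \<le> h (p y)" using rooted_height_le[OF R, of "p x" q] R xy by (auto simp: rooted_def)
    moreover have "h (p y) < h y" using R xy by (auto simp: rooted_def)
    ultimately show False by simp
  qed
  note contra = this
  show ?thesis
  proof (rule ccontr)
    assume "descendants V p x \<inter> descendants V p y \<noteq> {}"
    then obtain u m n where u: "u \<in> V" "(p ^^ m) u = x" "(p ^^ n) u = y" by (auto simp: descendants_def)
    show False
    proof (cases "m \<le> n")
      case True
      then show ?thesis using contra[OF u True] xy by blast
    next
      case False
      then show ?thesis using contra[OF u(1,3,2)] xy by force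
    qed
  qed
qed

text \<open>Two disjoint sets of size at least \<open>2 ^ l\<close> do not fit into a set of size
  less than \<open>2 ^ (l + 1)\<close>. Applied to subtrees, at most one child has the level of its
  parent.\<close>

lemma floor_log_card_unique:
  assumes "A \<inter> B = {}" "A \<subseteq> C" "B \<subseteq> C" "finite C" "A \<noteq> {}" "B \<noteq> {}"
    and "floor_log (card A) = floor_log (card C)" "floor_log (card B) = floor_log (card C)"
  shows False
proof -
  have fin: "finite A" "finite B" using assms by (auto intro: finite_subset)
  have "card A > 0" "card B > 0" using assms fin by (auto simp: card_gt_0_iff)
  then have "2 ^ floor_log (card C) \<le> card A" "2 ^ floor_log (card C) \<le> card B"
    using floor_log_exp2_le[of "card A"] floor_log_exp2_le[of "card B"] assms(7,8) by auto
  moreover have "card A + card B \<le> card C"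
    using card_Un_disjoint[OF fin assms(1)] card_mono[OF assms(4), of "A \<union> B"] assms(2,3) by simp
  ultimately show False using floor_log_exp2_gt[of "card C"] by simp
qed

text \<open>The factor \<open>8 * (K + 1)\<close> yields \<open>8 * T N \<le> 2 * d + 1\<close>, so
  \<open>t = d div 2\<close> works. The summand \<open>N0\<close> of \<open>d\<close> puts the whole
  range beyond the threshold, and \<open>8 * r + 8\<close> leaves room for
  \<open>2 * r\<close>.\<close>

lemma smallo_scale:
  fixes T :: "nat \<Rightarrow> nat"
  assumes "(\<lambda>n. real (T n)) \<in> o(\<lambda>n. real n)"
  shows "\<exists>d t. t + 2 * r < d \<and> (\<forall>N. 2 * d + 1 \<le> N \<longrightarrow> N \<le> (2 * d + 1) * K \<longrightarrow> T N \<le> t)"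
proof -
  have "eventually (\<lambda>n. norm (real (T n)) \<le> 1 / (8 * real (K + 1)) * norm (real n)) at_top"
    by (rule landau_o.smallD[OF assms]) simp
  then obtain N0 where N0: "\<And>n. n \<ge> N0 \<Longrightarrow> real (T n) \<le> real n / (8 * real (K + 1))"
    by (auto simp: eventually_sequentially)
  define d where "d = N0 + 8 * r + 8"
  have "T N \<le> d div 2" if N: "2 * d + 1 \<le> N" "N \<le> (2 * d + 1) * K" for N
  proof -
    have "N0 \<le> N" using N(1) by (simp add: d_def)
    then have "8 * real (K + 1) * real (T N) \<le> real N" using N0[of N] by (simp add: field_simps)
    then have "8 * (K + 1) * T N \<le> N" by (metis (mono_tags, opaque_lifting) of_nat_le_iff of_nat_mult of_nat_numeral)
    also have "\<dots> \<le> (K + 1) * (2 * d + 1)" using N(2) by (simp add: algebra_simps)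
    finally have "(K + 1) * (8 * T N) \<le> (K + 1) * (2 * d + 1)" by (simp only: ac_simps)
    then have "8 * T N \<le> 2 * d + 1" by (simp only: mult_le_cancel1)
    then show ?thesis by simp
  qed
  moreover have "d div 2 + 2 * r < d" by (simp add: d_def)
  ultimately show ?thesis by blast
qed

context local_problem
begin

lemma logarithmic_mend:
  assumes mend: "verifier_mendable (bdd_tree \<Delta>) r \<psi> T" and small: "(\<lambda>n. real (T n)) \<in> o(\<lambda>n. real n)"
  shows "\<exists>d. verifier_mendable (bdd_tree \<Delta>) r \<psi> (\<lambda>n. (3 * d + 2) * (floor_log n + 2))"
proof -
  obtain K where K: "\<forall>X E \<sigma> \<mu> x. bdd_tree \<Delta> X E \<longrightarrow> x \<in> X \<longrightarrow> K < card X \<longrightarrow>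
     (\<exists>X' E' \<sigma>' \<mu>'. X' \<subseteq> X \<and> x \<in> X' \<and> card X' \<le> K \<and> bdd_tree \<Delta> X' E' \<and>
        root_type X' E' \<sigma>' \<mu>' x = root_type X E \<sigma> \<mu> x)"
    using small_representatives by (rule exE)
  obtain d t where dt: "t + 2 * r < d" "\<And>N. 2 * d + 1 \<le> N \<Longrightarrow> N \<le> (2 * d + 1) * K \<Longrightarrow> T N \<le> t"
    using smallo_scale[OF small, of r K] by blast
  have "\<exists>\<mu>'. is_mend r \<psi> V E \<sigma> \<mu> v ((3 * d + 2) * (floor_log (card V) + 2)) \<mu>'"
    if V: "bdd_tree \<Delta> V E" and acc: "relaxed_accepts r \<psi> V E \<sigma> \<mu>" and v: "v \<in> V" for V E \<sigma> \<mu> v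
  proof -
    obtain p h where R: "rooted V E v p h" using tree_rooted[of V E v] V v by (auto simp: bdd_tree_def)
    \<comment> \<open>The subtree of the root is the whole tree, so the root has level
      \<open>floor_log (card V)\<close>, and \<open>reach\<close> at the next level is the claimed
      bound.\<close>
    define lv where "lv = (\<lambda>y. floor_log (card (descendants V p y)))"
    have finV: "finite V" using bdd_tree_simple_graph[OF V] by (simp add: simple_graph_def)
    have D: "descendants V p y \<subseteq> V" "finite (descendants V p y)" for y
      using finV by (auto simp: descendants_def)
    have self: "y \<in> descendants V p y" if "y \<in> V" for y using that by (auto simp: descendants_def intro: exI[of _ 0])
    interpret leveled_tree \<Delta> r \<psi> V E v p h lv d t
    proof
      show "lv y \<le> lv (p y)" if "y \<in> V" for y
        unfolding lv_def using descendants_child_subset[OF that, of p] D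
        by (intro floor_log_le_iff card_mono) auto
      show "x = y" if xy: "x \<in> V" "y \<in> V" "x \<noteq> v" "y \<noteq> v" "p x = p y" "lv x = lv (p x)" "lv y = lv (p y)" for x y
      proof (rule ccontr)
        assume "x \<noteq> y"
        from floor_log_card_unique[OF descendants_disjoint_siblings[OF R xy(1-5) this], of "descendants V p (p x)"]
        show False
          using descendants_child_subset[OF xy(1), of p] descendants_child_subset[OF xy(2), of p] D
            self[OF xy(1)] self[OF xy(2)] xy
          unfolding lv_def by auto
      qed
    qed (rule V R dt(1) | rule caterpillar_mend[OF K mend dt(2)], assumption+)+
    have "descendants V p v = V" using rooted_reach[OF R] by (auto simp: descendants_def)
    then show ?thesis using root_mend[OF mend acc] unfolding reach_def lv_def by simp
  qed
  then show ?thesis unfolding verifier_mendable_def by blast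
qed

end

text \<open>For \<open>2 \<le> n\<close> the summand 2 is at most \<open>2 * ln n / ln 2\<close>,
  whence the factor 3.\<close>

lemma floor_log_bigo: "(\<lambda>n. real (c * (floor_log n + 2))) \<in> O(\<lambda>n. ln (real n))"
proof (rule bigoI)
  show "eventually (\<lambda>n. norm (real (c * (floor_log n + 2))) \<le> (3 * real c / ln 2) * norm (ln (real n))) at_top"
    using eventually_ge_at_top[of "2 :: nat"]
  proof eventually_elim
    case (elim n)
    have "2 ^ floor_log n \<le> n" using elim by (intro floor_log_exp2_le) simp
    then have "real (2 ^ floor_log n) \<le> real n" by (rule of_nat_mono)
    then have "ln (real (2 ^ floor_log n)) \<le> ln (real n)" by (rule ln_mono) (use elim in simp_all)
    then have "real (floor_log n) * ln 2 \<le> ln (real n)" by (simp add: ln_realpow)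
    moreover have "ln 2 \<le> ln (real n)" using elim by simp
    ultimately have "(real (floor_log n) + 2) * ln 2 \<le> 3 * ln (real n)" by (simp add: algebra_simps)
    then have "real (floor_log n) + 2 \<le> 3 * ln (real n) / ln 2" by (simp add: field_simps)
    then have "real c * (real (floor_log n) + 2) \<le> real c * (3 * ln (real n) / ln 2)" by (rule mult_left_mono) simp
    moreover have "0 \<le> ln (real n)" using elim by simp
    ultimately show ?case by (simp add: field_simps)
  qed
qed

theorem theorem8p5:
  fixes \<Delta> r0 :: nat
    and \<psi>0 :: "nat set \<Rightarrow> (nat \<Rightarrow> nat \<Rightarrow> bool) \<Rightarrow> (nat \<Rightarrow> 'i::finite) \<Rightarrow> (nat \<Rightarrow> 'o::finite) \<Rightarrow> nat \<Rightarrow> bool"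
    and T :: "nat \<Rightarrow> nat"
  assumes "local_verifier (bdd_tree \<Delta>) r0 \<psi>0"
    and "problem_mendable (bdd_tree \<Delta>) \<psi>0 T"
    and "(\<lambda>n. real (T n)) \<in> o(\<lambda>n. real n)"
  shows "\<exists>T'. problem_mendable (bdd_tree \<Delta>) \<psi>0 T' \<and>
           (\<lambda>n. real (T' n)) \<in> O(\<lambda>n. ln (real n))"
proof -
  obtain r \<psi> where \<psi>: "verifier_for (bdd_tree \<Delta>) \<psi>0 r \<psi>" "verifier_mendable (bdd_tree \<Delta>) r \<psi> T"
    using assms(2) by (auto simp: problem_mendable_def)
  then interpret local_problem \<Delta> r \<psi> by unfold_locales (simp add: verifier_for_def)
  obtain d where "verifier_mendable (bdd_tree \<Delta>) r \<psi> (\<lambda>n. (3 * d + 2) * (floor_log n + 2))"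
    using logarithmic_mend[OF \<psi>(2) assms(3)] by blast
  then show ?thesis using \<psi>(1) floor_log_bigo unfolding problem_mendable_def by blast
qed

end
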